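(* Let $\mu_1,\mu_2>0$. For $\beta>0$ and $\lambda_1,\lambda_2>0$ consider the system $$ \begin{cases} -\Delta u+\lambda_1u=\mu_1 u^3+\beta uv^2,\\ -\Delta v+\lambda_2v=\mu_2 v^3+\beta vu^2, \end{cases}\quad\text{in }\mathbb{R}^3.\tag{$*$} $$ a) For $\beta\ge\mu_1$ there exists $\eta_1(\beta)>0$ such that $( * )$ has no positive solution if $\frac{\lambda_1}{\lambda_2}>\eta_1(\beta)$. b) For $\beta\ge\mu_2$ there exists $\eta_2(\beta)>0$ such that $( * )$ has no positive solution if $\frac{\lambda_1}{\lambda_2}<\eta_2(\beta)$.
   Context: A positive solution is a solution $(u,v)$ with $u,v\in H^1(\mathbb{R}^3)$ and $u>0$, $v>0$ in $\mathbb{R}^3$. The numbers $\eta_1(\beta),\eta_2(\beta)$ may also depend on the fixed parameters $\mu_1,\mu_2$. *)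

theory Defs
  imports "HOL-Analysis.Analysis"
begin

definition grad :: "('a::euclidean_space \<Rightarrow> real) \<Rightarrow> 'a \<Rightarrow> 'a" where
  "grad f x = (\<Sum>i\<in>Basis. frechet_derivative f (at x) i *\<^sub>R i)"

primrec C_k :: "nat \<Rightarrow> ('a::euclidean_space \<Rightarrow> real) \<Rightarrow> bool" where
  "C_k 0 f \<longleftrightarrow> continuous_on UNIV f"
| "C_k (Suc k) f \<longleftrightarrow>
    (\<forall>x. f differentiable (at x)) \<and> (\<forall>i\<in>Basis. C_k k (\<lambda>x. frechet_derivative f (at x) i))"

definition test_functions :: "('a::euclidean_space \<Rightarrow> real) set" where
  "test_functions = {\<phi>. (\<forall>k. C_k k \<phi>) \<and> compact (closure {x. \<phi> x \<noteq> 0})}"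

(* Elements of L2 and H1 are functions rather than classes modulo null sets; everything
   below is invariant under changing them on a null set. *)

definition L2 :: "('a::euclidean_space \<Rightarrow> 'b::euclidean_space) set" where
  "L2 = {f. f \<in> borel_measurable lebesgue \<and> integrable lebesgue (\<lambda>x. (norm (f x))\<^sup>2)}"

(* Intended for u and G in L2 (or at least locally integrable), where both integrals converge. *)

definition weak_gradient :: "('a::euclidean_space \<Rightarrow> real) \<Rightarrow> ('a \<Rightarrow> 'a) \<Rightarrow> bool" where
  "weak_gradient u G \<longleftrightarrow>
    (\<forall>\<phi>\<in>test_functions.
      (LINT x|lebesgue. u x *\<^sub>R grad \<phi> x) = - (LINT x|lebesgue. \<phi> x *\<^sub>R G x))"

definition H1 :: "('a::euclidean_space \<Rightarrow> real) set" where
  "H1 = {u \<in> L2. \<exists>G\<in>L2. weak_gradient u G}"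

(* u is a weak solution of  - Laplace u + lam * u = h.  The weak gradient G is unique up to
   null sets.  Intended for locally integrable h; the cubic right-hand sides below are locally
   integrable for u, v in H1, since H1 embeds into L^6 in dimension 3. *)

definition weak_solution :: "real \<Rightarrow> ('a::euclidean_space \<Rightarrow> real) \<Rightarrow> ('a \<Rightarrow> real) \<Rightarrow> bool" where
  "weak_solution lam h u \<longleftrightarrow>
    u \<in> H1 \<and>
    (\<exists>G\<in>L2. weak_gradient u G \<and>
      (\<forall>\<phi>\<in>test_functions.
        (LINT x|lebesgue. G x \<bullet> grad \<phi> x) + lam * (LINT x|lebesgue. u x * \<phi> x)
          = (LINT x|lebesgue. h x * \<phi> x)))"

definition solution ::
    "real \<Rightarrow> real \<Rightarrow> real \<Rightarrow> real \<Rightarrow> real \<Rightarrow> (real^3 \<Rightarrow> real) \<Rightarrow> (real^3 \<Rightarrow> real) \<Rightarrow> bool" where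
  "solution \<mu>1 \<mu>2 \<beta> lam1 lam2 u v \<longleftrightarrow>
    weak_solution lam1 (\<lambda>x. \<mu>1 * u x ^ 3 + \<beta> * u x * (v x)\<^sup>2) u \<and>
    weak_solution lam2 (\<lambda>x. \<mu>2 * v x ^ 3 + \<beta> * v x * (u x)\<^sup>2) v"

definition positive_solution ::
    "real \<Rightarrow> real \<Rightarrow> real \<Rightarrow> real \<Rightarrow> real \<Rightarrow> (real^3 \<Rightarrow> real) \<Rightarrow> (real^3 \<Rightarrow> real) \<Rightarrow> bool" where
  "positive_solution \<mu>1 \<mu>2 \<beta> lam1 lam2 u v \<longleftrightarrow>
    solution \<mu>1 \<mu>2 \<beta> lam1 lam2 u v \<and>
    u \<in> H1 \<and> v \<in> H1 \<and>
    (AE x in lebesgue. u x > 0) \<and> (AE x in lebesgue. v x > 0)"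

end

theory Submission
  imports Defs
begin

text \<open>
  It suffices to treat part a), since exchanging \<open>u\<close> and \<open>v\<close> turns it into part b).
  Write the equations as \<open>-\<Delta>u + \<lambda>1 u = W1 u\<close> and \<open>-\<Delta>v + \<lambda>2 v = W2 v\<close> with \<open>W1 = \<mu>1 u\<^sup>2 + \<beta> v\<^sup>2\<close>
  and \<open>W2 = \<mu>2 v\<^sup>2 + \<beta> u\<^sup>2\<close>. As \<open>v\<close> is a positive solution of the second equation, the quadratic form
  of \<open>-\<Delta> + \<lambda>2 - W2\<close> is nonnegative at \<open>u\<close>; subtracting the energy identity of the first equation
  and using \<open>\<beta> \<ge> \<mu>1\<close> gives \<open>(\<lambda>1 - \<lambda>2) \<integral> u\<^sup>2 \<le> \<beta> \<integral> u\<^sup>2 v\<^sup>2\<close>.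

  The cubic power is the critical exponent of the Liouville theorem for supersolutions in
  dimension three. Hence \<open>-\<Delta>v + \<lambda>2 v \<ge> \<mu>2 v\<^sup>3\<close> forces the integral of \<open>v\<^sup>3\<close> over balls of radius \<open>r\<close> to tend
  to zero as \<open>r\<surd>\<lambda>2\<close> does, uniformly in \<open>v\<close>. Therefore the potential \<open>v\<^sup>2\<close> is a small form perturbation at
  the scale \<open>1/\<surd>\<lambda>1\<close>, and the same argument applied to \<open>u\<close> bounds \<open>\<integral> W1 u\<^sup>2\<close> by a multiple of
  \<open>\<lambda>1 \<integral> u\<^sup>2\<close>. If \<open>\<lambda>1/\<lambda>2\<close> is large, then \<open>\<beta> \<integral> u\<^sup>2 v\<^sup>2\<close> is smaller than \<open>(\<lambda>1 - \<lambda>2) \<integral> u\<^sup>2\<close>, a contradiction.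

  All form inequalities are written in dual form, with the resolvent \<open>(-\<Delta> + \<lambda>)\<^sup>-\<^sup>1\<close> given by the heat
  kernel: they reduce to Tonelli's theorem, the Schur test with a supersolution as weight, and the
  semigroup property.
\<close>

section \<open>Smooth functions and cutoffs\<close>

text \<open>Nothing is known about a solution beyond the weak equation, so after the passage to
  resolvents only integrals of nonnegative functions in \<open>ennreal\<close> are compared.
  Finiteness has to be earned wherever a term is cancelled: by truncating the potential and by the
  energy bound. All inequalities behind the contradiction are instances of one: if g > 0 satisfies
  resolvent(V g) \<le> \<delta> g and u is the resolvent of h, then the integral of V u^2 is at most
  \<delta> times that of h u. To compare the two equations, g is v and \<delta> is 1. For small
  \<delta> the weight v is useless, since the equation bounds the resolvent of v^3 by v only with
  the fixed factor 1 / \<mu>2. The weight sqrt v plus a constant is used instead: v^2 sqrt v is of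
  lower order than v^3, which leaves room to interpolate with the small local mass. The mass of u is
  small only at a scale finer than 1 / sqrt lam1 by a fixed factor, which costs a factor A in the
  bound for the u^4 term. The constant for v^2 is therefore fixed after A, and the threshold for the
  ratio last.\<close>

definition smooth :: "('a::euclidean_space \<Rightarrow> real) \<Rightarrow> bool" where
  "smooth f \<longleftrightarrow> (\<forall>k. C_k k f)"

abbreviation pd :: "('a::euclidean_space \<Rightarrow> real) \<Rightarrow> 'a \<Rightarrow> 'a \<Rightarrow> real" where
  "pd f i x \<equiv> frechet_derivative f (at x) i"

lemma C_k_SucI:
  assumes "\<And>x. (f has_derivative f' x) (at x)"
    and "\<And>i. i \<in> Basis \<Longrightarrow> C_k k (\<lambda>x. f' x i)"
  shows "C_k (Suc k) f"
proof -
  have "frechet_derivative f (at x) = f' x" for x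
    using assms(1) frechet_derivative_at by metis
  with assms show ?thesis
    by (auto simp: differentiable_def)
qed

lemma C_k_Suc_derivative:
  assumes "C_k (Suc k) f"
  shows "(f has_derivative frechet_derivative f (at x)) (at x)"
  using assms frechet_derivative_works by auto

lemma pd_eqI: "(f has_derivative f') (at x) \<Longrightarrow> pd f i x = f' i"
  by (simp add: frechet_derivative_at[symmetric])

lemma C_k_Suc_imp:
  "C_k (Suc k) f \<Longrightarrow> C_k k f"
proof (induction k arbitrary: f)
  case 0
  then show ?case
    by (auto intro!: continuous_at_imp_continuous_on differentiable_imp_continuous_within)
next
  case (Suc k)
  then show ?case by (metis C_k.simps(2))
qed

lemma C_k_const: "C_k k (\<lambda>x. c)"
proof (induction k arbitrary: c)
  case (Suc k)
  show ?case
    by (rule C_k_SucI[where f' = "\<lambda>x i. 0"]) (auto intro: Suc)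
qed simp

lemma C_k_inner: "C_k k (\<lambda>x. x \<bullet> a)"
proof (cases k)
  case (Suc n)
  show ?thesis unfolding Suc
    by (rule C_k_SucI[where f' = "\<lambda>x i. i \<bullet> a"])
       (auto intro!: derivative_eq_intros C_k_const)
qed (auto intro!: continuous_intros)

lemma C_k_add:
  "C_k k f \<Longrightarrow> C_k k g \<Longrightarrow> C_k k (\<lambda>x. f x + g x)"
proof (induction k arbitrary: f g)
  case 0
  then show ?case by (auto intro!: continuous_intros)
next
  case (Suc k)
  show ?case
  proof (rule C_k_SucI)
    show "((\<lambda>x. f x + g x) has_derivative
        (\<lambda>i. frechet_derivative f (at x) i + frechet_derivative g (at x) i)) (at x)" for x
      by (intro derivative_intros C_k_Suc_derivative[OF Suc.prems(1)] C_k_Suc_derivative[OF Suc.prems(2)])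
  qed (use Suc in auto)
qed

lemma C_k_mult:
  "C_k k f \<Longrightarrow> C_k k g \<Longrightarrow> C_k k (\<lambda>x. f x * g x)"
proof (induction k arbitrary: f g)
  case 0
  then show ?case by (auto intro!: continuous_intros)
next
  case (Suc k)
  show ?case
  proof (rule C_k_SucI)
    show "((\<lambda>x. f x * g x) has_derivative
        (\<lambda>i. f x * frechet_derivative g (at x) i + frechet_derivative f (at x) i * g x)) (at x)" for x
      by (intro derivative_intros C_k_Suc_derivative[OF Suc.prems(1)] C_k_Suc_derivative[OF Suc.prems(2)])
    show "C_k k (\<lambda>x. f x * frechet_derivative g (at x) i + frechet_derivative f (at x) i * g x)"
      if "i \<in> Basis" for i
      using that Suc.prems
      by (intro C_k_add Suc.IH C_k_Suc_imp[OF Suc.prems(1)] C_k_Suc_imp[OF Suc.prems(2)]) auto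
  qed
qed

text \<open>The outer function is one member of a sequence closed under differentiation, so the
  chain rule can lead from \<open>F n\<close> to \<open>F (Suc n)\<close> inside one induction. The
  sequence is constant for \<open>exp\<close> and runs through \<open>bump_aux\<close> of changing
  polynomials for the bump.\<close>

lemma C_k_comp:
  fixes F :: "nat \<Rightarrow> real \<Rightarrow> real"
  assumes F: "\<And>n x. (F n has_real_derivative F (Suc n) x) (at x)"
  shows "C_k k q \<Longrightarrow> C_k k (\<lambda>x. F n (q x))"
proof (induction k arbitrary: n)
  case 0
  have "continuous_on UNIV (F n)"
    using F by (auto intro!: continuous_at_imp_continuous_on DERIV_isCont)
  with 0 show ?case by (auto intro: continuous_on_compose2)
next
  case (Suc k)
  show ?case
  proof (rule C_k_SucI)
    show "((\<lambda>x. F n (q x)) has_derivative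
        (\<lambda>i. F (Suc n) (q x) * frechet_derivative q (at x) i)) (at x)" for x
      using C_k_Suc_derivative[OF Suc.prems, of x] F[of n "q x"]
      by (auto intro: has_derivative_compose simp: has_field_derivative_def)
    show "C_k k (\<lambda>x. F (Suc n) (q x) * frechet_derivative q (at x) i)"
      if "i \<in> Basis" for i
      using that Suc.prems by (intro C_k_mult Suc.IH C_k_Suc_imp[OF Suc.prems]) auto
  qed
qed

lemma smooth_const: "smooth (\<lambda>x. c)"
  and smooth_inner: "smooth (\<lambda>x. x \<bullet> a)"
  and smooth_add: "smooth f \<Longrightarrow> smooth g \<Longrightarrow> smooth (\<lambda>x. f x + g x)"
  and smooth_mult: "smooth f \<Longrightarrow> smooth g \<Longrightarrow> smooth (\<lambda>x. f x * g x)"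
  by (auto simp: smooth_def C_k_const C_k_inner C_k_add C_k_mult)

lemma smooth_comp:
  assumes "\<And>n x. (F n has_real_derivative F (Suc n) x) (at x)" "smooth q"
  shows "smooth (\<lambda>x. F n (q x :: real))"
  using C_k_comp[of F _ q, OF assms(1)] assms(2) unfolding smooth_def by blast

lemma smooth_has_derivative:
  "smooth f \<Longrightarrow> (f has_derivative frechet_derivative f (at x)) (at x)"
  unfolding smooth_def by (rule C_k_Suc_derivative) (erule spec)

lemma smooth_pd: "smooth f \<Longrightarrow> i \<in> Basis \<Longrightarrow> smooth (pd f i)"
  unfolding smooth_def by (metis C_k.simps(2))

lemma smooth_continuous: "smooth f \<Longrightarrow> continuous_on S f"
  unfolding smooth_def by (metis C_k.simps(1) continuous_on_subset top_greatest)

lemma smooth_measurable [measurable_dest]: "smooth f \<Longrightarrow> f \<in> borel_measurable borel"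
  by (intro borel_measurable_continuous_onI smooth_continuous)

lemma smooth_norm_diff_sq:
  fixes a :: "'a::euclidean_space"
  shows "smooth (\<lambda>x. (norm (x - a))\<^sup>2)"
proof -
  have "smooth (\<lambda>x. (\<Sum>i\<in>J. (x \<bullet> i + - (a \<bullet> i)) * (x \<bullet> i + - (a \<bullet> i))))" if "finite J" for J :: "'a set"
    using that
    by (induction J) (simp_all del: add_uminus_conv_diff add: smooth_const smooth_add smooth_mult smooth_inner)
  moreover have "(norm (x - a))\<^sup>2 = (\<Sum>i\<in>Basis. (x \<bullet> i + - (a \<bullet> i)) * (x \<bullet> i + - (a \<bullet> i)))" for x
    unfolding power2_norm_eq_inner by (subst euclidean_inner) (simp add: inner_diff_left)
  ultimately show ?thesis by simp
qed

section \<open>A smooth bump function and the cutoffs built from it\<close>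

definition bump_aux :: "real poly \<Rightarrow> real \<Rightarrow> real" where
  "bump_aux p t = (if t > 0 then poly p (1 / t) * exp (- (1 / t)) else 0)"

lemma poly_times_exp_neg_tendsto_0:
  "((\<lambda>x::real. poly p x * exp (- x)) \<longlongrightarrow> 0) at_top"
proof -
  have "((\<lambda>x::real. \<Sum>i\<le>degree p. coeff p i * (x ^ i / exp x)) \<longlongrightarrow> (\<Sum>i\<le>degree p. coeff p i * 0)) at_top"
    by (intro tendsto_intros tendsto_power_div_exp_0)
  then show ?thesis
    by (simp add: poly_altdef sum_distrib_right sum_divide_distrib exp_minus field_simps)
qed

text \<open>For t > 0 this is the chain rule in x = 1/t: differentiating p(x) exp(-x) gives (p' -
  p)(x) exp(-x), and dx/dt = - x^2 contributes the factor \<open>monom 1 2\<close> and the sign. The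
  functions \<open>bump_aux p\<close> are thus closed under differentiation.\<close>

lemma bump_aux_deriv:
  "(bump_aux p has_real_derivative bump_aux (monom 1 2 * (p - pderiv p)) t) (at t)"
proof -
  consider "t > 0" | "t < 0" | "t = 0" by linarith
  then show ?thesis
  proof cases
    case 1
    have ev: "\<forall>\<^sub>F x in nhds t. bump_aux p x = poly p (1 / x) * exp (- (1 / x))"
      using eventually_nhds_in_open[of "{0<..}" t] 1
      by (auto elim!: eventually_mono simp: bump_aux_def)
    have "((\<lambda>x. poly p (1 / x) * exp (- (1 / x))) has_real_derivative
        bump_aux (monom 1 2 * (p - pderiv p)) t) (at t)"
      using 1
      by (auto intro!: derivative_eq_intros DERIV_chain'[where g = "poly p"] poly_DERIV
          simp: bump_aux_def poly_monom field_simps power2_eq_square)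
    then show ?thesis
      using DERIV_cong_ev[OF refl ev refl] by blast
  next
    case 2
    have ev: "\<forall>\<^sub>F x in nhds t. bump_aux p x = 0"
      using eventually_nhds_in_open[of "{..<0}" t] 2
      by (auto elim!: eventually_mono simp: bump_aux_def)
    have "((\<lambda>x. 0) has_real_derivative bump_aux (monom 1 2 * (p - pderiv p)) t) (at t)"
      using 2 by (simp add: bump_aux_def)
    then show ?thesis
      using DERIV_cong_ev[OF refl ev refl] by blast
  next
    case 3
    have R: "((\<lambda>h. bump_aux p h / h) \<longlongrightarrow> 0) (at_right 0)"
    proof -
      \<comment> \<open>With x = 1/h the difference quotient at 0 is x p(x) exp(-x), and
        \<open>pCons 0 p\<close> is the polynomial x p(x).\<close>
      have "((\<lambda>h. poly (pCons 0 p) (inverse h) * exp (- inverse h)) \<longlongrightarrow> 0) (at_right (0::real))"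
        by (rule filterlim_compose[OF poly_times_exp_neg_tendsto_0 filterlim_inverse_at_top_right])
      moreover have "\<forall>\<^sub>F h in at_right (0::real). bump_aux p h / h
          = poly (pCons 0 p) (inverse h) * exp (- inverse h)"
        unfolding eventually_at_right_field
        by (intro exI[of _ 1]) (auto simp: bump_aux_def field_simps)
      ultimately show ?thesis using tendsto_cong by fast
    qed
    have L: "((\<lambda>h. bump_aux p h / h) \<longlongrightarrow> 0) (at_left 0)"
    proof -
      have "\<forall>\<^sub>F h in at_left (0::real). bump_aux p h / h = 0"
        unfolding eventually_at_left_field
        by (intro exI[of _ "-1"]) (auto simp: bump_aux_def)
      then show ?thesis by (simp add: tendsto_eventually)
    qed
    show ?thesis
      using filterlim_split_at[OF L R] 3 by (simp add: DERIV_def bump_aux_def)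
  qed
qed

text \<open>The factor \<open>exp 1\<close> normalises the value at 0 to 1, so that the dilates used
  as cutoffs converge to 1 pointwise.\<close>

definition bump :: "'a::euclidean_space \<Rightarrow> real" where
  "bump x = exp 1 * bump_aux 1 (1 - (norm x)\<^sup>2)"

lemma smooth_bump_scaled:
  fixes c :: real
  shows "smooth (\<lambda>x::'a::euclidean_space. bump (c *\<^sub>R x))"
proof -
  \<comment> \<open>The polynomial reached after n differentiations of exp(-1/t).\<close>
  define P where "P n = ((\<lambda>p. monom 1 2 * (p - pderiv p)) ^^ n) (1 :: real poly)" for n
  have "(bump_aux (P n) has_real_derivative bump_aux (P (Suc n)) t) (at t)" for n t
    using bump_aux_deriv by (simp add: P_def)
  moreover have "smooth (\<lambda>x::'a. 1 + (- c\<^sup>2) * (norm (x - 0))\<^sup>2)"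
    by (intro smooth_add smooth_mult smooth_const smooth_norm_diff_sq)
  ultimately have "smooth (\<lambda>x::'a. bump_aux (P 0) (1 + (- c\<^sup>2) * (norm (x - 0))\<^sup>2))"
    by (rule smooth_comp)
  then have "smooth (\<lambda>x::'a. exp 1 * bump_aux (P 0) (1 + (- c\<^sup>2) * (norm (x - 0))\<^sup>2))"
    by (intro smooth_mult smooth_const)
  then show ?thesis
    by (simp add: P_def bump_def power_mult_distrib)
qed

lemma bump_bounds: "0 \<le> bump x" "bump x \<le> 1"
proof -
  have "1 / (1 - (norm x)\<^sup>2) \<ge> 1" if "1 - (norm x)\<^sup>2 > 0"
    using that by (simp add: field_simps)
  then show "0 \<le> bump x" "bump x \<le> 1"
    by (auto simp: bump_def bump_aux_def simp flip: exp_add)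
qed

lemma bump_0 [simp]: "bump 0 = 1"
  by (simp add: bump_def bump_aux_def flip: exp_add)

lemma bump_eq_0:
  assumes "norm x \<ge> 1"
  shows "bump x = 0"
proof -
  have "\<not> 1 - (norm x)\<^sup>2 > 0"
    using one_le_power[OF assms, of 2] by linarith
  then show ?thesis unfolding bump_def bump_aux_def by (simp only: if_False mult_zero_right)
qed

text \<open>Every cutoff below is a dilate of \<open>bump\<close>, so one bound for its partial
  derivatives serves them all as a dominating constant.\<close>

lemma bump_pd_bounded:
  obtains C where "C \<ge> 0" "\<And>x::'a::euclidean_space. \<And>i. i \<in> Basis \<Longrightarrow> \<bar>pd bump i x\<bar> \<le> C"
proof -
  have sm: "smooth (bump :: 'a \<Rightarrow> real)"
    using smooth_bump_scaled[of 1] by simp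
  have "\<exists>C. \<forall>x\<in>cball 0 1. \<bar>pd bump i x\<bar> \<le> C" if i: "i \<in> Basis" for i :: 'a
  proof -
    have "compact (pd bump i ` cball 0 1)"
      by (intro compact_continuous_image smooth_continuous smooth_pd sm i) auto
    then show ?thesis
      by (auto dest!: compact_imp_bounded simp: bounded_iff)
  qed
  then obtain C where C: "\<And>i x. i \<in> Basis \<Longrightarrow> x \<in> cball 0 1 \<Longrightarrow> \<bar>pd bump i (x::'a)\<bar> \<le> C i"
    by metis
  define D where "D = (\<Sum>i\<in>(Basis::'a set). \<bar>C i\<bar>)"
  have D: "\<bar>C i\<bar> \<le> D" if "i \<in> Basis" for i :: 'a
    unfolding D_def by (rule member_le_sum) (use that in auto)
  have "\<bar>pd bump i x\<bar> \<le> D" if i: "i \<in> Basis" for i x :: 'a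
  proof (cases "norm x \<le> 1")
    case True
    then show ?thesis using C[OF i, of x] D[OF i] by auto
  next
    case False
    have "(bump has_derivative (\<lambda>_. 0)) (at x)"
      by (rule has_derivative_transform_within_open[of "\<lambda>_. 0" _ _ _ "- cball 0 1"])
         (use False in \<open>auto simp: bump_eq_0\<close>)
    then have "pd bump i x = 0"
      by (rule pd_eqI)
    moreover have "D \<ge> 0" by (simp add: D_def sum_nonneg)
    ultimately show ?thesis by simp
  qed
  moreover have "D \<ge> 0" by (simp add: D_def sum_nonneg)
  ultimately show ?thesis using that by blast
qed

lemma pd_mult:
  assumes "smooth f" "smooth g"
  shows "pd (\<lambda>x. f x * g x) i x = f x * pd g i x + pd f i x * g x"
proof -
  have "((\<lambda>x. f x * g x) has_derivative (\<lambda>i. f x * pd g i x + pd f i x * g x)) (at x)"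
    by (rule has_derivative_mult[OF assms[THEN smooth_has_derivative]])
  then show ?thesis by (rule pd_eqI)
qed

lemma pd_bump_scaled:
  "pd (\<lambda>x::'a::euclidean_space. bump (c *\<^sub>R x)) i x = c * pd bump i (c *\<^sub>R x)"
proof -
  have sm: "smooth (bump :: 'a \<Rightarrow> real)"
    using smooth_bump_scaled[of 1] by simp
  have D: "(bump has_derivative frechet_derivative bump (at (c *\<^sub>R x))) (at (c *\<^sub>R x))"
    by (rule smooth_has_derivative[OF sm])
  have "((\<lambda>x::'a. bump (c *\<^sub>R x)) has_derivative (\<lambda>i. frechet_derivative bump (at (c *\<^sub>R x)) (c *\<^sub>R i))) (at x)"
    by (rule has_derivative_compose[where f = "\<lambda>x. c *\<^sub>R x", OF _ D]) (intro derivative_intros)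
  moreover have "frechet_derivative bump (at (c *\<^sub>R x)) (c *\<^sub>R i) = c * pd bump i (c *\<^sub>R x)"
    using linear_cmul[OF has_derivative_linear[OF D]] by simp
  ultimately show ?thesis by (simp add: pd_eqI)
qed

lemma test_function_cutoff:
  fixes f :: "'a::euclidean_space \<Rightarrow> real"
  assumes "smooth f" "c > 0"
  shows "(\<lambda>x. bump (c *\<^sub>R x) * f x) \<in> test_functions"
proof -
  have "{x. bump (c *\<^sub>R x) * f x \<noteq> 0} \<subseteq> cball 0 (1 / c)"
  proof
    fix x assume "x \<in> {x. bump (c *\<^sub>R x) * f x \<noteq> 0}"
    then have "\<not> norm (c *\<^sub>R x) \<ge> 1" using bump_eq_0 by fastforce
    then show "x \<in> cball 0 (1 / c)" using \<open>c > 0\<close> by (simp add: field_simps)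
  qed
  then have "compact (closure {x. bump (c *\<^sub>R x) * f x \<noteq> 0})"
    by (metis bounded_cball bounded_subset compact_closure)
  moreover have "smooth (\<lambda>x. bump (c *\<^sub>R x) * f x)"
    by (intro smooth_mult smooth_bump_scaled assms)
  ultimately show ?thesis by (simp add: test_functions_def smooth_def)
qed

section \<open>The heat kernel\<close>

lemma nn_integral_lborel_affine:
  fixes f :: "'a::euclidean_space \<Rightarrow> ennreal"
  assumes [measurable]: "f \<in> borel_measurable borel" and "c \<noteq> 0"
  shows "(\<integral>\<^sup>+x. f x \<partial>lborel) = ennreal (\<bar>c\<bar> ^ DIM('a)) * (\<integral>\<^sup>+x. f (t + c *\<^sub>R x) \<partial>lborel)"
  by (subst lborel_affine[OF \<open>c \<noteq> 0\<close>, of t])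
     (simp add: nn_integral_density nn_integral_distr nn_integral_cmult)

lemma distr_lborel_reflect: "distr lborel borel (\<lambda>y. x - y) = (lborel :: 'a::euclidean_space measure)"
  using lborel_affine[of "-1" x] by (simp add: density_1)

lemma nn_integral_lborel_reflect:
  fixes f :: "'a::euclidean_space \<Rightarrow> ennreal"
  assumes [measurable]: "f \<in> borel_measurable borel"
  shows "(\<integral>\<^sup>+y. f (x - y) \<partial>lborel) = (\<integral>\<^sup>+y. f y \<partial>lborel)"
  using nn_integral_lborel_affine[of f "-1" x] by simp

lemma nn_integral_lborel_shift:
  fixes f :: "'a::euclidean_space \<Rightarrow> ennreal"
  assumes [measurable]: "f \<in> borel_measurable borel"
  shows "(\<integral>\<^sup>+y. f (y - x) \<partial>lborel) = (\<integral>\<^sup>+y. f y \<partial>lborel)"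
  using nn_integral_lborel_affine[of f 1 "-x"] by (simp add: add.commute)

lemma integrable_lborel_reflect:
  fixes f :: "'a::euclidean_space \<Rightarrow> real"
  assumes "integrable lborel f"
  shows "integrable lborel (\<lambda>y. f (x - y))"
proof -
  have "integrable (distr lborel borel (\<lambda>y. x - y)) f"
    using assms by (simp only: distr_lborel_reflect)
  moreover have "f \<in> borel_measurable borel"
    using assms by (simp add: borel_measurable_integrable[of lborel, simplified])
  ultimately show ?thesis by (subst (asm) integrable_distr_eq) auto
qed

section \<open>Tail integrals and Gaussian moments in dimension three\<close>

lemma emeasure_ball_R3:
  "r \<ge> 0 \<Longrightarrow> emeasure lborel (ball (x :: real^3) r) = ennreal (4 / 3 * pi * r ^ 3)"
  by (simp add: emeasure_ball unit_ball_vol_3)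

lemma nn_integral_powr_tail:
  fixes a \<rho> :: real
  assumes "a > 1" "\<rho> > 0"
  shows "(\<integral>\<^sup>+t. ennreal (t powr - a) * indicator {\<rho>..} t \<partial>lborel) = ennreal (\<rho> powr (1 - a) / (a - 1))"
proof -
  have "(\<integral>\<^sup>+t. ennreal (t powr - a) * indicator {\<rho>..} t \<partial>lborel)
      = ennreal (0 - (- (\<rho> powr (1 - a)) / (a - 1)))"
  proof (rule nn_integral_FTC_atLeast)
    show "((\<lambda>t. - (t powr (1 - a)) / (a - 1)) has_real_derivative t powr - a) (at t)" if "\<rho> \<le> t" for t
    proof -
      have "((\<lambda>t. - (t powr (1 - a)) / (a - 1)) has_real_derivative
          - ((1 - a) * t powr (1 - a - 1)) / (a - 1)) (at t)"
        using that assms by (intro derivative_eq_intros has_real_derivative_powr) auto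
      moreover have "- ((1 - a) * t powr (1 - a - 1)) / (a - 1) = t powr - a"
        using assms by (simp add: field_simps)
      ultimately show ?thesis by simp
    qed
    show "((\<lambda>t. - (t powr (1 - a)) / (a - 1)) \<longlongrightarrow> 0) at_top"
    proof -
      have "((\<lambda>t. t powr (1 - a)) \<longlongrightarrow> 0) at_top"
        using assms by (intro tendsto_neg_powr filterlim_ident) auto
      then have "((\<lambda>t. - (t powr (1 - a)) / (a - 1)) \<longlongrightarrow> - 0 / (a - 1)) at_top"
        using assms by (intro tendsto_intros) auto
      then show ?thesis by simp
    qed
  qed auto
  then show ?thesis by simp
qed

text \<open>Layer-cake integration in place of polar coordinates: \<open>norm z powr - a\<close> is
  \<open>a\<close> times the integral of \<open>t powr - (a + 1)\<close> over t \<ge> norm z, and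
  exchanging the integrals leaves volumes of balls. Using full balls instead of shells costs only a
  constant.\<close>

lemma nn_integral_norm_powr_tail:
  fixes a \<rho> :: real
  assumes "a > 3" "\<rho> > 0"
  shows "(\<integral>\<^sup>+z. ennreal (norm z powr - a) * indicator {\<rho>..} (norm z) \<partial>(lborel :: (real^3) measure))
    \<le> ennreal (a * (4 / 3 * pi) / (a - 3) * \<rho> powr (3 - a))"
proof -
  have "(\<integral>\<^sup>+z. ennreal (norm z powr - a) * indicator {\<rho>..} (norm z) \<partial>(lborel :: (real^3) measure))
      \<le> (\<integral>\<^sup>+(z::real^3). (\<integral>\<^sup>+t. (a * ennreal (t powr - (a + 1)) * indicator {\<rho>..} t) * indicator {t. norm z \<le> t} t \<partial>lborel) \<partial>lborel)"
  proof (rule nn_integral_mono)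
    fix z :: "real^3"
    show "ennreal (norm z powr - a) * indicator {\<rho>..} (norm z)
      \<le> (\<integral>\<^sup>+t. (a * ennreal (t powr - (a + 1)) * indicator {\<rho>..} t) * indicator {t. norm z \<le> t} t \<partial>lborel)"
    proof (cases "\<rho> \<le> norm z")
      case True
      have "(\<integral>\<^sup>+t. (a * ennreal (t powr - (a + 1)) * indicator {\<rho>..} t) * indicator {t. norm z \<le> t} t \<partial>lborel)
        = (\<integral>\<^sup>+t. a * (ennreal (t powr - (a + 1)) * indicator {norm z..} t) \<partial>lborel)"
        using True by (intro nn_integral_cong) (auto split: split_indicator)
      also have "\<dots> = a * ennreal (norm z powr (1 - (a + 1)) / ((a + 1) - 1))"
        using assms True by (subst nn_integral_cmult) (simp_all only: nn_integral_powr_tail[of "a + 1" "norm z"], auto)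
      also have "\<dots> = ennreal (norm z powr - a)"
        using assms by (simp flip: ennreal_mult')
      finally show ?thesis using True by simp
    qed simp
  qed
  also have "\<dots> = (\<integral>\<^sup>+t. (\<integral>\<^sup>+(z::real^3). (a * ennreal (t powr - (a + 1)) * indicator {\<rho>..} t) * indicator {t. norm z \<le> t} t \<partial>lborel) \<partial>lborel)"
    by (rule lborel_pair.Fubini') measurable
  also have "\<dots> = (\<integral>\<^sup>+t. (a * ennreal (t powr - (a + 1)) * indicator {\<rho>..} t) * emeasure lborel (cball (0::real^3) t) \<partial>lborel)"
  proof (rule nn_integral_cong)
    fix t :: real
    have "(\<integral>\<^sup>+(z::real^3). (a * ennreal (t powr - (a + 1)) * indicator {\<rho>..} t) * indicator {t. norm z \<le> t} t \<partial>lborel)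
      = (\<integral>\<^sup>+(z::real^3). (a * ennreal (t powr - (a + 1)) * indicator {\<rho>..} t) * indicator (cball 0 t) z \<partial>lborel)"
      by (intro nn_integral_cong) (auto split: split_indicator)
    then show "(\<integral>\<^sup>+(z::real^3). (a * ennreal (t powr - (a + 1)) * indicator {\<rho>..} t) * indicator {t. norm z \<le> t} t \<partial>lborel)
      = (a * ennreal (t powr - (a + 1)) * indicator {\<rho>..} t) * emeasure lborel (cball (0::real^3) t)"
      by (simp add: nn_integral_cmult_indicator)
  qed
  also have "\<dots> = (\<integral>\<^sup>+t. ennreal (a * (4 / 3 * pi)) * (ennreal (t powr - (a - 2)) * indicator {\<rho>..} t) \<partial>lborel)"
  proof (rule nn_integral_cong)
    fix t :: real
    show "(a * ennreal (t powr - (a + 1)) * indicator {\<rho>..} t) * emeasure lborel (cball (0::real^3) t)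
      = ennreal (a * (4 / 3 * pi)) * (ennreal (t powr - (a - 2)) * indicator {\<rho>..} t)"
    proof (cases "t \<ge> \<rho>")
      case True
      then have t: "t > 0" using assms by simp
      have "t powr - (a + 1) * t ^ 3 = t powr - (a + 1) * t powr 3"
        using t by (simp only: powr_numeral)
      also have "\<dots> = t powr - (a - 2)"
        by (simp only: powr_add[symmetric]) simp
      finally have *: "t powr - (a + 1) * t ^ 3 = t powr - (a - 2)" .
      have "(a * ennreal (t powr - (a + 1)) * indicator {\<rho>..} t) * emeasure lborel (cball (0::real^3) t)
        = ennreal (a * t powr - (a + 1) * (4 / 3 * pi * t ^ 3))"
        using True t assms
        by (simp add: emeasure_cball[OF less_imp_le[OF t]] unit_ball_vol_3 ennreal_mult'[symmetric] mult.assoc)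
      also have "a * t powr - (a + 1) * (4 / 3 * pi * t ^ 3) = (a * (4 / 3 * pi)) * t powr - (a - 2)"
        by (simp only: *[symmetric] mult_ac)
      finally show ?thesis
        using True t assms ennreal_mult'[of "a * (4 / 3 * pi)" "t powr - (a - 2)"] by simp
    qed simp
  qed
  also have "\<dots> = ennreal (a * (4 / 3 * pi)) * ennreal (\<rho> powr (1 - (a - 2)) / ((a - 2) - 1))"
    using assms by (subst nn_integral_cmult) (auto simp del: minus_diff_eq simp: nn_integral_powr_tail)
  also have "\<dots> = ennreal (a * (4 / 3 * pi) / (a - 3) * \<rho> powr (3 - a))"
    using assms by (simp flip: ennreal_mult')
  finally show ?thesis .
qed

text \<open>A single term of the exponential series of c r^2, the other terms being
  nonnegative.\<close>

lemma power_gauss_bound: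
  fixes r c :: real
  assumes "c > 0"
  shows "r ^ (2 * n) * exp (- (c * r\<^sup>2)) \<le> fact n / c ^ n"
proof -
  have "(c * r\<^sup>2) ^ n / fact n \<le> exp (c * r\<^sup>2)"
  proof -
    have "(\<Sum>k\<in>{n}. (c * r\<^sup>2) ^ k / fact k) \<le> (\<Sum>k. (c * r\<^sup>2) ^ k / fact k)"
      using summable_exp_generic[of "c * r\<^sup>2"] assms
      by (intro sum_le_suminf) (auto simp: field_simps)
    then show ?thesis by (simp add: exp_def field_simps)
  qed
  then show ?thesis
    using assms by (simp add: exp_minus field_simps power_mult_distrib flip: power_mult)
qed

lemma integrable_power_gauss:
  assumes "c > 0"
  shows "integrable lborel (\<lambda>z::real^3. norm z ^ (2 * n) * exp (- (c * (norm z)\<^sup>2)))"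
proof (rule integrableI_nonneg)
  \<comment> \<open>The first summand bounds the integrand on the unit ball. The second comes from
    four extra powers of \<open>norm z\<close> and gives the decay \<open>norm z powr - 4\<close>,
    integrable at infinity in dimension three.\<close>
  define B where "B = fact n / c ^ n + fact (n + 2) / c ^ (n + 2)"
  have B: "B > 0" using assms by (auto simp: B_def intro!: add_pos_pos)
  let ?f = "\<lambda>z::real^3. norm z ^ (2 * n) * exp (- (c * (norm z)\<^sup>2))"
  have le: "ennreal (?f z) \<le> ennreal B * indicator (ball 0 1) z
      + ennreal B * (ennreal (norm z powr - 4) * indicator {1..} (norm z))" for z
  proof (cases "norm z < 1")
    case True
    have "?f z \<le> B"
      using power_gauss_bound[OF assms, of "norm z" n] assms by (simp add: B_def add_increasing2)
    with True show ?thesis by (simp add: ennreal_leI)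
  next
    case False
    have "norm z ^ (2 * (n + 2)) = norm z ^ (2 * n) * norm z ^ 4"
      by (simp only: distrib_left power_add) simp
    then have "?f z * norm z ^ 4 \<le> fact (n + 2) / c ^ (n + 2)"
      using power_gauss_bound[OF assms, of "norm z" "n + 2"] by (simp only: mult_ac)
    also have "\<dots> \<le> B" using assms by (simp add: B_def del: power_add fact_Suc)
    finally have "?f z * norm z ^ 4 \<le> B" .
    moreover have "norm z powr - 4 = 1 / norm z ^ 4" "norm z ^ 4 > 0"
      using False by (auto intro!: powr_neg_numeral zero_less_power)
    ultimately have "?f z \<le> B * norm z powr - 4"
      by (simp add: pos_le_divide_eq)
    with False show ?thesis
      using B by (simp add: ennreal_leI flip: ennreal_mult')
  qed
  have "(\<integral>\<^sup>+z. ?f z \<partial>lborel) \<le> (\<integral>\<^sup>+z. ennreal B * indicator (ball (0::real^3) 1) z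
      + ennreal B * (ennreal (norm z powr - 4) * indicator {1..} (norm z)) \<partial>lborel)"
    by (rule nn_integral_mono) (rule le)
  also have "\<dots> = ennreal B * emeasure lborel (ball (0::real^3) 1)
      + ennreal B * (\<integral>\<^sup>+z. (ennreal (norm z powr - 4) * indicator {1..} (norm z)) \<partial>(lborel :: (real^3) measure))"
    by (subst nn_integral_add)
       (auto simp: nn_integral_cmult nn_integral_cmult_indicator intro!: borel_measurable_times_ennreal borel_measurable_indicator)
  also have "\<dots> < \<infinity>"
    using nn_integral_norm_powr_tail[of 4 1]
    by (auto simp: emeasure_ball_R3 ennreal_mult_less_top intro: le_less_trans)
  finally show "(\<integral>\<^sup>+z. ?f z \<partial>lborel) < \<infinity>" .
qed auto

text \<open>Equal to (4 pi) powr (3/2). Left as an integral, it makes the total mass of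
  \<open>heat\<close> equal to 1 by scaling alone.\<close>

definition gauss_mass :: real where
  "gauss_mass = (LINT z|(lborel :: (real^3) measure). exp (- ((norm z)\<^sup>2 / 4)))"

definition heat :: "real \<Rightarrow> real^3 \<Rightarrow> real" where
  "heat t z = t powr (- 3 / 2) * exp (- ((norm z)\<^sup>2 / (4 * t))) / gauss_mass"

lemma integrable_gauss: "c > 0 \<Longrightarrow> integrable lborel (\<lambda>z::real^3. exp (- ((norm z)\<^sup>2 / c)))"
  using integrable_power_gauss[of "1 / c" 0] by simp

lemma gauss_mass_pos: "gauss_mass > 0"
proof -
  have "gauss_mass \<noteq> 0"
  proof
    assume "gauss_mass = 0"
    then have "AE z in (lborel :: (real^3) measure). exp (- ((norm z)\<^sup>2 / 4)) = 0"
      unfolding gauss_mass_def using integrable_gauss[of 4]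
      by (subst (asm) integral_nonneg_eq_0_iff_AE) auto
    then have "AE z in (lborel :: (real^3) measure). False" by simp
    then show False by (simp add: AE_iff_null null_sets_def)
  qed
  moreover have "gauss_mass \<ge> 0" by (simp add: gauss_mass_def)
  ultimately show ?thesis by simp
qed

lemma heat_measurable [measurable]:
  "f \<in> borel_measurable M \<Longrightarrow> g \<in> borel_measurable M \<Longrightarrow> (\<lambda>x. heat (f x) (g x)) \<in> borel_measurable M"
  by (simp add: heat_def)

lemma heat_nonneg [simp]: "heat t z \<ge> 0"
  using gauss_mass_pos by (simp add: heat_def)

lemma heat_uminus [simp]: "heat t (- z) = heat t z"
  by (simp add: heat_def)

lemma heat_commute: "heat t (x - y) = heat t (y - x)"
  by (metis heat_uminus minus_diff_eq)

lemma nn_integral_heat: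
  assumes "t > 0"
  shows "(\<integral>\<^sup>+z. heat t z \<partial>lborel) = 1"
proof -
  define s where "s = sqrt t"
  have s: "s > 0" "t = s\<^sup>2" using assms by (auto simp: s_def)
  have sp: "t powr (- 3 / 2) = 1 / s ^ 3"
  proof -
    have "s powr (2 * (- 3 / 2)) = (s powr 2) powr (- 3 / 2)"
      by (rule powr_powr[symmetric])
    then have "t powr (- 3 / 2) = s powr (2 * (- 3 / 2))"
      using s by (simp only: powr_numeral)
    also have "\<dots> = 1 / s ^ 3"
      using s(1) by (simp add: powr_neg_numeral)
    finally show ?thesis .
  qed
  have "(\<integral>\<^sup>+z. heat t z \<partial>lborel) = ennreal (\<bar>s\<bar> ^ DIM(real^3)) * (\<integral>\<^sup>+z. heat t (0 + s *\<^sub>R z) \<partial>lborel)"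
    using s by (intro nn_integral_lborel_affine) auto
  also have "\<dots> = (\<integral>\<^sup>+z. ennreal (\<bar>s\<bar> ^ DIM(real^3)) * ennreal (heat t (0 + s *\<^sub>R z)) \<partial>lborel)"
    by (rule nn_integral_cmult[symmetric]) measurable
  also have "\<dots> = (\<integral>\<^sup>+z. ennreal (1 / gauss_mass) * exp (- ((norm (z::real^3))\<^sup>2 / 4)) \<partial>lborel)"
  proof (intro nn_integral_cong)
    fix z :: "real^3"
    have "(norm (s *\<^sub>R z))\<^sup>2 / (4 * t) = (norm z)\<^sup>2 / 4"
      using s by (simp add: power_mult_distrib)
    then have "s ^ 3 * heat t (s *\<^sub>R z) = 1 / gauss_mass * exp (- ((norm z)\<^sup>2 / 4))"
      using s(1) by (simp only: heat_def sp) simp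
    then show "ennreal (\<bar>s\<bar> ^ DIM(real^3)) * ennreal (heat t (0 + s *\<^sub>R z)) = ennreal (1 / gauss_mass) * ennreal (exp (- ((norm z)\<^sup>2 / 4)))"
      using s(1) gauss_mass_pos by (simp flip: ennreal_mult' add: ennreal_power)
  qed
  also have "\<dots> = ennreal (1 / gauss_mass) * ennreal gauss_mass"
    using integrable_gauss[of 4] unfolding gauss_mass_def
    by (subst nn_integral_cmult) (auto simp: nn_integral_eq_integral)
  also have "\<dots> = 1"
    using gauss_mass_pos by (simp flip: ennreal_mult')
  finally show ?thesis .
qed

lemma integrable_heat: "t > 0 \<Longrightarrow> integrable lborel (heat t)"
  using nn_integral_heat by (intro integrableI_nonneg) auto

lemma nn_integral_heat_shift:
  "t > 0 \<Longrightarrow> (\<integral>\<^sup>+y. heat t (x - y) \<partial>lborel) = 1"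
  using nn_integral_lborel_reflect[of "heat t" x] by (simp add: nn_integral_heat)

lemma heat_deriv_time:
  assumes "t > 0"
  shows "((\<lambda>t. heat t z) has_real_derivative ((norm z)\<^sup>2 / (4 * t\<^sup>2) - 3 / (2 * t)) * heat t z) (at t)"
proof -
  have "t powr (- 3 / 2 - 1) = t powr (- 3 / 2) / t"
    using assms by (subst powr_diff) simp
  then have *: "- 3 / 2 * t powr (- 3 / 2 - 1) = - 3 / (2 * t) * t powr (- 3 / 2)"
    using assms by simp
  have "((\<lambda>t. t powr (- 3 / 2)) has_real_derivative - 3 / (2 * t) * t powr (- 3 / 2)) (at t)"
    using has_real_derivative_powr[OF assms, of "- 3 / 2"] unfolding * .
  moreover have "((\<lambda>t. exp (- ((norm z)\<^sup>2 / (4 * t)))) has_real_derivative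
      exp (- ((norm z)\<^sup>2 / (4 * t))) * ((norm z)\<^sup>2 / (4 * t\<^sup>2))) (at t)"
    using assms by (auto intro!: derivative_eq_intros simp: field_simps power2_eq_square)
  ultimately have "((\<lambda>t. t powr (- 3 / 2) * exp (- ((norm z)\<^sup>2 / (4 * t))) / gauss_mass) has_real_derivative
      (t powr (- 3 / 2) * (exp (- ((norm z)\<^sup>2 / (4 * t))) * ((norm z)\<^sup>2 / (4 * t\<^sup>2)))
       + - 3 / (2 * t) * t powr (- 3 / 2) * exp (- ((norm z)\<^sup>2 / (4 * t)))) / gauss_mass) (at t)"
    by (intro DERIV_cdivide DERIV_mult')
  then show ?thesis
    by (simp add: heat_def algebra_simps diff_divide_distrib add_divide_distrib)
qed

lemma smooth_heat: "smooth (\<lambda>y. heat t (y - x))"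
proof -
  have "smooth (\<lambda>y. (t powr (- 3 / 2) / gauss_mass) * exp ((- 1 / (4 * t)) * (norm (y - x))\<^sup>2))"
    by (intro smooth_mult smooth_const smooth_comp[where F = "\<lambda>_. exp"] smooth_norm_diff_sq)
       (auto intro!: derivative_eq_intros)
  then show ?thesis by (simp add: heat_def)
qed

lemma heat_has_derivative:
  assumes "t > 0"
  shows "((\<lambda>y. heat t (y - x)) has_derivative (\<lambda>j. - ((y - x) \<bullet> j / (2 * t)) * heat t (y - x))) (at y)"
proof -
  have "((\<lambda>y. - (((y - x) \<bullet> (y - x)) / (4 * t))) has_derivative (\<lambda>j. - ((y - x) \<bullet> j / (2 * t)))) (at y)"
    using assms by (auto intro!: derivative_eq_intros ext simp: inner_commute field_simps)
  then have "((\<lambda>y. exp (- (((y - x) \<bullet> (y - x)) / (4 * t)))) has_derivative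
      (\<lambda>j. exp (- (((y - x) \<bullet> (y - x)) / (4 * t))) * - ((y - x) \<bullet> j / (2 * t)))) (at y)"
    by (rule has_derivative_compose) (simp add: DERIV_exp[unfolded has_field_derivative_def])
  then have "((\<lambda>y. (t powr (- 3 / 2) / gauss_mass) * exp (- (((y - x) \<bullet> (y - x)) / (4 * t)))) has_derivative
      (\<lambda>j. (t powr (- 3 / 2) / gauss_mass) * (exp (- (((y - x) \<bullet> (y - x)) / (4 * t))) * - ((y - x) \<bullet> j / (2 * t))))) (at y)"
    by (rule has_derivative_mult_right)
  then show ?thesis
    by (simp add: heat_def power2_norm_eq_inner mult_ac)
qed

lemma pd_heat:
  "t > 0 \<Longrightarrow> pd (\<lambda>y. heat t (y - x)) i y = - ((y - x) \<bullet> i / (2 * t)) * heat t (y - x)"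
  by (rule pd_eqI[OF heat_has_derivative])

lemma pd_pd_heat:
  assumes "t > 0" "i \<in> Basis"
  shows "pd (pd (\<lambda>y. heat t (y - x)) i) i y = (((y - x) \<bullet> i)\<^sup>2 / (4 * t\<^sup>2) - 1 / (2 * t)) * heat t (y - x)"
proof -
  have "((\<lambda>y. - ((y - x) \<bullet> i / (2 * t)) * heat t (y - x)) has_derivative
    (\<lambda>j. - ((y - x) \<bullet> i / (2 * t)) * (- ((y - x) \<bullet> j / (2 * t)) * heat t (y - x)) + (- (j \<bullet> i / (2 * t))) * heat t (y - x))) (at y)"
    using assms by (intro has_derivative_mult heat_has_derivative) (auto intro!: derivative_eq_intros)
  moreover have "(\<lambda>y. - ((y - x) \<bullet> i / (2 * t)) * heat t (y - x)) = pd (\<lambda>y. heat t (y - x)) i"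
    using assms by (simp add: pd_heat fun_eq_iff)
  ultimately have "pd (pd (\<lambda>y. heat t (y - x)) i) i y
    = - ((y - x) \<bullet> i / (2 * t)) * (- ((y - x) \<bullet> i / (2 * t)) * heat t (y - x)) + (- (i \<bullet> i / (2 * t))) * heat t (y - x)"
    by (simp add: pd_eqI)
  also have "\<dots> = (((y - x) \<bullet> i)\<^sup>2 / (4 * t\<^sup>2) - 1 / (2 * t)) * heat t (y - x)"
  proof -
    have "- (w / (2 * t)) * (- (w / (2 * t)) * h) + (- (1 / (2 * t))) * h = (w\<^sup>2 / (4 * t\<^sup>2) - 1 / (2 * t)) * h"
      for w h :: real
      using assms by (simp add: field_simps power2_eq_square)
    then show ?thesis using assms by simp
  qed
  finally show ?thesis .
qed

lemma heat_laplacian: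
  assumes "t > 0"
  shows "(\<Sum>i\<in>Basis. pd (pd (\<lambda>y. heat t (y - x)) i) i y)
    = ((norm (y - x))\<^sup>2 / (4 * t\<^sup>2) - 3 / (2 * t)) * heat t (y - x)"
proof -
  have "(\<Sum>i\<in>Basis. pd (pd (\<lambda>y. heat t (y - x)) i) i y)
    = ((\<Sum>i\<in>Basis. ((y - x) \<bullet> i) * ((y - x) \<bullet> i)) / (4 * t\<^sup>2) - (\<Sum>i\<in>(Basis::(real^3) set). 1 / (2 * t))) * heat t (y - x)"
  proof -
    have "(\<Sum>i\<in>Basis. pd (pd (\<lambda>y. heat t (y - x)) i) i y)
      = (\<Sum>i\<in>Basis. (((y - x) \<bullet> i)\<^sup>2 / (4 * t\<^sup>2) - 1 / (2 * t)) * heat t (y - x))"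
      using assms by (intro sum.cong refl pd_pd_heat)
    then show ?thesis
      by (simp only: sum_divide_distrib power2_eq_square sum_distrib_right[symmetric] sum_subtractf)
  qed
  then show ?thesis
    using assms by (simp add: power2_norm_eq_inner euclidean_inner[symmetric])
qed

text \<open>These moments put the Gaussians and their first and second derivatives into L2, so that
  they can be integrated against u and its weak gradient.\<close>

lemma integrable_power_heat_sq:
  assumes "t > 0"
  shows "integrable lborel (\<lambda>z. norm z ^ (2 * n) * (heat t z)\<^sup>2)"
proof -
  have "integrable lborel (\<lambda>z::real^3. (t powr (- 3 / 2) / gauss_mass)\<^sup>2 * (norm z ^ (2 * n) * exp (- (1 / (2 * t) * (norm z)\<^sup>2))))"
    using assms by (intro integrable_mult_right integrable_power_gauss) auto
  moreover have "(t powr (- 3 / 2) / gauss_mass)\<^sup>2 * (norm z ^ (2 * n) * exp (- (1 / (2 * t) * (norm z)\<^sup>2)))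
     = norm z ^ (2 * n) * (heat t z)\<^sup>2" for z :: "real^3"
  proof -
    have "(exp (- ((norm z)\<^sup>2 / (4 * t))))\<^sup>2 = exp (- (1 / (2 * t) * (norm z)\<^sup>2))"
      by (simp add: power2_eq_square flip: exp_add)
    then show ?thesis
      by (simp only: heat_def power_divide power_mult_distrib) simp
  qed
  ultimately show ?thesis by (simp only:)
qed

section \<open>Extending the weak formulation to Gaussians\<close>

lemma abs_mult_le_sum_squares: "\<bar>a * b\<bar> \<le> a\<^sup>2 + b\<^sup>2" for a b :: real
proof -
  have "2 * (\<bar>a\<bar> * \<bar>b\<bar>) \<le> a\<^sup>2 + b\<^sup>2" "0 \<le> \<bar>a\<bar> * \<bar>b\<bar>"
    using sum_squares_bound[of "\<bar>a\<bar>" "\<bar>b\<bar>"] by (simp_all add: mult.assoc)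
  then show ?thesis unfolding abs_mult by linarith
qed

lemma integrable_mult_of_squares:
  fixes f g :: "'a \<Rightarrow> real"
  assumes [measurable]: "f \<in> borel_measurable M" "g \<in> borel_measurable M"
    and "integrable M (\<lambda>x. (f x)\<^sup>2)" "integrable M (\<lambda>x. (g x)\<^sup>2)"
  shows "integrable M (\<lambda>x. f x * g x)"
proof (rule Bochner_Integration.integrable_bound)
  show "integrable M (\<lambda>x. (f x)\<^sup>2 + (g x)\<^sup>2)" using assms by auto
  show "AE x in M. norm (f x * g x) \<le> norm ((f x)\<^sup>2 + (g x)\<^sup>2)"
    by (intro AE_I2) (use abs_mult_le_sum_squares in \<open>auto intro: order_trans\<close>)
qed simp

text \<open>The product f(x) g(y) is bounded by f(x)^2 + g(y)^2, and in each term translation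
  invariance integrates out the other variable. This is Young's inequality with a crude constant,
  enough for integrability and for bounds uniform in time.\<close>

lemma nn_integral_convolution_form:
  fixes f g k :: "'a::euclidean_space \<Rightarrow> real"
  assumes [measurable]: "f \<in> borel_measurable borel" "g \<in> borel_measurable borel" "k \<in> borel_measurable borel"
  shows "(\<integral>\<^sup>+x. \<integral>\<^sup>+y. ennreal \<bar>f x * g y * k (x - y)\<bar> \<partial>lborel \<partial>lborel)
    \<le> (\<integral>\<^sup>+z. ennreal \<bar>k z\<bar> \<partial>lborel) * ((\<integral>\<^sup>+x. ennreal ((f x)\<^sup>2) \<partial>lborel) + (\<integral>\<^sup>+x. ennreal ((g x)\<^sup>2) \<partial>lborel))"
proof -
  have "(\<integral>\<^sup>+x. \<integral>\<^sup>+y. ennreal \<bar>f x * g y * k (x - y)\<bar> \<partial>lborel \<partial>lborel)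
    \<le> (\<integral>\<^sup>+x. \<integral>\<^sup>+y. ennreal ((f x)\<^sup>2) * ennreal \<bar>k (x - y)\<bar> + ennreal ((g y)\<^sup>2) * ennreal \<bar>k (x - y)\<bar> \<partial>lborel \<partial>lborel)"
  proof (intro nn_integral_mono)
    fix x y
    have "\<bar>f x * g y * k (x - y)\<bar> \<le> ((f x)\<^sup>2 + (g y)\<^sup>2) * \<bar>k (x - y)\<bar>"
      unfolding abs_mult[of _ "k (x - y)"] by (intro mult_right_mono abs_mult_le_sum_squares) auto
    then show "ennreal \<bar>f x * g y * k (x - y)\<bar> \<le> ennreal ((f x)\<^sup>2) * ennreal \<bar>k (x - y)\<bar> + ennreal ((g y)\<^sup>2) * ennreal \<bar>k (x - y)\<bar>"
      by (simp add: distrib_right ennreal_leI flip: ennreal_mult' ennreal_plus)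
  qed
  also have "\<dots> = (\<integral>\<^sup>+x. \<integral>\<^sup>+y. ennreal ((f x)\<^sup>2) * ennreal \<bar>k (x - y)\<bar> \<partial>lborel \<partial>lborel)
      + (\<integral>\<^sup>+x. \<integral>\<^sup>+y. ennreal ((g y)\<^sup>2) * ennreal \<bar>k (x - y)\<bar> \<partial>lborel \<partial>lborel)"
    by (subst nn_integral_add; simp add: nn_integral_add)
  also have "(\<integral>\<^sup>+x. \<integral>\<^sup>+y. ennreal ((g y)\<^sup>2) * ennreal \<bar>k (x - y)\<bar> \<partial>lborel \<partial>lborel)
      = (\<integral>\<^sup>+y. \<integral>\<^sup>+x. ennreal ((g y)\<^sup>2) * ennreal \<bar>k (x - y)\<bar> \<partial>lborel \<partial>lborel)"
    by (rule lborel_pair.Fubini') measurable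
  also have "\<dots> = (\<integral>\<^sup>+z. ennreal \<bar>k z\<bar> \<partial>lborel) * (\<integral>\<^sup>+x. ennreal ((g x)\<^sup>2) \<partial>lborel)"
    using nn_integral_lborel_shift[of "\<lambda>z. ennreal \<bar>k z\<bar>"]
    by (simp add: nn_integral_cmult nn_integral_multc mult.commute)
  also have "(\<integral>\<^sup>+x. \<integral>\<^sup>+y. ennreal ((f x)\<^sup>2) * ennreal \<bar>k (x - y)\<bar> \<partial>lborel \<partial>lborel)
      = (\<integral>\<^sup>+z. ennreal \<bar>k z\<bar> \<partial>lborel) * (\<integral>\<^sup>+x. ennreal ((f x)\<^sup>2) \<partial>lborel)"
    using nn_integral_lborel_reflect[of "\<lambda>z. ennreal \<bar>k z\<bar>"]
    by (simp add: nn_integral_cmult nn_integral_multc mult.commute)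
  finally show ?thesis by (simp add: distrib_left)
qed

lemma integrable_convolution_form:
  fixes f g k :: "'a::euclidean_space \<Rightarrow> real"
  assumes [measurable]: "f \<in> borel_measurable borel" "g \<in> borel_measurable borel" "k \<in> borel_measurable borel"
    and "integrable lborel (\<lambda>x. (f x)\<^sup>2)" "integrable lborel (\<lambda>x. (g x)\<^sup>2)" "integrable lborel k"
  shows "integrable (lborel \<Otimes>\<^sub>M lborel) (\<lambda>(x, y). f x * g y * k (x - y))"
proof (rule integrableI_bounded)
  have "(\<integral>\<^sup>+p. ennreal (norm (case p of (x, y) \<Rightarrow> f x * g y * k (x - y))) \<partial>(lborel \<Otimes>\<^sub>M lborel))
    = (\<integral>\<^sup>+x. \<integral>\<^sup>+y. ennreal \<bar>f x * g y * k (x - y)\<bar> \<partial>lborel \<partial>lborel)"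
    by (subst lborel.nn_integral_fst[symmetric]) auto
  also have "\<dots> < \<infinity>"
    using assms(4-6)
    by (intro le_less_trans[OF nn_integral_convolution_form])
       (auto simp: ennreal_mult_less_top integrable_iff_bounded)
  finally show "(\<integral>\<^sup>+p. ennreal (norm (case p of (x, y) \<Rightarrow> f x * g y * k (x - y))) \<partial>(lborel \<Otimes>\<^sub>M lborel)) < \<infinity>" .
qed measurable

lemma integrable_component_sq:
  fixes G :: "'a::euclidean_space \<Rightarrow> 'a"
  assumes [measurable]: "G \<in> borel_measurable borel" and G2: "integrable lborel (\<lambda>x. (norm (G x))\<^sup>2)" and i: "i \<in> Basis"
  shows "integrable lborel (\<lambda>x. (G x \<bullet> i)\<^sup>2)"
proof (rule Bochner_Integration.integrable_bound[OF G2])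
  have "\<bar>G x \<bullet> i\<bar> \<le> norm (G x)" for x
    using Basis_le_norm[OF i] .
  then show "AE x in lborel. norm ((G x \<bullet> i)\<^sup>2) \<le> norm ((norm (G x))\<^sup>2)"
    by (simp add: abs_le_square_iff[symmetric])
qed simp

text \<open>A single equation in the form that the analysis uses: Borel representatives, u positive
  everywhere, and the weak identities written by coordinates. Integrability of
  \<open>h * \<phi>\<close> is a separate axiom because the Bochner integral of a non-integrable
  function is 0, so \<open>weak_form\<close> by itself would not make its right-hand side
  meaningful.\<close>

locale weak_eq =
  fixes lam :: real and h u :: "real^3 \<Rightarrow> real" and G :: "real^3 \<Rightarrow> real^3"
  assumes h_borel [measurable]: "h \<in> borel_measurable borel"
    and u_borel [measurable]: "u \<in> borel_measurable borel"
    and G_borel [measurable]: "G \<in> borel_measurable borel"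
    and u_sq: "integrable lborel (\<lambda>x. (u x)\<^sup>2)"
    and G_sq: "integrable lborel (\<lambda>x. (norm (G x))\<^sup>2)"
    and u_pos: "u x > 0"
    and h_nonneg: "h x \<ge> 0"
    and h_test: "\<phi> \<in> test_functions \<Longrightarrow> integrable lborel (\<lambda>x. h x * \<phi> x)"
    and weak_grad: "\<phi> \<in> test_functions \<Longrightarrow> i \<in> Basis \<Longrightarrow>
      (LINT x|lborel. u x * pd \<phi> i x) = - (LINT x|lborel. \<phi> x * (G x \<bullet> i))"
    and weak_form: "\<phi> \<in> test_functions \<Longrightarrow>
      (\<Sum>i\<in>Basis. LINT x|lborel. (G x \<bullet> i) * pd \<phi> i x) + lam * (LINT x|lborel. u x * \<phi> x)
        = (LINT x|lborel. h x * \<phi> x)"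
begin

lemmas G_comp_sq = integrable_component_sq[OF G_borel G_sq]

definition cut :: "nat \<Rightarrow> real^3 \<Rightarrow> real" where
  "cut n x = bump ((1 / real (Suc n)) *\<^sub>R x)"

lemma cut_tendsto: "(\<lambda>n. cut n x) \<longlonglongrightarrow> 1"
proof -
  have sm: "smooth (bump :: real^3 \<Rightarrow> real)"
    using smooth_bump_scaled[of 1] by simp
  have "(\<lambda>n. (1 / real (Suc n)) *\<^sub>R x) \<longlonglongrightarrow> 0 *\<^sub>R x"
    by (intro tendsto_intros LIMSEQ_Suc lim_1_over_n)
  then have "(\<lambda>n. bump ((1 / real (Suc n)) *\<^sub>R x)) \<longlonglongrightarrow> bump (0 :: real^3)"
    by (intro isCont_tendsto_compose[of 0 bump])
       (use smooth_continuous[OF sm, of UNIV] in \<open>auto simp: continuous_on_eq_continuous_at\<close>)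
  then show ?thesis by (simp add: cut_def)
qed

lemma cut_bounds: "0 \<le> cut n x" "cut n x \<le> 1"
  by (simp_all add: cut_def bump_bounds)

lemma smooth_cut: "smooth (cut n)"
  unfolding cut_def[abs_def] by (rule smooth_bump_scaled)

lemma cut_test: "smooth \<psi> \<Longrightarrow> (\<lambda>x. cut n x * \<psi> x) \<in> test_functions"
  unfolding cut_def by (rule test_function_cutoff) auto

lemma pd_cut_mult:
  "smooth \<psi> \<Longrightarrow> pd (\<lambda>x. cut n x * \<psi> x) i x
    = cut n x * pd \<psi> i x + (1 / real (Suc n)) * pd bump i ((1 / real (Suc n)) *\<^sub>R x) * \<psi> x"
  using pd_mult[OF smooth_cut, of \<psi> n x i] pd_bump_scaled[of "1 / real (Suc n)" x i]
  unfolding cut_def[abs_def] by simp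

lemma cutoff_limit:
  assumes [measurable]: "f \<in> borel_measurable borel" and "integrable lborel (\<lambda>x. (f x)\<^sup>2)"
    and sm: "smooth \<psi>" and "integrable lborel (\<lambda>x. (\<psi> x)\<^sup>2)"
  shows "(\<lambda>n. LINT x|lborel. f x * (cut n x * \<psi> x)) \<longlonglongrightarrow> (LINT x|lborel. f x * \<psi> x)"
proof (rule integral_dominated_convergence[where w = "\<lambda>x. \<bar>f x * \<psi> x\<bar>"])
  have [measurable]: "\<psi> \<in> borel_measurable borel" "cut n \<in> borel_measurable borel" for n
    using sm smooth_cut by (auto intro: smooth_measurable)
  show "(\<lambda>x. f x * \<psi> x) \<in> borel_measurable lborel" "(\<lambda>x. f x * (cut n x * \<psi> x)) \<in> borel_measurable lborel" for n
    by measurable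
  show "integrable lborel (\<lambda>x. \<bar>f x * \<psi> x\<bar>)"
    using assms by (intro integrable_abs integrable_mult_of_squares) auto
  show "AE x in lborel. (\<lambda>n. f x * (cut n x * \<psi> x)) \<longlonglongrightarrow> f x * \<psi> x"
    by (auto intro!: tendsto_eq_intros cut_tendsto)
  have "\<bar>f x\<bar> * (cut n x * \<bar>\<psi> x\<bar>) \<le> \<bar>f x\<bar> * (1 * \<bar>\<psi> x\<bar>)" for n x
    by (intro mult_left_mono mult_right_mono cut_bounds) auto
  then show "AE x in lborel. norm (f x * (cut n x * \<psi> x)) \<le> \<bar>f x * \<psi> x\<bar>" for n
    by (simp add: abs_mult cut_bounds)
qed

text \<open>The derivative of the cutoff carries the factor 1/(n+1) and a uniformly bounded
  function, so in the limit only the term with \<open>pd \<psi>\<close> survives.\<close>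

lemma cutoff_limit_pd:
  assumes f [measurable]: "f \<in> borel_measurable borel" and f2: "integrable lborel (\<lambda>x. (f x)\<^sup>2)"
    and sm: "smooth \<psi>" and psi2: "integrable lborel (\<lambda>x. (\<psi> x)\<^sup>2)"
    and i: "i \<in> Basis" and pd2: "integrable lborel (\<lambda>x. (pd \<psi> i x)\<^sup>2)"
  shows "(\<lambda>n. LINT x|lborel. f x * pd (\<lambda>x. cut n x * \<psi> x) i x) \<longlonglongrightarrow> (LINT x|lborel. f x * pd \<psi> i x)"
proof -
  obtain C where C: "C \<ge> 0" "\<And>x::real^3. \<And>i. i \<in> Basis \<Longrightarrow> \<bar>pd bump i x\<bar> \<le> C"
    using bump_pd_bounded by blast
  have smb: "smooth (bump :: real^3 \<Rightarrow> real)"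
    using smooth_bump_scaled[of 1] by simp
  have [measurable]: "\<psi> \<in> borel_measurable borel" "pd \<psi> i \<in> borel_measurable borel"
      "cut n \<in> borel_measurable borel" "pd bump i \<in> borel_measurable borel" for n
    using sm smooth_cut smb i by (auto intro: smooth_measurable smooth_pd)
  show ?thesis
  proof (rule integral_dominated_convergence[where w = "\<lambda>x. \<bar>f x * pd \<psi> i x\<bar> + C * \<bar>f x * \<psi> x\<bar>"])
    show "(\<lambda>x. f x * pd \<psi> i x) \<in> borel_measurable lborel"
        "(\<lambda>x. f x * pd (\<lambda>x. cut n x * \<psi> x) i x) \<in> borel_measurable lborel" for n
      by (simp_all add: pd_cut_mult[OF sm])
    show "integrable lborel (\<lambda>x. \<bar>f x * pd \<psi> i x\<bar> + C * \<bar>f x * \<psi> x\<bar>)"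
      using f2 pd2 psi2
      by (intro Bochner_Integration.integrable_add integrable_mult_right integrable_abs integrable_mult_of_squares) auto
    have "(\<lambda>n. f x * pd (\<lambda>x. cut n x * \<psi> x) i x) \<longlonglongrightarrow> f x * (1 * pd \<psi> i x + 0)" for x
      unfolding pd_cut_mult[OF sm]
    proof (intro tendsto_intros cut_tendsto)
      have "(\<lambda>n. (C * \<bar>\<psi> x\<bar>) * (1 / real (Suc n))) \<longlonglongrightarrow> (C * \<bar>\<psi> x\<bar>) * 0"
        by (intro tendsto_intros LIMSEQ_Suc lim_1_over_n)
      then have lim: "(\<lambda>n. (C * \<bar>\<psi> x\<bar>) * (1 / real (Suc n))) \<longlonglongrightarrow> 0" by simp
      show "(\<lambda>n. 1 / real (Suc n) * pd bump i ((1 / real (Suc n)) *\<^sub>R x) * \<psi> x) \<longlonglongrightarrow> 0"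
      proof (rule Lim_null_comparison[OF always_eventually lim], rule allI)
        fix n
        have "1 / real (Suc n) * \<bar>pd bump i ((1 / real (Suc n)) *\<^sub>R x)\<bar> * \<bar>\<psi> x\<bar> \<le> 1 / real (Suc n) * C * \<bar>\<psi> x\<bar>"
          by (intro mult_left_mono mult_right_mono C i) auto
        then show "norm (1 / real (Suc n) * pd bump i ((1 / real (Suc n)) *\<^sub>R x) * \<psi> x) \<le> (C * \<bar>\<psi> x\<bar>) * (1 / real (Suc n))"
          by (simp add: abs_mult mult_ac)
      qed
    qed
    then show "AE x in lborel. (\<lambda>n. f x * pd (\<lambda>x. cut n x * \<psi> x) i x) \<longlonglongrightarrow> f x * pd \<psi> i x"
      by simp
    show "AE x in lborel. norm (f x * pd (\<lambda>x. cut n x * \<psi> x) i x) \<le> \<bar>f x * pd \<psi> i x\<bar> + C * \<bar>f x * \<psi> x\<bar>" for n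
    proof (rule AE_I2)
      fix x
      have "1 / real (Suc n) * \<bar>pd bump i ((1 / real (Suc n)) *\<^sub>R x)\<bar> \<le> 1 * C"
        by (intro mult_mono C i) auto
      then have "\<bar>(1 / real (Suc n)) * pd bump i ((1 / real (Suc n)) *\<^sub>R x) * \<psi> x\<bar> \<le> C * \<bar>\<psi> x\<bar>"
        by (simp only: abs_mult) (rule mult_right_mono, auto)
      moreover have "\<bar>cut n x * pd \<psi> i x\<bar> \<le> 1 * \<bar>pd \<psi> i x\<bar>"
        unfolding abs_mult by (intro mult_right_mono) (use cut_bounds in auto)
      ultimately have "\<bar>pd (\<lambda>x. cut n x * \<psi> x) i x\<bar> \<le> \<bar>pd \<psi> i x\<bar> + C * \<bar>\<psi> x\<bar>"
        unfolding pd_cut_mult[OF sm] by linarith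
      then have "\<bar>f x\<bar> * \<bar>pd (\<lambda>x. cut n x * \<psi> x) i x\<bar> \<le> \<bar>f x\<bar> * (\<bar>pd \<psi> i x\<bar> + C * \<bar>\<psi> x\<bar>)"
        by (intro mult_left_mono) auto
      then show "norm (f x * pd (\<lambda>x. cut n x * \<psi> x) i x) \<le> \<bar>f x * pd \<psi> i x\<bar> + C * \<bar>f x * \<psi> x\<bar>"
        by (simp add: abs_mult algebra_simps)
    qed
  qed
qed

lemma weak_grad_smooth:
  assumes sm: "smooth \<psi>" and psi2: "integrable lborel (\<lambda>x. (\<psi> x)\<^sup>2)"
    and i: "i \<in> Basis" and pd2: "integrable lborel (\<lambda>x. (pd \<psi> i x)\<^sup>2)"
  shows "(LINT x|lborel. u x * pd \<psi> i x) = - (LINT x|lborel. \<psi> x * (G x \<bullet> i))"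
proof (rule LIMSEQ_unique)
  show "(\<lambda>n. LINT x|lborel. u x * pd (\<lambda>x. cut n x * \<psi> x) i x) \<longlonglongrightarrow> (LINT x|lborel. u x * pd \<psi> i x)"
    by (rule cutoff_limit_pd[OF u_borel u_sq sm psi2 i pd2])
  have "(\<lambda>n. - (LINT x|lborel. (G x \<bullet> i) * (cut n x * \<psi> x))) \<longlonglongrightarrow> - (LINT x|lborel. (G x \<bullet> i) * \<psi> x)"
    by (intro tendsto_minus cutoff_limit sm psi2 G_comp_sq i) measurable
  then show "(\<lambda>n. LINT x|lborel. u x * pd (\<lambda>x. cut n x * \<psi> x) i x) \<longlonglongrightarrow> - (LINT x|lborel. \<psi> x * (G x \<bullet> i))"
    unfolding weak_grad[OF cut_test[OF sm] i] by (simp only: mult_ac)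
qed

text \<open>Nothing guarantees beforehand that \<open>h * \<psi>\<close> is integrable. For
  nonnegative \<psi> Fatou's lemma extracts this from the convergence of the left-hand sides, and
  dominated convergence then identifies the limit.\<close>

lemma weak_form_smooth:
  assumes sm: "smooth \<psi>" and psi2: "integrable lborel (\<lambda>x. (\<psi> x)\<^sup>2)"
    and pd2: "\<And>i. i \<in> Basis \<Longrightarrow> integrable lborel (\<lambda>x. (pd \<psi> i x)\<^sup>2)"
    and nonneg: "\<And>x. \<psi> x \<ge> 0"
  shows "integrable lborel (\<lambda>x. h x * \<psi> x)"
    and "(\<Sum>i\<in>Basis. LINT x|lborel. (G x \<bullet> i) * pd \<psi> i x) + lam * (LINT x|lborel. u x * \<psi> x)
        = (LINT x|lborel. h x * \<psi> x)"
proof -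
  have [measurable]: "\<psi> \<in> borel_measurable borel" "cut n \<in> borel_measurable borel" for n
    using sm smooth_cut by (auto intro: smooth_measurable)
  let ?l = "(\<Sum>i\<in>Basis. LINT x|lborel. (G x \<bullet> i) * pd \<psi> i x) + lam * (LINT x|lborel. u x * \<psi> x)"
  have lim: "(\<lambda>n. LINT x|lborel. h x * (cut n x * \<psi> x)) \<longlonglongrightarrow> ?l"
    unfolding weak_form[OF cut_test[OF sm], symmetric]
    by (intro tendsto_intros cutoff_limit_pd cutoff_limit u_sq G_comp_sq psi2 pd2 sm) measurable
  have nn: "ennreal (LINT x|lborel. h x * (cut n x * \<psi> x)) = (\<integral>\<^sup>+x. h x * (cut n x * \<psi> x) \<partial>lborel)" for n
    by (rule nn_integral_eq_integral[symmetric, OF h_test[OF cut_test[OF sm]]]) (simp add: h_nonneg cut_bounds nonneg)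
  have "(\<integral>\<^sup>+x. h x * \<psi> x \<partial>lborel) = (\<integral>\<^sup>+x. liminf (\<lambda>n. ennreal (h x * (cut n x * \<psi> x))) \<partial>lborel)"
  proof (intro nn_integral_cong lim_imp_Liminf[symmetric] tendsto_ennrealI)
    show "(\<lambda>n. h x * (cut n x * \<psi> x)) \<longlonglongrightarrow> h x * \<psi> x" for x
      by (auto intro!: tendsto_eq_intros cut_tendsto)
  qed simp
  also have "\<dots> \<le> liminf (\<lambda>n. \<integral>\<^sup>+x. h x * (cut n x * \<psi> x) \<partial>lborel)"
    by (rule nn_integral_liminf) measurable
  also have "\<dots> = ennreal ?l"
    unfolding nn[symmetric] by (intro lim_imp_Liminf tendsto_ennrealI lim) simp
  finally have fin: "(\<integral>\<^sup>+x. h x * \<psi> x \<partial>lborel) < \<infinity>"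
    using le_less_trans by fastforce
  show int: "integrable lborel (\<lambda>x. h x * \<psi> x)"
    by (rule integrableI_nonneg) (use fin in \<open>auto simp: h_nonneg nonneg\<close>)
  have "(\<lambda>n. LINT x|lborel. h x * (cut n x * \<psi> x)) \<longlonglongrightarrow> (LINT x|lborel. h x * \<psi> x)"
  proof (rule integral_dominated_convergence[where w = "\<lambda>x. h x * \<psi> x"])
    show "AE x in lborel. (\<lambda>n. h x * (cut n x * \<psi> x)) \<longlonglongrightarrow> h x * \<psi> x"
      by (auto intro!: tendsto_eq_intros cut_tendsto)
    have "h x * (cut n x * \<psi> x) \<le> h x * (1 * \<psi> x)" for n x
      by (intro mult_left_mono mult_right_mono cut_bounds h_nonneg nonneg)
    then show "AE x in lborel. norm (h x * (cut n x * \<psi> x)) \<le> h x * \<psi> x" for n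
      by (simp add: abs_mult cut_bounds h_nonneg nonneg)
  qed (use int in measurable)
  with lim show "?l = (LINT x|lborel. h x * \<psi> x)"
    by (rule LIMSEQ_unique)
qed

end

section \<open>The heat semigroup, the resolvent, and the heat flow of a weak solution\<close>

definition heat_op :: "real \<Rightarrow> (real^3 \<Rightarrow> ennreal) \<Rightarrow> real^3 \<Rightarrow> ennreal" where
  "heat_op t f x = (\<integral>\<^sup>+y. ennreal (heat t (x - y)) * f y \<partial>lborel)"

text \<open>The Laplace transform of the heat semigroup. Values in \<open>ennreal\<close> make
  Tonelli's theorem available without integrability conditions.\<close>

definition resolvent :: "real \<Rightarrow> (real^3 \<Rightarrow> ennreal) \<Rightarrow> real^3 \<Rightarrow> ennreal" where
  "resolvent lam f x = (\<integral>\<^sup>+s. ennreal (exp (- lam * s)) * heat_op s f x * indicator {0<..} s \<partial>lborel)"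

lemma heat_op_measurable [measurable]:
  assumes [measurable]: "f \<in> borel_measurable borel" "g \<in> borel_measurable M" "k \<in> borel_measurable M"
  shows "(\<lambda>x. heat_op (g x) f (k x)) \<in> borel_measurable M"
  unfolding heat_op_def by measurable

lemma resolvent_measurable [measurable]:
  assumes [measurable]: "f \<in> borel_measurable borel"
  shows "resolvent lam f \<in> borel_measurable borel"
  unfolding resolvent_def by measurable

lemma integrable_pd_heat_sq:
  assumes t: "t > 0" and i: "i \<in> Basis"
  shows "integrable lborel (\<lambda>y. (pd (\<lambda>y. heat t (y - x)) i y)\<^sup>2)"
    and "integrable lborel (\<lambda>y. (pd (pd (\<lambda>y. heat t (y - x)) i) i y)\<^sup>2)"
    and "integrable lborel (\<lambda>y. (heat t (y - x))\<^sup>2)"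
proof -
  have sh: "integrable lborel (\<lambda>y. norm (y - x) ^ (2 * n) * (heat t (y - x))\<^sup>2)" for n
    using integrable_lborel_reflect[OF integrable_power_heat_sq[OF t, of n], of x]
    by (simp only: norm_minus_commute[of x] heat_commute[of t x])
  show s0: "integrable lborel (\<lambda>y. (heat t (y - x))\<^sup>2)"
    using sh[of 0] by simp
  have le: "\<bar>z \<bullet> i\<bar> \<le> norm z" for z :: "real^3"
    using Basis_le_norm[OF i] .
  have le2: "(z \<bullet> i)\<^sup>2 \<le> (norm z)\<^sup>2" for z :: "real^3"
    using le by (simp add: abs_le_square_iff[symmetric])
  have [measurable]: "(\<lambda>y. heat t (y - x)) \<in> borel_measurable borel" by measurable
  show "integrable lborel (\<lambda>y. (pd (\<lambda>y. heat t (y - x)) i y)\<^sup>2)"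
  proof (rule Bochner_Integration.integrable_bound[OF integrable_mult_left[OF sh[of 1], of "1 / (4 * t\<^sup>2)"]])
    show "AE y in lborel. norm ((pd (\<lambda>y. heat t (y - x)) i y)\<^sup>2) \<le> norm (norm (y - x) ^ (2 * 1) * (heat t (y - x))\<^sup>2 * (1 / (4 * t\<^sup>2)))"
    proof (rule AE_I2)
      fix y
      have "(pd (\<lambda>y. heat t (y - x)) i y)\<^sup>2 = ((y - x) \<bullet> i)\<^sup>2 * (heat t (y - x))\<^sup>2 * (1 / (4 * t\<^sup>2))"
        unfolding pd_heat[OF t] by (simp add: power_mult_distrib power_divide)
      also have "\<dots> \<le> (norm (y - x))\<^sup>2 * (heat t (y - x))\<^sup>2 * (1 / (4 * t\<^sup>2))"
        by (intro mult_right_mono le2) auto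
      finally show "norm ((pd (\<lambda>y. heat t (y - x)) i y)\<^sup>2) \<le> norm (norm (y - x) ^ (2 * 1) * (heat t (y - x))\<^sup>2 * (1 / (4 * t\<^sup>2)))"
        by simp
    qed
  qed (simp add: pd_heat[OF t])
  show "integrable lborel (\<lambda>y. (pd (pd (\<lambda>y. heat t (y - x)) i) i y)\<^sup>2)"
  proof (rule Bochner_Integration.integrable_bound)
    show "integrable lborel (\<lambda>y. 2 * (1 / (4 * t\<^sup>2))\<^sup>2 * (norm (y - x) ^ (2 * 2) * (heat t (y - x))\<^sup>2)
        + 2 * (1 / (2 * t))\<^sup>2 * (heat t (y - x))\<^sup>2)"
      by (intro Bochner_Integration.integrable_add integrable_mult_right sh s0)
    show "AE y in lborel. norm ((pd (pd (\<lambda>y. heat t (y - x)) i) i y)\<^sup>2)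
      \<le> norm (2 * (1 / (4 * t\<^sup>2))\<^sup>2 * (norm (y - x) ^ (2 * 2) * (heat t (y - x))\<^sup>2)
        + 2 * (1 / (2 * t))\<^sup>2 * (heat t (y - x))\<^sup>2)"
    proof (rule AE_I2)
      fix y
      define w where "w = ((y - x) \<bullet> i)\<^sup>2"
      have w: "0 \<le> w" "w \<le> (norm (y - x))\<^sup>2" using le2 by (auto simp: w_def)
      then have w2: "w\<^sup>2 \<le> norm (y - x) ^ (2 * 2)"
        unfolding power_mult by (rule power_mono[rotated])
      have "(w / (4 * t\<^sup>2) - 1 / (2 * t))\<^sup>2 \<le> 2 * (w / (4 * t\<^sup>2))\<^sup>2 + 2 * (1 / (2 * t))\<^sup>2"
        by (rule order_trans[OF _ eq_refl]) (use sum_squares_bound[of "w / (4 * t\<^sup>2)" "- 1 / (2 * t)"] in \<open>simp_all add: power2_diff\<close>)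
      also have "(w / (4 * t\<^sup>2))\<^sup>2 = (1 / (4 * t\<^sup>2))\<^sup>2 * w\<^sup>2" by (simp add: power_divide)
      also have "2 * ((1 / (4 * t\<^sup>2))\<^sup>2 * w\<^sup>2) \<le> 2 * ((1 / (4 * t\<^sup>2))\<^sup>2 * norm (y - x) ^ (2 * 2))"
        by (intro mult_left_mono w2) auto
      finally have "(w / (4 * t\<^sup>2) - 1 / (2 * t))\<^sup>2 * (heat t (y - x))\<^sup>2
        \<le> (2 * ((1 / (4 * t\<^sup>2))\<^sup>2 * norm (y - x) ^ (2 * 2)) + 2 * (1 / (2 * t))\<^sup>2) * (heat t (y - x))\<^sup>2"
        by (intro mult_right_mono) auto
      also have "\<dots> = 2 * (1 / (4 * t\<^sup>2))\<^sup>2 * (norm (y - x) ^ (2 * 2) * (heat t (y - x))\<^sup>2)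
        + 2 * (1 / (2 * t))\<^sup>2 * (heat t (y - x))\<^sup>2"
        by (simp only: distrib_right mult.assoc)
      finally show "norm ((pd (pd (\<lambda>y. heat t (y - x)) i) i y)\<^sup>2)
      \<le> norm (2 * (1 / (4 * t\<^sup>2))\<^sup>2 * (norm (y - x) ^ (2 * 2) * (heat t (y - x))\<^sup>2)
        + 2 * (1 / (2 * t))\<^sup>2 * (heat t (y - x))\<^sup>2)"
        unfolding pd_pd_heat[OF t i] w_def[symmetric] power_mult_distrib by simp
    qed
  qed (simp add: pd_pd_heat[OF t i])
qed

text \<open>Both the time derivative and the Laplacian of \<open>heat\<close>, by
  \<open>heat_deriv_time\<close> and \<open>heat_laplacian\<close>: one name records the heat
  equation.\<close>

definition heat_dt :: "real \<Rightarrow> real^3 \<Rightarrow> real" where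
  "heat_dt t z = ((norm z)\<^sup>2 / (4 * t\<^sup>2) - 3 / (2 * t)) * heat t z"

lemma heat_dt_measurable [measurable]:
  "f \<in> borel_measurable M \<Longrightarrow> g \<in> borel_measurable M \<Longrightarrow> (\<lambda>x. heat_dt (f x) (g x)) \<in> borel_measurable M"
  by (simp add: heat_dt_def)

text \<open>A majorant on [a, b] that does not depend on the time s, used to integrate over space
  and time together.\<close>

lemma heat_compare:
  assumes "0 < a" "a \<le> s" "s \<le> b"
  shows "heat s z \<le> (a powr (- 3 / 2) / b powr (- 3 / 2)) * heat b z"
proof -
  have 1: "s powr (- 3 / 2) \<le> a powr (- 3 / 2)"
    using assms by (intro powr_mono2') auto
  have 2: "exp (- ((norm z)\<^sup>2 / (4 * s))) \<le> exp (- ((norm z)\<^sup>2 / (4 * b)))"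
    using assms by (simp add: frac_le)
  have "heat s z \<le> a powr (- 3 / 2) * exp (- ((norm z)\<^sup>2 / (4 * b))) / gauss_mass"
    unfolding heat_def using gauss_mass_pos by (intro divide_right_mono mult_mono 1 2) auto
  also have "\<dots> = (a powr (- 3 / 2) / b powr (- 3 / 2)) * heat b z"
    using assms by (simp add: heat_def)
  finally show ?thesis .
qed

context weak_eq
begin

lemma heat_weak_form:
  assumes t: "t > 0"
  shows "integrable lborel (\<lambda>y. h y * heat t (y - x))"
    and "(\<Sum>i\<in>Basis. LINT y|lborel. (G y \<bullet> i) * pd (\<lambda>y. heat t (y - x)) i y) + lam * (LINT y|lborel. u y * heat t (y - x))
        = (LINT y|lborel. h y * heat t (y - x))"
  by (rule weak_form_smooth[OF smooth_heat integrable_pd_heat_sq(3)[OF t SOME_Basis] integrable_pd_heat_sq(1)[OF t]]; simp)+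

text \<open>Testing with a Gaussian and moving the weak gradient onto it replaces the Laplacian of u
  by that of the Gaussian, which is its time derivative.\<close>

lemma heat_eq:
  assumes t: "t > 0"
  shows "(LINT y|lborel. h y * heat t (y - x)) = (LINT y|lborel. u y * (lam * heat t (y - x) - heat_dt t (y - x)))"
proof -
  let ?p = "\<lambda>y. heat t (y - x)"
  have [measurable]: "pd (pd ?p i) i \<in> borel_measurable borel" "pd ?p i \<in> borel_measurable borel" if "i \<in> Basis" for i
    using that by (auto intro!: smooth_measurable smooth_pd smooth_heat)
  have int: "integrable lborel (\<lambda>y. u y * pd (pd ?p i) i y)" if "i \<in> Basis" for i
    using that by (intro integrable_mult_of_squares u_sq integrable_pd_heat_sq t) auto
  have int0: "integrable lborel (\<lambda>y. u y * ?p y)"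
    by (intro integrable_mult_of_squares u_sq integrable_pd_heat_sq(3)[OF t SOME_Basis]) auto
  have "(LINT y|lborel. (G y \<bullet> i) * pd ?p i y) = - (LINT y|lborel. u y * pd (pd ?p i) i y)" if "i \<in> Basis" for i
    using weak_grad_smooth[OF smooth_pd[OF smooth_heat that] integrable_pd_heat_sq(1)[OF t that] that integrable_pd_heat_sq(2)[OF t that], of x]
    by (simp add: mult.commute)
  then have "(LINT y|lborel. h y * ?p y) = lam * (LINT y|lborel. u y * ?p y) - (\<Sum>i\<in>Basis. LINT y|lborel. u y * pd (pd ?p i) i y)"
    using heat_weak_form(2)[OF t, of x] by (simp add: sum_negf)
  also have "(\<Sum>i\<in>Basis. LINT y|lborel. u y * pd (pd ?p i) i y) = (LINT y|lborel. (\<Sum>i\<in>Basis. u y * pd (pd ?p i) i y))"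
    using int by (intro Bochner_Integration.integral_sum[symmetric])
  also have "lam * (LINT y|lborel. u y * ?p y) - \<dots> = (LINT y|lborel. lam * (u y * ?p y) - (\<Sum>i\<in>Basis. u y * pd (pd ?p i) i y))"
    using int int0 by (subst Bochner_Integration.integral_diff) auto
  also have "\<dots> = (LINT y|lborel. u y * (lam * heat t (y - x) - heat_dt t (y - x)))"
    by (simp only: sum_distrib_left[symmetric] heat_laplacian[OF t] heat_dt_def right_diff_distrib mult.left_commute)
  finally show ?thesis .
qed

lemma u_heat_integrable:
  assumes t: "t > 0"
  shows "integrable lborel (\<lambda>y. u y * heat t (y - x))"
  by (intro integrable_mult_of_squares u_sq integrable_pd_heat_sq(3)[OF t SOME_Basis]) auto

lemma heat_op_u:
  assumes t: "t > 0"
  shows "heat_op t (\<lambda>y. ennreal (u y)) x = ennreal (LINT y|lborel. u y * heat t (y - x))"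
  unfolding heat_op_def using u_pos
  by (subst nn_integral_eq_integral[OF u_heat_integrable[OF t], symmetric])
     (auto simp: ennreal_mult' mult.commute heat_commute[of t x] less_imp_le)

lemma heat_op_h:
  assumes t: "t > 0"
  shows "heat_op t (\<lambda>y. ennreal (h y)) x = ennreal (LINT y|lborel. h y * heat t (y - x))"
  unfolding heat_op_def
  by (subst nn_integral_eq_integral[OF heat_weak_form(1)[OF t], symmetric])
     (auto simp: ennreal_mult' mult.commute heat_commute[of t x] h_nonneg)

text \<open>By \<open>heat_eq\<close> the integrand is minus the time derivative of
  \<open>exp (- lam * s)\<close> times the heat average of u. The fundamental theorem of calculus is
  applied for each fixed y, before integrating against u, which avoids differentiating under the
  integral sign; Fubini's theorem connects the two orders.\<close>

lemma heat_flow_Icc: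
  assumes a: "0 < a" and ab: "a \<le> b"
  shows "(\<integral>\<^sup>+s. ennreal (exp (- lam * s)) * heat_op s (\<lambda>y. ennreal (h y)) x * indicator {a..b} s \<partial>lborel)
    = ennreal (exp (- lam * a) * (LINT y|lborel. u y * heat a (y - x)) - exp (- lam * b) * (LINT y|lborel. u y * heat b (y - x)))"
proof -
  define F where "F = (\<lambda>(s, y). indicator {a..b} s * (u y * (exp (- lam * s) * (lam * heat s (y - x) - heat_dt s (y - x)))))"
  \<comment> \<open>The three factors bound \<open>exp (- lam * s)\<close>, the ratio from
    \<open>heat_compare\<close>, and the coefficient of 1 + norm(z)^2 in the polynomial
    factor.\<close>
  define M where "M = exp (\<bar>lam\<bar> * b) * (a powr (- 3 / 2) / b powr (- 3 / 2)) * (\<bar>lam\<bar> + 3 / (2 * a) + 1 / (4 * a\<^sup>2))"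
  have b: "b > 0" using a ab by simp
  have M: "M \<ge> 0" using a by (auto simp: M_def)
  have bound: "\<bar>exp (- lam * s) * (lam * heat s z - heat_dt s z)\<bar> \<le> M * ((1 + (norm z)\<^sup>2) * heat b z)"
    if s: "a \<le> s" "s \<le> b" for s z
  proof -
    have s0: "s > 0" using s a by simp
    have "- lam * s \<le> \<bar>lam\<bar> * b"
      using s s0 by (metis abs_ge_self abs_ge_zero abs_minus_cancel less_imp_le mult_mono)
    then have 1: "exp (- lam * s) \<le> exp (\<bar>lam\<bar> * b)" by simp
    have s2: "a\<^sup>2 \<le> s\<^sup>2" using s a by (intro power_mono) auto
    have A: "(norm z)\<^sup>2 / (4 * s\<^sup>2) \<le> (norm z)\<^sup>2 / (4 * a\<^sup>2)" "3 / (2 * s) \<le> 3 / (2 * a)"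
      "0 \<le> (norm z)\<^sup>2 / (4 * s\<^sup>2)" "0 \<le> 3 / (2 * s)"
      using s s0 a s2 by (auto intro!: divide_left_mono mult_pos_pos)
    have "\<bar>lam - ((norm z)\<^sup>2 / (4 * s\<^sup>2) - 3 / (2 * s))\<bar> \<le> \<bar>lam\<bar> + 3 / (2 * a) + (norm z)\<^sup>2 / (4 * a\<^sup>2)"
      using A by linarith
    also have "\<dots> \<le> (\<bar>lam\<bar> + 3 / (2 * a) + 1 / (4 * a\<^sup>2)) * (1 + (norm z)\<^sup>2)"
    proof -
      have "p + n * q \<le> (p + q) * (1 + n)" if "p \<ge> 0" "q \<ge> 0" "n \<ge> 0" for p q n :: real
        using mult_nonneg_nonneg[OF that(1,3)] that by (simp add: algebra_simps)
      from this[of "\<bar>lam\<bar> + 3 / (2 * a)" "1 / (4 * a\<^sup>2)" "(norm z)\<^sup>2"] show ?thesis using a by simp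
    qed
    finally have 2: "\<bar>lam - ((norm z)\<^sup>2 / (4 * s\<^sup>2) - 3 / (2 * s))\<bar> \<le> (\<bar>lam\<bar> + 3 / (2 * a) + 1 / (4 * a\<^sup>2)) * (1 + (norm z)\<^sup>2)" .
    have "\<bar>exp (- lam * s) * (lam * heat s z - heat_dt s z)\<bar>
      = exp (- lam * s) * (\<bar>lam - ((norm z)\<^sup>2 / (4 * s\<^sup>2) - 3 / (2 * s))\<bar> * heat s z)"
      by (simp add: heat_dt_def abs_mult flip: left_diff_distrib)
    also have "\<dots> \<le> exp (\<bar>lam\<bar> * b) * (((\<bar>lam\<bar> + 3 / (2 * a) + 1 / (4 * a\<^sup>2)) * (1 + (norm z)\<^sup>2)) * ((a powr (- 3 / 2) / b powr (- 3 / 2)) * heat b z))"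
      by (intro mult_mono 1 2 heat_compare a s mult_nonneg_nonneg) (use a in auto)
    also have "\<dots> = M * ((1 + (norm z)\<^sup>2) * heat b z)"
      by (simp add: M_def mult_ac)
    finally show ?thesis .
  qed
  have Mint: "integrable lborel (\<lambda>y. u y * ((1 + (norm (y - x))\<^sup>2) * heat b (y - x)))"
  proof (intro integrable_mult_of_squares u_sq)
    have sh: "integrable lborel (\<lambda>y. norm (y - x) ^ (2 * n) * (heat b (y - x))\<^sup>2)" for n
      using integrable_lborel_reflect[OF integrable_power_heat_sq[OF b, of n], of x]
      by (simp only: norm_minus_commute[of x] heat_commute[of b x])
    have "integrable lborel (\<lambda>y. norm (y - x) ^ (2 * 0) * (heat b (y - x))\<^sup>2 + 2 * (norm (y - x) ^ (2 * 1) * (heat b (y - x))\<^sup>2)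
        + norm (y - x) ^ (2 * 2) * (heat b (y - x))\<^sup>2)"
      by (intro Bochner_Integration.integrable_add integrable_mult_right sh)
    moreover have "norm (y - x) ^ (2 * 0) * (heat b (y - x))\<^sup>2 + 2 * (norm (y - x) ^ (2 * 1) * (heat b (y - x))\<^sup>2)
        + norm (y - x) ^ (2 * 2) * (heat b (y - x))\<^sup>2 = ((1 + (norm (y - x))\<^sup>2) * heat b (y - x))\<^sup>2" for y
      unfolding power_mult by (simp add: power2_eq_square algebra_simps)
    ultimately show "integrable lborel (\<lambda>y. ((1 + (norm (y - x))\<^sup>2) * heat b (y - x))\<^sup>2)"
      by simp
  qed auto
  have Fint: "integrable (lborel \<Otimes>\<^sub>M lborel) F"
  proof (rule Bochner_Integration.integrable_bound)
    show "integrable (lborel \<Otimes>\<^sub>M lborel) (\<lambda>(s, y). indicator {a..b} s * (M * (u y * ((1 + (norm (y - x))\<^sup>2) * heat b (y - x)))))"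
    proof (rule lborel_pair.Fubini_integrable)
      have "integrable lborel (\<lambda>s. indicator {a..b} s *\<^sub>R (LBINT y. \<bar>M * (u y * ((1 + (norm (y - x))\<^sup>2) * heat b (y - x)))\<bar>))"
        by (intro integrable_indicator) (auto simp: emeasure_lborel_Icc_eq)
      moreover have "(LBINT y. norm (case (s, y) of (s, y) \<Rightarrow> indicator {a..b} s * (M * (u y * ((1 + (norm (y - x))\<^sup>2) * heat b (y - x))))))
        = indicator {a..b} s *\<^sub>R (LBINT y. \<bar>M * (u y * ((1 + (norm (y - x))\<^sup>2) * heat b (y - x)))\<bar>)" for s
        by (auto split: split_indicator)
      ultimately show "integrable lborel (\<lambda>s. LBINT y. norm (case (s, y) of (s, y) \<Rightarrow> indicator {a..b} s * (M * (u y * ((1 + (norm (y - x))\<^sup>2) * heat b (y - x))))))"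
        by simp
      show "AE s in lborel. integrable lborel (\<lambda>y. case (s, y) of (s, y) \<Rightarrow> indicator {a..b} s * (M * (u y * ((1 + (norm (y - x))\<^sup>2) * heat b (y - x)))))"
        using Mint by auto
    qed measurable
    show "F \<in> borel_measurable (lborel \<Otimes>\<^sub>M lborel)" unfolding F_def by measurable
    show "AE p in lborel \<Otimes>\<^sub>M lborel. norm (F p) \<le> norm (case p of (s, y) \<Rightarrow> indicator {a..b} s * (M * (u y * ((1 + (norm (y - x))\<^sup>2) * heat b (y - x)))))"
    proof (intro AE_I2, clarify)
      fix s :: real and y :: "real^3"
      have "\<bar>u y\<bar> * \<bar>exp (- lam * s) * (lam * heat s (y - x) - heat_dt s (y - x))\<bar> \<le> \<bar>u y\<bar> * (M * ((1 + (norm (y - x))\<^sup>2) * heat b (y - x)))"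
        if "s \<in> {a..b}"
        using that by (intro mult_left_mono bound) auto
      then show "norm (F (s, y)) \<le> norm (indicator {a..b} s * (M * (u y * ((1 + (norm (y - x))\<^sup>2) * heat b (y - x)))))"
        using M by (auto simp: F_def abs_mult mult_ac split: split_indicator)
    qed
  qed
  have inner: "(LINT s|lborel. F (s, y)) = u y * (exp (- lam * a) * heat a (y - x) - exp (- lam * b) * heat b (y - x))" for y
  proof -
    have "(LINT s|lborel. indicator {a..b} s *\<^sub>R (exp (- lam * s) * (lam * heat s (y - x) - heat_dt s (y - x))))
      = - (exp (- lam * b) * heat b (y - x)) - - (exp (- lam * a) * heat a (y - x))"
    proof (rule integral_FTC_Icc)
      fix s assume "a \<le> s" "s \<le> b"
      then have s: "s > 0" using a by simp
      have "((\<lambda>s. exp (- lam * s)) has_real_derivative - lam * exp (- lam * s)) (at s)"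
        by (auto intro!: derivative_eq_intros)
      from DERIV_minus[OF DERIV_mult[OF this heat_deriv_time[OF s, of "y - x"]]]
      have D: "((\<lambda>s. - (exp (- lam * s) * heat s (y - x))) has_real_derivative exp (- lam * s) * (lam * heat s (y - x) - heat_dt s (y - x))) (at s)"
        by (simp add: heat_dt_def algebra_simps)
      then show "((\<lambda>s. - (exp (- lam * s) * heat s (y - x))) has_vector_derivative exp (- lam * s) * (lam * heat s (y - x) - heat_dt s (y - x))) (at s within {a..b})"
        by (auto simp flip: has_real_derivative_iff_has_vector_derivative intro: DERIV_subset)
    next
      show "continuous_on {a..b} (\<lambda>s. exp (- lam * s) * (lam * heat s (y - x) - heat_dt s (y - x)))"
        unfolding heat_dt_def heat_def using a gauss_mass_pos by (auto intro!: continuous_intros)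
    qed (use ab in auto)
    then have "u y * (LINT s|lborel. indicator {a..b} s *\<^sub>R (exp (- lam * s) * (lam * heat s (y - x) - heat_dt s (y - x))))
      = u y * (exp (- lam * a) * heat a (y - x) - exp (- lam * b) * heat b (y - x))" by simp
    then show ?thesis
      unfolding F_def by (simp add: mult.left_commute[of _ "u y"])
  qed
  have "(LINT s|lborel. LINT y|lborel. F (s, y)) = (LINT y|lborel. LINT s|lborel. F (s, y))"
    using lborel_pair.Fubini_integral[of "\<lambda>s y. F (s, y)"] Fint by simp
  also have "\<dots> = (LINT y|lborel. u y * (exp (- lam * a) * heat a (y - x) - exp (- lam * b) * heat b (y - x)))"
    by (simp only: inner)
  also have "(LINT y|lborel. u y * (exp (- lam * a) * heat a (y - x) - exp (- lam * b) * heat b (y - x)))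
     = exp (- lam * a) * (LINT y|lborel. u y * heat a (y - x)) - exp (- lam * b) * (LINT y|lborel. u y * heat b (y - x))"
    using u_heat_integrable[OF a, of x] u_heat_integrable[OF b, of x]
    by (simp add: right_diff_distrib mult.left_commute[of "u _"])
  finally have I: "(LINT s|lborel. LINT y|lborel. F (s, y)) = exp (- lam * a) * (LINT y|lborel. u y * heat a (y - x)) - exp (- lam * b) * (LINT y|lborel. u y * heat b (y - x))" .
  have F_in: "(LINT y|lborel. F (s, y)) = indicator {a..b} s * (exp (- lam * s) * (LINT y|lborel. h y * heat s (y - x)))" for s
  proof (cases "s \<in> {a..b}")
    case True
    then have "s > 0" using a by simp
    with True show ?thesis by (simp add: F_def heat_eq mult.left_commute[of _ "exp _"])
  qed (simp add: F_def)
  have "(\<integral>\<^sup>+s. ennreal (exp (- lam * s)) * heat_op s (\<lambda>y. ennreal (h y)) x * indicator {a..b} s \<partial>lborel)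
    = (\<integral>\<^sup>+s. ennreal (LINT y|lborel. F (s, y)) \<partial>lborel)"
  proof (rule nn_integral_cong)
    fix s
    show "ennreal (exp (- lam * s)) * heat_op s (\<lambda>y. ennreal (h y)) x * indicator {a..b} s = ennreal (LINT y|lborel. F (s, y))"
    proof (cases "s \<in> {a..b}")
      case True
      then have "s > 0" using a by simp
      with True show ?thesis by (simp add: F_in heat_op_h ennreal_mult')
    qed (simp add: F_in)
  qed
  also have "\<dots> = ennreal (LINT s|lborel. LINT y|lborel. F (s, y))"
  proof (rule nn_integral_eq_integral)
    show "integrable lborel (\<lambda>s. LINT y|lborel. F (s, y))"
      using lborel_pair.integrable_fst'[OF Fint] by simp
    show "AE s in lborel. 0 \<le> (LINT y|lborel. F (s, y))"
      unfolding F_in by (auto intro!: mult_nonneg_nonneg integral_nonneg simp: h_nonneg)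
  qed
  finally show ?thesis unfolding I .
qed

end

section \<open>Representation by the resolvent and finite energy\<close>

lemma heat_le: "t \<ge> a \<Longrightarrow> a > 0 \<Longrightarrow> heat t z \<le> a powr (- 3 / 2) / gauss_mass"
proof -
  assume "t \<ge> a" "a > 0"
  then have "t powr (- 3 / 2) * exp (- ((norm z)\<^sup>2 / (4 * t))) \<le> a powr (- 3 / 2) * 1"
    by (intro mult_mono powr_mono2') auto
  then show ?thesis
    using gauss_mass_pos by (simp add: heat_def divide_right_mono)
qed

text \<open>From a \<le> 1 + a^2: square integrable functions are locally integrable.\<close>

lemma nn_integral_1_plus_square_finite:
  assumes "integrable lborel (\<lambda>x. (u x)\<^sup>2)" "emeasure lborel B < \<infinity>"
    and [measurable]: "B \<in> sets borel" "u \<in> borel_measurable borel"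
  shows "(\<integral>\<^sup>+x. ennreal (u x) * indicator B x \<partial>lborel) \<le> emeasure lborel B + (\<integral>\<^sup>+x. ennreal ((u x)\<^sup>2) \<partial>lborel)"
    and "emeasure lborel B + (\<integral>\<^sup>+x. ennreal ((u x)\<^sup>2) \<partial>lborel) < \<infinity>"
proof -
  have le: "a \<le> 1 + a\<^sup>2" for a :: real
    using sum_squares_bound[of 1 a] by (cases "a \<ge> 0") (auto simp: add_increasing2)
  have "(\<integral>\<^sup>+x. ennreal (u x) * indicator B x \<partial>lborel) \<le> (\<integral>\<^sup>+x. indicator B x + ennreal ((u x)\<^sup>2) \<partial>lborel)"
  proof (rule nn_integral_mono)
    fix x
    show "ennreal (u x) * indicator B x \<le> indicator B x + ennreal ((u x)\<^sup>2)"
      using ennreal_leI[OF le[of "u x"]] by (auto split: split_indicator simp: ennreal_plus)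
  qed
  also have "\<dots> = emeasure lborel B + (\<integral>\<^sup>+x. ennreal ((u x)\<^sup>2) \<partial>lborel)"
    by (subst nn_integral_add) auto
  finally show "(\<integral>\<^sup>+x. ennreal (u x) * indicator B x \<partial>lborel) \<le> emeasure lborel B + (\<integral>\<^sup>+x. ennreal ((u x)\<^sup>2) \<partial>lborel)" .
  show "emeasure lborel B + (\<integral>\<^sup>+x. ennreal ((u x)\<^sup>2) \<partial>lborel) < \<infinity>"
    using assms(1,2) by (simp add: integrable_iff_bounded)
qed

lemma heat_rescale:
  assumes t: "t > 0"
  shows "ennreal (sqrt t ^ 3) * ennreal (heat t (sqrt t *\<^sub>R z)) = ennreal (heat 1 z)"
proof -
  define s where "s = sqrt t"
  have s: "s > 0" "t = s\<^sup>2" using t by (auto simp: s_def)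
  have "s powr (2 * (- 3 / 2)) = (s powr 2) powr (- 3 / 2)"
    by (rule powr_powr[symmetric])
  then have sp: "t powr (- 3 / 2) = 1 / s ^ 3"
    using s by (simp add: powr_neg_numeral)
  have "(norm (s *\<^sub>R z))\<^sup>2 / (4 * t) = (norm z)\<^sup>2 / 4"
    using s by (simp add: power_mult_distrib)
  then have "s ^ 3 * heat t (s *\<^sub>R z) = heat 1 z"
    using s(1) by (simp only: heat_def sp) simp
  then show ?thesis unfolding s_def using t by (simp flip: ennreal_mult')
qed

text \<open>Parabolic scaling turns heat averages over shrinking times into fixed averages of
  translates, whose limits follow by dominated convergence.\<close>

lemma heat_op_box:
  fixes u :: "real^3 \<Rightarrow> real"
  assumes [measurable]: "u \<in> borel_measurable borel" "B \<in> sets borel" and t: "t > 0"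
  shows "(\<integral>\<^sup>+x. heat_op t (\<lambda>y. ennreal (u y)) x * indicator B x \<partial>lborel)
    = (\<integral>\<^sup>+z. ennreal (heat 1 z) * (\<integral>\<^sup>+y. ennreal (u y) * indicator B (y + sqrt t *\<^sub>R z) \<partial>lborel) \<partial>lborel)"
proof -
  have "heat_op t (\<lambda>y. ennreal (u y)) x = (\<integral>\<^sup>+z. ennreal (heat 1 z) * ennreal (u (x - sqrt t *\<^sub>R z)) \<partial>lborel)" for x
  proof -
    have "heat_op t (\<lambda>y. ennreal (u y)) x
      = ennreal (\<bar>- sqrt t\<bar> ^ DIM(real^3)) * (\<integral>\<^sup>+z. ennreal (heat t (x - (x + (- sqrt t) *\<^sub>R z))) * ennreal (u (x + (- sqrt t) *\<^sub>R z)) \<partial>lborel)"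
      unfolding heat_op_def by (rule nn_integral_lborel_affine) (use t in auto)
    also have "\<dots> = (\<integral>\<^sup>+z. ennreal (sqrt t ^ 3) * (ennreal (heat t (sqrt t *\<^sub>R z)) * ennreal (u (x - sqrt t *\<^sub>R z))) \<partial>lborel)"
      using t by (subst nn_integral_cmult) auto
    also have "\<dots> = (\<integral>\<^sup>+z. ennreal (heat 1 z) * ennreal (u (x - sqrt t *\<^sub>R z)) \<partial>lborel)"
      by (simp only: mult.assoc[symmetric] heat_rescale[OF t])
    finally show ?thesis .
  qed
  then have "(\<integral>\<^sup>+x. heat_op t (\<lambda>y. ennreal (u y)) x * indicator B x \<partial>lborel)
    = (\<integral>\<^sup>+x. (\<integral>\<^sup>+z. ennreal (heat 1 z) * (ennreal (u (x - sqrt t *\<^sub>R z)) * indicator B x) \<partial>lborel) \<partial>lborel)"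
    by (simp add: nn_integral_multc[symmetric] mult.assoc)
  also have "\<dots> = (\<integral>\<^sup>+z. (\<integral>\<^sup>+x. ennreal (heat 1 z) * (ennreal (u (x - sqrt t *\<^sub>R z)) * indicator B x) \<partial>lborel) \<partial>lborel)"
    by (rule lborel_pair.Fubini') measurable
  also have "\<dots> = (\<integral>\<^sup>+z. ennreal (heat 1 z) * (\<integral>\<^sup>+y. ennreal (u y) * indicator B (y + sqrt t *\<^sub>R z) \<partial>lborel) \<partial>lborel)"
  proof (rule nn_integral_cong)
    fix z
    have "(\<integral>\<^sup>+x. ennreal (heat 1 z) * (ennreal (u (x - sqrt t *\<^sub>R z)) * indicator B x) \<partial>lborel)
      = ennreal (heat 1 z) * (\<integral>\<^sup>+x. ennreal (u (x - sqrt t *\<^sub>R z)) * indicator B ((x - sqrt t *\<^sub>R z) + sqrt t *\<^sub>R z) \<partial>lborel)"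
      by (subst nn_integral_cmult) auto
    also have "(\<integral>\<^sup>+x. ennreal (u (x - sqrt t *\<^sub>R z)) * indicator B ((x - sqrt t *\<^sub>R z) + sqrt t *\<^sub>R z) \<partial>lborel)
      = (\<integral>\<^sup>+y. ennreal (u y) * indicator B (y + sqrt t *\<^sub>R z) \<partial>lborel)"
      by (rule nn_integral_lborel_shift[of "\<lambda>y. ennreal (u y) * indicator B (y + sqrt t *\<^sub>R z)"]) measurable
    finally show "(\<integral>\<^sup>+x. ennreal (heat 1 z) * (ennreal (u (x - sqrt t *\<^sub>R z)) * indicator B x) \<partial>lborel)
      = ennreal (heat 1 z) * (\<integral>\<^sup>+y. ennreal (u y) * indicator B (y + sqrt t *\<^sub>R z) \<partial>lborel)" .
  qed
  finally show ?thesis .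
qed

text \<open>The indicator is continuous off the frontier, and the frontier of a box is a null set,
  which is enough for dominated convergence.\<close>

lemma indicator_box_translate_tendsto:
  assumes "s \<longlonglongrightarrow> 0" "y \<notin> frontier (box a b)"
  shows "(\<lambda>n. indicator (box a b) (y + s n *\<^sub>R z) :: ennreal) \<longlonglongrightarrow> indicator (box a b) y"
proof -
  have lim: "(\<lambda>n. y + s n *\<^sub>R z) \<longlonglongrightarrow> y"
    using assms(1) by (auto intro!: tendsto_eq_intros)
  consider "y \<in> box a b" | "y \<in> - closure (box a b)"
    using assms(2) by (auto simp: frontier_def interior_open open_box)
  then show ?thesis
  proof cases
    case 1
    from topological_tendstoD[OF lim open_box 1]
    show ?thesis by (intro tendsto_eventually) (auto elim!: eventually_mono simp: 1)
  next
    case 2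
    then have nin: "y \<notin> box a b" using closure_subset by auto
    have "\<forall>\<^sub>F n in sequentially. y + s n *\<^sub>R z \<in> - closure (box a b)"
      by (rule topological_tendstoD[OF lim _ 2]) auto
    then show ?thesis
      using closure_subset[of "box a b"]
      by (intro tendsto_eventually) (auto elim!: eventually_mono simp: nin split: split_indicator)
  qed
qed

text \<open>Convergence of the heat averages at time 0 is tested on boxes only; this suffices for
  \<open>representation\<close>, since boxes generate the Borel sets. Dominated convergence is used
  twice: inside for a fixed translate, with u on a larger ball as majorant, and outside with a bound
  uniform in the translate.\<close>

lemma heat_op_box_tendsto:
  fixes u :: "real^3 \<Rightarrow> real"
  assumes [measurable]: "u \<in> borel_measurable borel"
    and u_sq: "integrable lborel (\<lambda>x. (u x)\<^sup>2)" and t: "\<And>n. t n > 0" "\<And>n. t n \<le> 1" "t \<longlonglongrightarrow> 0"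
  shows "(\<lambda>n. \<integral>\<^sup>+x. heat_op (t n) (\<lambda>y. ennreal (u y)) x * indicator (box a b) x \<partial>lborel)
    \<longlonglongrightarrow> (\<integral>\<^sup>+x. ennreal (u x) * indicator (box a b) x \<partial>lborel)"
proof -
  let ?B = "box a b"
  let ?I = "\<lambda>n z. \<integral>\<^sup>+y. ennreal (u y) * indicator ?B (y + sqrt (t n) *\<^sub>R z) \<partial>lborel"
  let ?S = "\<integral>\<^sup>+x. ennreal ((u x)\<^sup>2) \<partial>lborel"
  have s0: "(\<lambda>n. sqrt (t n)) \<longlonglongrightarrow> 0"
    using tendsto_real_sqrt[OF t(3)] by simp
  obtain R where R: "R > 0" "\<And>y. y \<in> ?B \<Longrightarrow> norm y \<le> R"
    using bounded_box[of a b] by (meson bounded_pos)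
  have lim: "(\<lambda>n. ?I n z) \<longlonglongrightarrow> (\<integral>\<^sup>+y. ennreal (u y) * indicator ?B y \<partial>lborel)" for z
  proof (rule nn_integral_dominated_convergence[where w = "\<lambda>y. ennreal (u y) * indicator (cball 0 (R + norm z)) y"])
    show "(\<integral>\<^sup>+y. ennreal (u y) * indicator (cball 0 (R + norm z)) y \<partial>lborel) < \<infinity>"
      using R(1) by (intro le_less_trans[OF nn_integral_1_plus_square_finite(1) nn_integral_1_plus_square_finite(2)] u_sq)
        (auto simp: emeasure_cball)
    have "y \<in> cball 0 (R + norm z)" if "y + sqrt (t n) *\<^sub>R z \<in> ?B" for n y
    proof -
      have "norm y \<le> norm (y + sqrt (t n) *\<^sub>R z) + norm (sqrt (t n) *\<^sub>R z)"
        using norm_triangle_ineq4[of "y + sqrt (t n) *\<^sub>R z" "sqrt (t n) *\<^sub>R z"] by simp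
      also have "\<dots> = norm (y + sqrt (t n) *\<^sub>R z) + sqrt (t n) * norm z"
        using t(1)[of n] by simp
      also have "\<dots> \<le> R + 1 * norm z"
        using R(2)[OF that] t(1,2)[of n] by (intro add_mono mult_right_mono) auto
      finally show ?thesis by simp
    qed
    then show "AE y in lborel. ennreal (u y) * indicator ?B (y + sqrt (t n) *\<^sub>R z) \<le> ennreal (u y) * indicator (cball 0 (R + norm z)) y" for n
      by (intro AE_I2) (auto split: split_indicator)
    have "frontier ?B \<in> null_sets lborel"
      using negligible_convex_frontier[of ?B] by (simp add: negligible_iff_null_sets null_sets_completion_iff)
    then have "AE y in lborel. y \<notin> frontier ?B" by (rule AE_not_in)
    then show "AE y in lborel. (\<lambda>n. ennreal (u y) * indicator ?B (y + sqrt (t n) *\<^sub>R z)) \<longlonglongrightarrow> ennreal (u y) * indicator ?B y"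
      by eventually_elim (intro ennreal_tendsto_cmult indicator_box_translate_tendsto s0, auto)
    have [measurable]: "cball (0::real^3) (R + norm z) \<in> sets borel" by auto
    show "(\<lambda>y. ennreal (u y) * indicator (cball 0 (R + norm z)) y) \<in> borel_measurable lborel" by measurable
  qed auto
  have bd: "?I n z \<le> emeasure lborel ?B + ?S" for n z
  proof -
    have "?I n z = (\<integral>\<^sup>+y. ennreal (u (y - sqrt (t n) *\<^sub>R z)) * indicator ?B y \<partial>lborel)"
      using nn_integral_lborel_shift[of "\<lambda>y. ennreal (u y) * indicator ?B (y + sqrt (t n) *\<^sub>R z)" "sqrt (t n) *\<^sub>R z"]
      by simp
    also have "\<dots> \<le> emeasure lborel ?B + (\<integral>\<^sup>+y. ennreal ((u (y - sqrt (t n) *\<^sub>R z))\<^sup>2) \<partial>lborel)"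
    proof (rule nn_integral_1_plus_square_finite(1))
      show "integrable lborel (\<lambda>y. (u (y - sqrt (t n) *\<^sub>R z))\<^sup>2)"
        using u_sq nn_integral_lborel_shift[of "\<lambda>y. ennreal ((u y)\<^sup>2)" "sqrt (t n) *\<^sub>R z"]
        by (simp add: integrable_iff_bounded)
    qed (auto simp: emeasure_lborel_box_eq)
    also have "\<dots> = emeasure lborel ?B + ?S"
      using nn_integral_lborel_shift[of "\<lambda>y. ennreal ((u y)\<^sup>2)" "sqrt (t n) *\<^sub>R z"] by simp
    finally show ?thesis .
  qed
  have "(\<lambda>n. \<integral>\<^sup>+z. ennreal (heat 1 z) * ?I n z \<partial>lborel) \<longlonglongrightarrow> (\<integral>\<^sup>+z. ennreal (heat 1 z) * (\<integral>\<^sup>+y. ennreal (u y) * indicator ?B y \<partial>lborel) \<partial>lborel)"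
  proof (rule nn_integral_dominated_convergence[where w = "\<lambda>z. ennreal (heat 1 z) * (emeasure lborel ?B + ?S)"])
    have "emeasure lborel ?B + ?S < \<infinity>"
      using u_sq by (intro nn_integral_1_plus_square_finite(2)) (auto simp: emeasure_lborel_box_eq)
    then show "(\<integral>\<^sup>+z. ennreal (heat 1 z) * (emeasure lborel ?B + ?S) \<partial>lborel) < \<infinity>"
      by (simp add: nn_integral_multc nn_integral_heat)
    show "AE z in lborel. ennreal (heat 1 z) * ?I n z \<le> ennreal (heat 1 z) * (emeasure lborel ?B + ?S)" for n
      by (intro AE_I2 mult_left_mono bd) auto
    show "AE z in lborel. (\<lambda>n. ennreal (heat 1 z) * ?I n z) \<longlonglongrightarrow> ennreal (heat 1 z) * (\<integral>\<^sup>+y. ennreal (u y) * indicator ?B y \<partial>lborel)"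
      by (intro AE_I2 ennreal_tendsto_cmult lim) auto
  qed measurable
  then show ?thesis
    by (simp add: heat_op_box t nn_integral_multc nn_integral_heat)
qed

context weak_eq
begin

text \<open>The boundary term at infinity disappears because the heat averages of u stay bounded for
  times at least a, while the exponential factor tends to 0.\<close>

lemma heat_flow_Ici:
  assumes lam: "lam > 0" and a: "0 < a"
  shows "(\<integral>\<^sup>+s. ennreal (exp (- lam * s)) * heat_op s (\<lambda>y. ennreal (h y)) x * indicator {a..} s \<partial>lborel)
    = ennreal (exp (- lam * a)) * heat_op a (\<lambda>y. ennreal (u y)) x"
proof -
  let ?U = "\<lambda>t. LINT y|lborel. u y * heat t (y - x)"
  let ?c = "a powr (- 3 / 2) / gauss_mass"
  let ?B = "(LINT y|lborel. (u y)\<^sup>2) + ?c"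
  have U: "0 \<le> ?U b" "?U b \<le> ?B" if "b \<ge> a" for b
  proof -
    have b: "b > 0" using a that by simp
    show "0 \<le> ?U b" using u_pos by (intro Bochner_Integration.integral_nonneg) (simp add: less_imp_le)
    have I1: "integrable lborel (\<lambda>y. (heat b (y - x))\<^sup>2)"
      by (rule integrable_pd_heat_sq(3)[OF b SOME_Basis])
    have I2: "integrable lborel (\<lambda>y. heat b (y - x))"
      using integrable_lborel_reflect[OF integrable_heat[OF b], of x] by (simp add: heat_commute[of b x])
    have "?U b \<le> (LINT y|lborel. (u y)\<^sup>2 + (heat b (y - x))\<^sup>2)"
      using abs_mult_le_sum_squares
      by (intro integral_mono u_heat_integrable b Bochner_Integration.integrable_add u_sq I1) (meson abs_le_D1)
    also have "\<dots> = (LINT y|lborel. (u y)\<^sup>2) + (LINT y|lborel. (heat b (y - x))\<^sup>2)"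
      by (rule Bochner_Integration.integral_add[OF u_sq I1])
    \<comment> \<open>The kernel is bounded by \<open>?c\<close> and has mass 1, so its square
      integrates to at most \<open>?c\<close>.\<close>
    also have "(LINT y|lborel. (heat b (y - x))\<^sup>2) \<le> (LINT y|lborel. ?c * heat b (y - x))"
      unfolding power2_eq_square using I1 I2 heat_le[OF that a]
      by (intro integral_mono mult_right_mono) (auto simp: power2_eq_square)
    also have "\<dots> = ?c"
    proof -
      have "ennreal (LINT y|lborel. heat b (y - x)) = 1"
        using nn_integral_eq_integral[OF I2] nn_integral_heat_shift[OF b, of x] by (simp add: heat_commute[of b x])
      then show ?thesis by (simp add: ennreal_eq_1)
    qed
    finally show "?U b \<le> ?B" by simp
  qed
  have "(\<lambda>n. \<integral>\<^sup>+s. ennreal (exp (- lam * s)) * heat_op s (\<lambda>y. ennreal (h y)) x * indicator {a..a + real n} s \<partial>lborel)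
    \<longlonglongrightarrow> (\<integral>\<^sup>+s. ennreal (exp (- lam * s)) * heat_op s (\<lambda>y. ennreal (h y)) x * indicator {a..} s \<partial>lborel)"
  proof (rule nn_integral_LIMSEQ)
    show "incseq (\<lambda>n s. ennreal (exp (- lam * s)) * heat_op s (\<lambda>y. ennreal (h y)) x * indicator {a..a + real n} s)"
      by (auto simp: incseq_def le_fun_def split: split_indicator)
    show "(\<lambda>n. ennreal (exp (- lam * s)) * heat_op s (\<lambda>y. ennreal (h y)) x * indicator {a..a + real n} s)
      \<longlonglongrightarrow> ennreal (exp (- lam * s)) * heat_op s (\<lambda>y. ennreal (h y)) x * indicator {a..} s" for s
    proof (rule tendsto_eventually)
      obtain N where "s - a < real N" using reals_Archimedean2 by blast
      then show "\<forall>\<^sub>F n in sequentially. ennreal (exp (- lam * s)) * heat_op s (\<lambda>y. ennreal (h y)) x * indicator {a..a + real n} s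
        = ennreal (exp (- lam * s)) * heat_op s (\<lambda>y. ennreal (h y)) x * indicator {a..} s"
        by (intro eventually_sequentiallyI[of N]) (auto split: split_indicator)
    qed
  qed measurable
  moreover have "(\<lambda>n. \<integral>\<^sup>+s. ennreal (exp (- lam * s)) * heat_op s (\<lambda>y. ennreal (h y)) x * indicator {a..a + real n} s \<partial>lborel)
    \<longlonglongrightarrow> ennreal (exp (- lam * a) * ?U a - 0)"
  proof -
    have "(\<lambda>n. exp (- lam * a) * exp (- lam) ^ n * ?B) \<longlonglongrightarrow> exp (- lam * a) * 0 * ?B"
      using lam by (intro tendsto_intros LIMSEQ_realpow_zero) auto
    then have lim: "(\<lambda>n. exp (- lam * (a + real n)) * ?B) \<longlonglongrightarrow> 0"
      by (simp add: exp_of_nat_mult[symmetric] distrib_left mult.commute flip: exp_add)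
    have "(\<lambda>n. exp (- lam * (a + real n)) * ?U (a + real n)) \<longlonglongrightarrow> 0"
      by (rule Lim_null_comparison[OF always_eventually lim]) (use U in \<open>auto simp: abs_mult\<close>)
    then show ?thesis
      unfolding heat_flow_Icc[OF a le_add_same_cancel1[THEN iffD2, OF of_nat_0_le_iff]]
      by (intro tendsto_ennrealI tendsto_diff tendsto_const)
  qed
  ultimately have "(\<integral>\<^sup>+s. ennreal (exp (- lam * s)) * heat_op s (\<lambda>y. ennreal (h y)) x * indicator {a..} s \<partial>lborel)
    = ennreal (exp (- lam * a) * ?U a - 0)"
    by (rule LIMSEQ_unique)
  then show ?thesis by (simp add: heat_op_u[OF a] ennreal_mult')
qed

text \<open>By \<open>heat_flow_Ici\<close> the n-th term is the integral of a nonnegative function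
  over the times from 1/(n+1) on, and these half-lines increase to the positive axis.\<close>

lemma heat_op_tendsto_resolvent:
  assumes lam: "lam > 0"
  shows "(\<lambda>n. ennreal (exp (- lam * (1 / real (Suc n)))) * heat_op (1 / real (Suc n)) (\<lambda>y. ennreal (u y)) x)
    \<longlonglongrightarrow> resolvent lam (\<lambda>y. ennreal (h y)) x"
    and "incseq (\<lambda>n x. ennreal (exp (- lam * (1 / real (Suc n)))) * heat_op (1 / real (Suc n)) (\<lambda>y. ennreal (u y)) x)"
proof -
  have pos: "0 < 1 / real (Suc n)" for n by simp
  have dec: "1 / real (Suc n) \<le> 1 / real (Suc m)" if "m \<le> n" for m n
    using that by (simp add: frac_le)
  show "incseq (\<lambda>n x. ennreal (exp (- lam * (1 / real (Suc n)))) * heat_op (1 / real (Suc n)) (\<lambda>y. ennreal (u y)) x)"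
    unfolding heat_flow_Ici[OF lam pos, symmetric] incseq_def le_fun_def
  proof (intro allI impI nn_integral_mono mult_left_mono)
    fix m n :: nat and s :: real assume "m \<le> n"
    from dec[OF this] show "indicator {1 / real (Suc m)..} s \<le> (indicator {1 / real (Suc n)..} s :: ennreal)"
      by (auto split: split_indicator)
  qed auto
  show "(\<lambda>n. ennreal (exp (- lam * (1 / real (Suc n)))) * heat_op (1 / real (Suc n)) (\<lambda>y. ennreal (u y)) x)
    \<longlonglongrightarrow> resolvent lam (\<lambda>y. ennreal (h y)) x"
    unfolding heat_flow_Ici[OF lam pos, symmetric] resolvent_def
  proof (rule nn_integral_LIMSEQ)
    show "incseq (\<lambda>n s. ennreal (exp (- lam * s)) * heat_op s (\<lambda>y. ennreal (h y)) x * indicator {1 / real (Suc n)..} s)"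
      unfolding incseq_def le_fun_def
    proof (intro allI impI mult_left_mono)
      fix m n :: nat and s :: real assume "m \<le> n"
      from dec[OF this] show "indicator {1 / real (Suc m)..} s \<le> (indicator {1 / real (Suc n)..} s :: ennreal)"
        by (auto split: split_indicator)
    qed auto
    show "(\<lambda>n. ennreal (exp (- lam * s)) * heat_op s (\<lambda>y. ennreal (h y)) x * indicator {1 / real (Suc n)..} s)
      \<longlonglongrightarrow> ennreal (exp (- lam * s)) * heat_op s (\<lambda>y. ennreal (h y)) x * indicator {0<..} s" for s
    proof (rule tendsto_eventually, cases "s > 0")
      case True
      obtain N where N: "1 / real (Suc N) < s" using nat_approx_posE[OF True] by blast
      have "1 / real (Suc n) \<le> s" if "n \<ge> N" for n
        using dec[OF that] N by linarith
      then show "\<forall>\<^sub>F n in sequentially. ennreal (exp (- lam * s)) * heat_op s (\<lambda>y. ennreal (h y)) x * indicator {1 / real (Suc n)..} s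
        = ennreal (exp (- lam * s)) * heat_op s (\<lambda>y. ennreal (h y)) x * indicator {0<..} s"
        using True by (intro eventually_sequentiallyI[of N]) (auto split: split_indicator)
    next
      case False
      have "\<not> 1 / real (Suc n) \<le> s" for n
        using pos[of n] False by linarith
      then show "\<forall>\<^sub>F n in sequentially. ennreal (exp (- lam * s)) * heat_op s (\<lambda>y. ennreal (h y)) x * indicator {1 / real (Suc n)..} s
        = ennreal (exp (- lam * s)) * heat_op s (\<lambda>y. ennreal (h y)) x * indicator {0<..} s"
        using False by (intro always_eventually) (auto split: split_indicator)
    qed
  qed measurable
qed

text \<open>The weighted heat averages at the times 1/(n+1) have two limits on every box: u, by
  \<open>heat_op_box_tendsto\<close>, and the resolvent of h, by monotone convergence. Two densities
  whose integrals over boxes agree are equal almost everywhere.\<close>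

theorem representation:
  assumes lam: "lam > 0"
  shows "AE x in lborel. ennreal (u x) = resolvent lam (\<lambda>y. ennreal (h y)) x"
proof -
  let ?r = "resolvent lam (\<lambda>y. ennreal (h y))"
  let ?f = "\<lambda>n x. ennreal (exp (- lam * (1 / real (Suc n)))) * heat_op (1 / real (Suc n)) (\<lambda>y. ennreal (u y)) x"
  have eq: "(\<integral>\<^sup>+x. ennreal (u x) * indicator (box a b) x \<partial>lborel) = (\<integral>\<^sup>+x. ?r x * indicator (box a b) x \<partial>lborel)" for a b
  proof (rule LIMSEQ_unique)
    have e: "(\<lambda>n. ennreal (exp (- lam * (1 / real (Suc n))))) \<longlonglongrightarrow> ennreal (exp (- lam * 0))"
      by (intro tendsto_ennrealI tendsto_intros LIMSEQ_Suc lim_1_over_n)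
    have "(\<lambda>n. ennreal (exp (- lam * (1 / real (Suc n)))) * (\<integral>\<^sup>+x. heat_op (1 / real (Suc n)) (\<lambda>y. ennreal (u y)) x * indicator (box a b) x \<partial>lborel))
      \<longlonglongrightarrow> ennreal (exp (- lam * 0)) * (\<integral>\<^sup>+x. ennreal (u x) * indicator (box a b) x \<partial>lborel)"
      by (intro tendsto_mult_ennreal e heat_op_box_tendsto u_sq LIMSEQ_Suc lim_1_over_n) auto
    then show "(\<lambda>n. \<integral>\<^sup>+x. ?f n x * indicator (box a b) x \<partial>lborel) \<longlonglongrightarrow> (\<integral>\<^sup>+x. ennreal (u x) * indicator (box a b) x \<partial>lborel)"
      by (simp add: nn_integral_cmult mult.assoc)
    show "(\<lambda>n. \<integral>\<^sup>+x. ?f n x * indicator (box a b) x \<partial>lborel) \<longlonglongrightarrow> (\<integral>\<^sup>+x. ?r x * indicator (box a b) x \<partial>lborel)"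
    proof (rule nn_integral_LIMSEQ)
      show "incseq (\<lambda>n x. ?f n x * indicator (box a b) x)"
        using heat_op_tendsto_resolvent(2)[OF lam] unfolding incseq_def le_fun_def
        by (auto intro!: mult_right_mono)
      show "(\<lambda>n. ?f n x * indicator (box a b) x) \<longlonglongrightarrow> ?r x * indicator (box a b) x" for x
        using heat_op_tendsto_resolvent(1)[OF lam] by (auto split: split_indicator)
    qed measurable
  qed
  have "density lborel (\<lambda>x. ennreal (u x)) = density lborel ?r"
  proof (rule measure_eqI_generator_eq)
    let ?E = "range (\<lambda>(a, b). box a b::(real^3) set)"
    show "Int_stable ?E" by (auto simp: Int_stable_def box_Int_box)
    show "?E \<subseteq> Pow UNIV" "sets (density lborel (\<lambda>x. ennreal (u x))) = sigma_sets UNIV ?E" "sets (density lborel ?r) = sigma_sets UNIV ?E"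
      by (simp_all add: borel_eq_box)
    let ?A = "\<lambda>n::nat. box (- (real n *\<^sub>R One)) (real n *\<^sub>R One) :: (real^3) set"
    show "range ?A \<subseteq> ?E" "(\<Union>i. ?A i) = UNIV"
      unfolding UN_box_eq_UNIV by auto
    show "emeasure (density lborel (\<lambda>x. ennreal (u x))) (?A i) \<noteq> \<infinity>" for i
    proof -
      have "(\<integral>\<^sup>+x. ennreal (u x) * indicator (?A i) x \<partial>lborel) < \<infinity>"
        by (rule le_less_trans[OF nn_integral_1_plus_square_finite(1)[OF u_sq] nn_integral_1_plus_square_finite(2)[OF u_sq]])
           (auto simp: emeasure_lborel_box_eq)
      then show ?thesis by (simp add: emeasure_density)
    qed
    show "emeasure (density lborel (\<lambda>x. ennreal (u x))) X = emeasure (density lborel ?r) X" if "X \<in> ?E" for X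
      using that by (auto simp: emeasure_density eq)
  qed
  then show ?thesis
    by (intro sigma_finite_measure.density_unique[OF sigma_finite_lborel]) auto
qed

end

section \<open>Finiteness of the energy\<close>

lemma heat_form_bound:
  fixes f g :: "real^3 \<Rightarrow> real"
  assumes [measurable]: "f \<in> borel_measurable borel" "g \<in> borel_measurable borel" and t: "t > 0"
    and f2: "integrable lborel (\<lambda>x. (f x)\<^sup>2)" and g2: "integrable lborel (\<lambda>x. (g x)\<^sup>2)"
  shows "\<bar>LINT x|lborel. LINT y|lborel. f x * g y * heat t (x - y)\<bar> \<le> (LINT x|lborel. (f x)\<^sup>2) + (LINT x|lborel. (g x)\<^sup>2)"
proof -
  let ?F = "\<lambda>(x, y). f x * g y * heat t (x - y)"
  have "ennreal (norm (LINT p|(lborel \<Otimes>\<^sub>M lborel). ?F p)) \<le> (\<integral>\<^sup>+p. norm (?F p) \<partial>(lborel \<Otimes>\<^sub>M lborel))"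
    by (rule integral_norm_bound_ennreal[OF integrable_convolution_form[OF _ _ _ f2 g2 integrable_heat[OF t]]]) auto
  also have "\<dots> = (\<integral>\<^sup>+x. \<integral>\<^sup>+y. ennreal \<bar>f x * g y * heat t (x - y)\<bar> \<partial>lborel \<partial>lborel)"
    by (subst lborel.nn_integral_fst[symmetric]) auto
  also have "\<dots> \<le> (\<integral>\<^sup>+z. ennreal \<bar>heat t z\<bar> \<partial>lborel) * ((\<integral>\<^sup>+x. ennreal ((f x)\<^sup>2) \<partial>lborel) + (\<integral>\<^sup>+x. ennreal ((g x)\<^sup>2) \<partial>lborel))"
    by (rule nn_integral_convolution_form) auto
  also have "\<dots> = ennreal ((LINT x|lborel. (f x)\<^sup>2) + (LINT x|lborel. (g x)\<^sup>2))"
    using f2 g2 by (simp add: nn_integral_heat[OF t] nn_integral_eq_integral ennreal_plus)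
  finally have "\<bar>LINT p|(lborel \<Otimes>\<^sub>M lborel). ?F p\<bar> \<le> (LINT x|lborel. (f x)\<^sup>2) + (LINT x|lborel. (g x)\<^sup>2)"
    by (subst (asm) ennreal_le_iff) auto
  then show ?thesis
    using lborel_pair.integral_fst[of "\<lambda>x y. f x * g y * heat t (x - y)"]
      integrable_convolution_form[OF _ _ _ f2 g2 integrable_heat[OF t]] by simp
qed

context weak_eq
begin

text \<open>Symmetry of the kernel moves the heat average from u to h, where the equation can be
  tested with Gaussians. The derivative on the kernel is then moved onto u by the weak gradient,
  leaving quadratic forms in G and u that are bounded uniformly in t.\<close>

lemma energy_bound:
  assumes t: "t > 0"
  shows "(\<integral>\<^sup>+y. ennreal (h y) * heat_op t (\<lambda>y. ennreal (u y)) y \<partial>lborel)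
    \<le> ennreal (2 * (\<Sum>i\<in>Basis. LINT x|lborel. (G x \<bullet> i)\<^sup>2) + \<bar>lam\<bar> * (2 * (LINT x|lborel. (u x)\<^sup>2)))"
proof -
  define d where "d i z = - (z \<bullet> i / (2 * t)) * heat t z" for i z :: "real^3"
  have [measurable]: "d i \<in> borel_measurable borel" for i
    unfolding d_def by measurable
  \<comment> \<open>Oddness of the differentiated kernel produces the sign that cancels the one from
    the weak gradient.\<close>
  have d_odd: "d i (x - y) = - d i (y - x)" for i x y
    by (simp add: d_def heat_commute[of t x y] inner_diff_left diff_divide_distrib left_diff_distrib)
  have pd_d: "pd (\<lambda>y. heat t (y - x)) i y = d i (y - x)" for i x y
    unfolding d_def by (rule pd_heat[OF t])
  have d_int: "integrable lborel (d i)" if i: "i \<in> Basis" for i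
  proof (rule Bochner_Integration.integrable_bound)
    let ?w = "\<lambda>z. 1 / (2 * t) * ((t powr (- 3 / 2) / gauss_mass) * (norm z ^ (2 * 0) * exp (- (1 / (4 * t) * (norm z)\<^sup>2)) + norm z ^ (2 * 1) * exp (- (1 / (4 * t) * (norm z)\<^sup>2)))) :: real"
    show "integrable lborel (?w :: real^3 \<Rightarrow> real)"
      using t by (intro integrable_mult_right Bochner_Integration.integrable_add integrable_power_gauss) auto
    show "AE z in lborel. norm (d i z) \<le> norm (?w z)"
    proof (rule AE_I2)
      fix z :: "real^3"
      have "\<bar>z \<bullet> i\<bar> \<le> 1 * norm z"
        using Basis_le_norm[OF i] by simp
      also have "\<dots> \<le> 1 + (norm z)\<^sup>2"
        using abs_mult_le_sum_squares[of 1 "norm z"] by simp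
      finally have "1 / (2 * t) * \<bar>z \<bullet> i\<bar> * heat t z \<le> 1 / (2 * t) * (1 + (norm z)\<^sup>2) * heat t z"
        using t by (intro mult_right_mono mult_left_mono) auto
      also have "\<dots> = ?w z"
        by (simp add: heat_def algebra_simps add_divide_distrib power2_eq_square)
      finally show "norm (d i z) \<le> norm (?w z)"
        using t gauss_mass_pos by (simp add: d_def abs_mult)
    qed
  qed measurable
  define P where "P x = (LINT y|lborel. h y * heat t (y - x))" for x
  let ?A = "\<lambda>i. LINT y|lborel. LINT x|lborel. (G y \<bullet> i) * (G x \<bullet> i) * heat t (y - x)"
  let ?B = "LINT x|lborel. LINT y|lborel. u x * u y * heat t (x - y)"
  have J: "integrable lborel (\<lambda>x. LINT y|lborel. u x * (G y \<bullet> i) * d i (x - y))"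
      "(LINT x|lborel. LINT y|lborel. u x * (G y \<bullet> i) * d i (x - y)) = - ?A i" if i: "i \<in> Basis" for i
  proof -
    have int: "integrable (lborel \<Otimes>\<^sub>M lborel) (\<lambda>(x, y). u x * (G y \<bullet> i) * d i (x - y))"
      by (intro integrable_convolution_form u_sq G_comp_sq i d_int) auto
    show "integrable lborel (\<lambda>x. LINT y|lborel. u x * (G y \<bullet> i) * d i (x - y))"
      using lborel_pair.integrable_fst'[OF int] by simp
    have "(LINT x|lborel. LINT y|lborel. u x * (G y \<bullet> i) * d i (x - y)) = (LINT y|lborel. LINT x|lborel. u x * (G y \<bullet> i) * d i (x - y))"
      by (rule lborel_pair.Fubini_integral[symmetric, OF int])
    also have "\<dots> = (LINT y|lborel. (G y \<bullet> i) * (LINT x|lborel. u x * pd (\<lambda>x. heat t (x - y)) i x))"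
      by (simp add: pd_d mult.assoc mult.left_commute[of "u _"])
    also have "\<dots> = (LINT y|lborel. (G y \<bullet> i) * - (LINT x|lborel. heat t (x - y) * (G x \<bullet> i)))"
      using i t by (subst weak_grad_smooth[OF smooth_heat]) (auto intro!: integrable_pd_heat_sq)
    also have "\<dots> = - ?A i"
      by (simp add: mult_ac heat_commute)
    finally show "(LINT x|lborel. LINT y|lborel. u x * (G y \<bullet> i) * d i (x - y)) = - ?A i" .
  qed
  have intB: "integrable lborel (\<lambda>x. LINT y|lborel. u x * u y * heat t (x - y))"
    using lborel_pair.integrable_fst'[OF integrable_convolution_form[OF u_borel u_borel _ u_sq u_sq integrable_heat[OF t]]] by simp
  have uP: "u x * P x = (\<Sum>i\<in>Basis. - (LINT y|lborel. u x * (G y \<bullet> i) * d i (x - y))) + lam * (LINT y|lborel. u x * u y * heat t (x - y))" for x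
  proof -
    have "u x * P x = (\<Sum>i\<in>Basis. u x * (LINT y|lborel. (G y \<bullet> i) * d i (y - x))) + lam * (u x * (LINT y|lborel. u y * heat t (y - x)))"
      unfolding P_def heat_weak_form(2)[OF t, symmetric] pd_d by (simp add: algebra_simps sum_distrib_left)
    then show ?thesis
      by (simp add: d_odd[of _ x] mult.assoc heat_commute[of t x])
  qed
  have uP_int: "integrable lborel (\<lambda>x. u x * P x)"
    unfolding uP using J(1) intB by (intro Bochner_Integration.integrable_add Bochner_Integration.integrable_sum integrable_mult_right integrable_minus)
  have uP_eq: "(LINT x|lborel. u x * P x) = (\<Sum>i\<in>Basis. ?A i) + lam * ?B"
    unfolding uP using J intB by (simp add: Bochner_Integration.integral_add Bochner_Integration.integral_sum)
  have "(\<integral>\<^sup>+y. ennreal (h y) * heat_op t (\<lambda>y. ennreal (u y)) y \<partial>lborel)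
    = (\<integral>\<^sup>+y. \<integral>\<^sup>+x. ennreal (h y) * (ennreal (heat t (y - x)) * ennreal (u x)) \<partial>lborel \<partial>lborel)"
    unfolding heat_op_def by (subst nn_integral_cmult) auto
  also have "\<dots> = (\<integral>\<^sup>+x. \<integral>\<^sup>+y. ennreal (h y) * (ennreal (heat t (y - x)) * ennreal (u x)) \<partial>lborel \<partial>lborel)"
    by (rule lborel_pair.Fubini') measurable
  also have "\<dots> = (\<integral>\<^sup>+x. ennreal (u x) * heat_op t (\<lambda>y. ennreal (h y)) x \<partial>lborel)"
    unfolding heat_op_def by (subst nn_integral_cmult[symmetric]) (auto simp: mult_ac heat_commute)
  also have "\<dots> = (\<integral>\<^sup>+x. ennreal (u x * P x) \<partial>lborel)"
    using u_pos by (simp add: heat_op_h[OF t] P_def ennreal_mult' less_imp_le)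
  also have "\<dots> = ennreal (LINT x|lborel. u x * P x)"
  proof (rule nn_integral_eq_integral[OF uP_int], rule AE_I2)
    show "0 \<le> u x * P x" for x
      unfolding P_def using u_pos[of x]
      by (intro mult_nonneg_nonneg Bochner_Integration.integral_nonneg) (auto simp: h_nonneg)
  qed
  also have "\<dots> \<le> ennreal (2 * (\<Sum>i\<in>Basis. LINT x|lborel. (G x \<bullet> i)\<^sup>2) + \<bar>lam\<bar> * (2 * (LINT x|lborel. (u x)\<^sup>2)))"
  proof (rule ennreal_leI)
    have "(\<Sum>i\<in>Basis. ?A i) \<le> (\<Sum>i\<in>Basis. 2 * (LINT x|lborel. (G x \<bullet> i)\<^sup>2))"
    proof (rule sum_mono)
      fix i :: "real^3" assume i: "i \<in> Basis"
      have "\<bar>?A i\<bar> \<le> (LINT x|lborel. (G x \<bullet> i)\<^sup>2) + (LINT x|lborel. (G x \<bullet> i)\<^sup>2)"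
        by (intro heat_form_bound t G_comp_sq i) auto
      then show "?A i \<le> 2 * (LINT x|lborel. (G x \<bullet> i)\<^sup>2)" by linarith
    qed
    moreover have "lam * ?B \<le> \<bar>lam\<bar> * (2 * (LINT x|lborel. (u x)\<^sup>2))"
    proof -
      have "\<bar>?B\<bar> \<le> (LINT x|lborel. (u x)\<^sup>2) + (LINT x|lborel. (u x)\<^sup>2)"
        by (intro heat_form_bound t u_sq) auto
      then have "\<bar>lam\<bar> * \<bar>?B\<bar> \<le> \<bar>lam\<bar> * (2 * (LINT x|lborel. (u x)\<^sup>2))"
        by (intro mult_left_mono) auto
      with order_trans[OF abs_ge_self eq_refl[OF abs_mult]] show ?thesis
        by (rule order_trans)
    qed
    ultimately show "(LINT x|lborel. u x * P x) \<le> 2 * (\<Sum>i\<in>Basis. LINT x|lborel. (G x \<bullet> i)\<^sup>2) + \<bar>lam\<bar> * (2 * (LINT x|lborel. (u x)\<^sup>2))"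
      unfolding uP_eq by (simp add: sum_distrib_left)
  qed
  finally show ?thesis .
qed

text \<open>The right-hand side of \<open>energy_bound\<close> does not depend on t, so it survives
  the monotone limit t -> 0. For the cubic right-hand side this gives finiteness of the integrals of
  u^4 and u^2 v^2.\<close>

theorem energy_finite:
  assumes lam: "lam > 0"
  shows "(\<integral>\<^sup>+x. ennreal (h x) * ennreal (u x) \<partial>lborel) < \<infinity>"
proof -
  let ?C = "ennreal (2 * (\<Sum>i\<in>Basis. LINT x|lborel. (G x \<bullet> i)\<^sup>2) + \<bar>lam\<bar> * (2 * (LINT x|lborel. (u x)\<^sup>2)))"
  let ?f = "\<lambda>n x. ennreal (exp (- lam * (1 / real (Suc n)))) * heat_op (1 / real (Suc n)) (\<lambda>y. ennreal (u y)) x"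
  have "(\<lambda>n. \<integral>\<^sup>+x. ennreal (h x) * ?f n x \<partial>lborel) \<longlonglongrightarrow> (\<integral>\<^sup>+x. ennreal (h x) * resolvent lam (\<lambda>y. ennreal (h y)) x \<partial>lborel)"
  proof (rule nn_integral_LIMSEQ)
    show "incseq (\<lambda>n x. ennreal (h x) * ?f n x)"
      unfolding incseq_def le_fun_def
      by (intro allI impI mult_left_mono heat_op_tendsto_resolvent(2)[OF lam, unfolded incseq_def le_fun_def, rule_format]) auto
    show "(\<lambda>n. ennreal (h x) * ?f n x) \<longlonglongrightarrow> ennreal (h x) * resolvent lam (\<lambda>y. ennreal (h y)) x" for x
      by (intro ennreal_tendsto_cmult heat_op_tendsto_resolvent(1) lam) auto
  qed measurable
  moreover have "(\<integral>\<^sup>+x. ennreal (h x) * ?f n x \<partial>lborel) \<le> ?C" for n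
  proof -
    have "(\<integral>\<^sup>+x. ennreal (h x) * ?f n x \<partial>lborel) \<le> (\<integral>\<^sup>+x. ennreal (h x) * (1 * heat_op (1 / real (Suc n)) (\<lambda>y. ennreal (u y)) x) \<partial>lborel)"
      using lam by (intro nn_integral_mono mult_left_mono mult_right_mono) auto
    also have "\<dots> \<le> ?C" using energy_bound[of "1 / real (Suc n)"] by simp
    finally show ?thesis .
  qed
  ultimately have "(\<integral>\<^sup>+x. ennreal (h x) * resolvent lam (\<lambda>y. ennreal (h y)) x \<partial>lborel) \<le> ?C"
    by (intro LIMSEQ_le_const2) auto
  also have "(\<integral>\<^sup>+x. ennreal (h x) * resolvent lam (\<lambda>y. ennreal (h y)) x \<partial>lborel) = (\<integral>\<^sup>+x. ennreal (h x) * ennreal (u x) \<partial>lborel)"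
    by (rule nn_integral_cong_AE) (use representation[OF lam] in auto)
  finally show ?thesis by (rule le_less_trans) simp
qed

end

section \<open>Bounds for the resolvent kernel\<close>

text \<open>Off the origin and for L > 0 this is the Yukawa potential
  \<open>exp (- sqrt L * norm z) / (4 * pi * norm z)\<close>. The estimates below are read off from
  the time integral.\<close>

definition kern :: "real \<Rightarrow> real^3 \<Rightarrow> ennreal" where
  "kern L z = (\<integral>\<^sup>+s. ennreal (exp (- L * s) * heat s z) * indicator {0<..} s \<partial>lborel)"

lemma kern_measurable [measurable]: "kern L \<in> borel_measurable borel"
  unfolding kern_def[abs_def] by measurable

lemma kern_commute: "kern L (x - y) = kern L (y - x)"
  by (simp add: kern_def heat_commute)

lemma resolvent_kern:
  assumes [measurable]: "f \<in> borel_measurable borel"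
  shows "resolvent L f x = (\<integral>\<^sup>+y. kern L (x - y) * f y \<partial>lborel)"
proof -
  have "resolvent L f x = (\<integral>\<^sup>+s. \<integral>\<^sup>+y. (ennreal (exp (- L * s) * heat s (x - y)) * indicator {0<..} s) * f y \<partial>lborel \<partial>lborel)"
    unfolding resolvent_def
  proof (rule nn_integral_cong)
    fix s
    have "ennreal (exp (- L * s)) * heat_op s f x * indicator {0<..} s
      = (ennreal (exp (- L * s)) * indicator {0<..} s) * heat_op s f x" by (simp add: mult_ac)
    also have "\<dots> = (\<integral>\<^sup>+y. (ennreal (exp (- L * s)) * indicator {0<..} s) * (ennreal (heat s (x - y)) * f y) \<partial>lborel)"
      unfolding heat_op_def by (subst nn_integral_cmult) auto
    also have "\<dots> = (\<integral>\<^sup>+y. (ennreal (exp (- L * s) * heat s (x - y)) * indicator {0<..} s) * f y \<partial>lborel)"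
      by (simp add: ennreal_mult mult_ac)
    finally show "ennreal (exp (- L * s)) * heat_op s f x * indicator {0<..} s
      = (\<integral>\<^sup>+y. (ennreal (exp (- L * s) * heat s (x - y)) * indicator {0<..} s) * f y \<partial>lborel)" .
  qed
  also have "\<dots> = (\<integral>\<^sup>+y. \<integral>\<^sup>+s. (ennreal (exp (- L * s) * heat s (x - y)) * indicator {0<..} s) * f y \<partial>lborel \<partial>lborel)"
    by (rule lborel_pair.Fubini') measurable
  also have "\<dots> = (\<integral>\<^sup>+y. kern L (x - y) * f y \<partial>lborel)"
    unfolding kern_def by (intro nn_integral_cong) (subst nn_integral_multc, auto)
  finally show ?thesis .
qed

lemma kern_antimono: "L \<le> L' \<Longrightarrow> kern L' z \<le> kern L z"
  unfolding kern_def
proof (rule nn_integral_mono)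
  fix s assume "L \<le> L'"
  then have "exp (- L' * s) * heat s z \<le> exp (- L * s) * heat s z" if "s > 0"
    using that by (intro mult_right_mono) auto
  then show "ennreal (exp (- L' * s) * heat s z) * indicator {0<..} s \<le> ennreal (exp (- L * s) * heat s z) * indicator {0<..} s"
    by (auto split: split_indicator intro: ennreal_leI)
qed

lemma resolvent_antimono:
  "L \<le> L' \<Longrightarrow> f \<in> borel_measurable borel \<Longrightarrow> resolvent L' f x \<le> resolvent L f x"
  by (simp add: resolvent_kern nn_integral_mono mult_right_mono kern_antimono)

text \<open>Only the times between r^2 and 2 r^2 are kept, with r = norm z. There the heat kernel is
  at least a multiple of r^-3 and, as L r^2 \<le> 1, the factor \<open>exp (- L * s)\<close> is at
  least \<open>exp (- 2)\<close>; the time interval has length r^2.\<close>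

lemma kern_lower:
  obtains c where "c > 0" "\<And>L z. L > 0 \<Longrightarrow> z \<noteq> 0 \<Longrightarrow> norm z \<le> 1 / sqrt L \<Longrightarrow> ennreal (c / norm z) \<le> kern L z"
proof
  let ?c = "exp (- 2) * 2 powr (- 3 / 2) * exp (- 1 / 4) / gauss_mass"
  show "?c > 0" using gauss_mass_pos by simp
  fix L :: real and z :: "real^3"
  assume L: "L > 0" and z: "z \<noteq> 0" "norm z \<le> 1 / sqrt L"
  define r where "r = norm z"
  have r: "r > 0" using z by (simp add: r_def)
  have "r * sqrt L \<le> 1" using z L by (simp add: r_def field_simps)
  then have "(r * sqrt L)\<^sup>2 \<le> 1" using r L by (intro power_le_one) auto
  then have Lr: "L * r\<^sup>2 \<le> 1" using L by (simp add: power_mult_distrib mult.commute)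
  have bd: "?c * r powr (- 3) \<le> exp (- L * s) * heat s z" if s: "r\<^sup>2 \<le> s" "s \<le> 2 * r\<^sup>2" for s
  proof -
    have s0: "s > 0" using s r by (metis less_le_trans zero_less_power)
    have "L * s \<le> L * (2 * r\<^sup>2)" using s L by (intro mult_left_mono) auto
    then have 1: "exp (- 2) \<le> exp (- L * s)" using Lr by simp
    have "2 powr (- 3 / 2) * r powr (- 3) = 2 powr (- 3 / 2) * (r powr 2) powr (- 3 / 2)"
      by (simp add: powr_powr)
    also have "\<dots> = (2 * r\<^sup>2) powr (- 3 / 2)"
      using r by (simp add: powr_mult)
    also have "\<dots> \<le> s powr (- 3 / 2)"
      using s s0 by (intro powr_mono2') auto
    finally have 2: "2 powr (- 3 / 2) * r powr (- 3) \<le> s powr (- 3 / 2)" .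
    have "r\<^sup>2 / (4 * s) \<le> 1 / 4" using s s0 by (simp add: field_simps)
    then have 3: "exp (- 1 / 4) \<le> exp (- ((norm z)\<^sup>2 / (4 * s)))" by (simp add: r_def)
    have "exp (- 2) * ((2 powr (- 3 / 2) * r powr (- 3)) * exp (- 1 / 4) / gauss_mass)
      \<le> exp (- L * s) * (s powr (- 3 / 2) * exp (- ((norm z)\<^sup>2 / (4 * s))) / gauss_mass)"
      using gauss_mass_pos by (intro mult_mono 1 2 3 divide_right_mono) auto
    then show ?thesis by (simp add: heat_def mult_ac)
  qed
  have "ennreal (?c / norm z) = ennreal (?c * r powr (- 3)) * emeasure lborel {r\<^sup>2..2 * r\<^sup>2}"
  proof -
    have "r powr (- 3) * r\<^sup>2 = 1 / r"
      using r by (simp add: powr_neg_numeral power2_eq_square power3_eq_cube)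
    then have "?c / norm z = ?c * r powr (- 3) * (2 * r\<^sup>2 - r\<^sup>2)"
      by (simp add: r_def mult.assoc)
    then show ?thesis
      using gauss_mass_pos by (simp add: ennreal_mult'[symmetric] del: mult_minus_left)
  qed
  also have "\<dots> = (\<integral>\<^sup>+s. ennreal (?c * r powr (- 3)) * indicator {r\<^sup>2..2 * r\<^sup>2} s \<partial>lborel)"
    by (simp add: nn_integral_cmult_indicator)
  also have "\<dots> \<le> kern L z"
    unfolding kern_def
  proof (rule nn_integral_mono)
    fix s
    show "ennreal (?c * r powr (- 3)) * indicator {r\<^sup>2..2 * r\<^sup>2} s \<le> ennreal (exp (- L * s) * heat s z) * indicator {0<..} s"
    proof (cases "s \<in> {r\<^sup>2..2 * r\<^sup>2}")
      case True
      then have "s > 0" using r by (metis atLeastAtMost_iff less_le_trans zero_less_power)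
      with True show ?thesis using bd[of s] by (simp add: ennreal_leI)
    qed simp
  qed
  finally show "ennreal (?c / norm z) \<le> kern L z" .
qed

text \<open>Split at s = r^2. Below, \<open>power_gauss_bound\<close> trades the exponential for a
  multiple of (s / r^2)^n, and \<open>n \<ge> m + 2\<close> makes the resulting power of s
  increasing, so its value at r^2 bounds it. Above, the exponential is at most 1 and the power has
  an integrable tail.\<close>

lemma nn_integral_powr_exp_inverse:
  fixes r :: real and m n :: nat
  assumes r: "r > 0" and n: "n \<ge> m + 2"
  shows "(\<integral>\<^sup>+s. ennreal (s powr (- 3 / 2 - m) * exp (- (r\<^sup>2 / (4 * s)))) * indicator {0<..} s \<partial>lborel)
    \<le> ennreal ((fact n * 4 ^ n + 2) * r powr (- 1 - 2 * m))"
proof -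
  let ?a = "3 / 2 + real m"
  have pw: "(r\<^sup>2) powr b = r powr (2 * b)" for b
    using r by (simp add: powr_powr[symmetric] powr_numeral)
  have small: "s powr (- 3 / 2 - m) * exp (- (r\<^sup>2 / (4 * s))) \<le> fact n * 4 ^ n * r powr (- 3 - 2 * m)"
    if s: "0 < s" "s \<le> r\<^sup>2" for s
  proof -
    have "(r / 2) ^ (2 * n) * exp (- (1 / s * (r / 2)\<^sup>2)) \<le> fact n / (1 / s) ^ n"
      using s by (intro power_gauss_bound) auto
    then have "exp (- (r\<^sup>2 / (4 * s))) \<le> fact n * 4 ^ n * (s ^ n / r ^ (2 * n))"
    proof -
      have "(r / 2) ^ (2 * n) = r ^ (2 * n) / 4 ^ n" by (simp add: power_divide power_mult)
      moreover have "1 / s * (r / 2)\<^sup>2 = r\<^sup>2 / (4 * s)" by (simp add: power_divide)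
      moreover assume "(r / 2) ^ (2 * n) * exp (- (1 / s * (r / 2)\<^sup>2)) \<le> fact n / (1 / s) ^ n"
      ultimately have "r ^ (2 * n) / 4 ^ n * exp (- (r\<^sup>2 / (4 * s))) \<le> fact n * s ^ n"
        by (simp only:) (simp add: power_one_over)
      moreover have "r ^ (2 * n) > 0" using r by simp
      ultimately show ?thesis by (simp add: field_simps)
    qed
    then have "s powr (- 3 / 2 - m) * exp (- (r\<^sup>2 / (4 * s))) \<le> s powr (- 3 / 2 - m) * (fact n * 4 ^ n * (s ^ n / r ^ (2 * n)))"
      by (intro mult_left_mono) auto
    also have "\<dots> = fact n * 4 ^ n * (s powr (real n - ?a) / r ^ (2 * n))"
    proof -
      have "s powr (- 3 / 2 - m) * s ^ n = s powr (real n - ?a)"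
        using s by (simp add: powr_realpow[symmetric] algebra_simps flip: powr_add)
      then show ?thesis by (simp add: mult_ac)
    qed
    also have "\<dots> \<le> fact n * 4 ^ n * ((r\<^sup>2) powr (real n - ?a) / r ^ (2 * n))"
      using s r n by (intro mult_left_mono divide_right_mono powr_mono2) auto
    also have "(r\<^sup>2) powr (real n - ?a) / r ^ (2 * n) = r powr (- 3 - 2 * m)"
    proof -
      have "r ^ (2 * n) = r powr (2 * n)" using r by (simp add: powr_realpow[symmetric])
      then show ?thesis
        using r unfolding pw by (simp add: algebra_simps flip: powr_diff)
    qed
    finally show ?thesis by simp
  qed
  have "(\<integral>\<^sup>+s. ennreal (s powr (- 3 / 2 - m) * exp (- (r\<^sup>2 / (4 * s)))) * indicator {0<..} s \<partial>lborel)
    \<le> (\<integral>\<^sup>+s. ennreal (fact n * 4 ^ n * r powr (- 3 - 2 * m)) * indicator {0..r\<^sup>2} s + ennreal (s powr - ?a) * indicator {r\<^sup>2..} s \<partial>lborel)"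
  proof (rule nn_integral_mono)
    fix s
    consider "s \<le> 0" | "0 < s" "s \<le> r\<^sup>2" | "s > r\<^sup>2" by linarith
    then show "ennreal (s powr (- 3 / 2 - m) * exp (- (r\<^sup>2 / (4 * s)))) * indicator {0<..} s
      \<le> ennreal (fact n * 4 ^ n * r powr (- 3 - 2 * m)) * indicator {0..r\<^sup>2} s + ennreal (s powr - ?a) * indicator {r\<^sup>2..} s"
    proof cases
      case 2
      then show ?thesis using ennreal_leI[OF small[OF 2]] by (simp add: add_increasing2)
    next
      case 3
      then have s: "s > 0" using zero_le_power2[of r] by linarith
      have "s powr (- 3 / 2 - m) * exp (- (r\<^sup>2 / (4 * s))) \<le> s powr (- 3 / 2 - m) * 1"
        using s by (intro mult_left_mono) auto
      also have "\<dots> = s powr - ?a" by simp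
      finally show ?thesis using 3 s by (simp add: ennreal_leI)
    qed simp
  qed
  also have "\<dots> = ennreal (fact n * 4 ^ n * r powr (- 3 - 2 * m)) * emeasure lborel {0..r\<^sup>2} + ennreal ((r\<^sup>2) powr (1 - ?a) / (?a - 1))"
    using r by (subst nn_integral_add) (auto simp: nn_integral_cmult_indicator nn_integral_powr_tail simp del: minus_add_distrib)
  also have "\<dots> = ennreal (fact n * 4 ^ n * r powr (- 3 - 2 * m) * r\<^sup>2 + (r\<^sup>2) powr (1 - ?a) / (?a - 1))"
    using r by (simp add: ennreal_mult'[symmetric] ennreal_plus[symmetric] del: ennreal_plus)
  also have "\<dots> \<le> ennreal ((fact n * 4 ^ n + 2) * r powr (- 1 - 2 * m))"
  proof (rule ennreal_leI)
    have 1: "r powr (- 3 - 2 * m) * r\<^sup>2 = r powr (- 1 - 2 * m)"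
    proof -
      have "r\<^sup>2 = r powr 2" using r by simp
      then show ?thesis by (simp only: powr_add[symmetric]) simp
    qed
    have 2: "(r\<^sup>2) powr (1 - ?a) = r powr (- 1 - 2 * m)"
      unfolding pw by simp
    have 3: "r powr (- 1 - 2 * m) / (?a - 1) \<le> r powr (- 1 - 2 * m) / (1 / 2)"
      by (intro divide_left_mono) auto
    show "fact n * 4 ^ n * r powr (- 3 - 2 * m) * r\<^sup>2 + (r\<^sup>2) powr (1 - ?a) / (?a - 1) \<le> (fact n * 4 ^ n + 2) * r powr (- 1 - 2 * m)"
      unfolding 2 mult.assoc[of _ _ "r\<^sup>2"] 1 distrib_right using 3 by simp
  qed
  finally show ?thesis .
qed

lemma kern_upper:
  obtains C where "C > 0" "\<And>L z. L > 0 \<Longrightarrow> z \<noteq> 0 \<Longrightarrow> kern L z \<le> ennreal (C / norm z)"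
proof
  let ?C = "(fact 2 * 4 ^ 2 + 2) / gauss_mass"
  show "?C > 0" using gauss_mass_pos by simp
  fix L :: real and z :: "real^3"
  assume L: "L > 0" and z: "z \<noteq> 0"
  have "kern L z \<le> (\<integral>\<^sup>+s. ennreal (1 / gauss_mass) * (ennreal (s powr (- 3 / 2 - real 0) * exp (- ((norm z)\<^sup>2 / (4 * s)))) * indicator {0<..} s) \<partial>lborel)"
    unfolding kern_def
  proof (rule nn_integral_mono)
    fix s
    have "exp (- L * s) * heat s z \<le> 1 * heat s z" if "s > 0"
      using L that by (intro mult_right_mono) auto
    then show "ennreal (exp (- L * s) * heat s z) * indicator {0<..} s
      \<le> ennreal (1 / gauss_mass) * (ennreal (s powr (- 3 / 2 - real 0) * exp (- ((norm z)\<^sup>2 / (4 * s)))) * indicator {0<..} s)"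
      using gauss_mass_pos by (auto split: split_indicator simp: heat_def ennreal_leI simp flip: ennreal_mult')
  qed
  also have "\<dots> \<le> ennreal (1 / gauss_mass) * ennreal ((fact 2 * 4 ^ 2 + 2) * norm z powr (- 1 - 2 * real 0))"
    using z nn_integral_powr_exp_inverse[of "norm z" 0 2] by (subst nn_integral_cmult) (auto intro!: mult_left_mono)
  also have "\<dots> = ennreal (?C / norm z)"
    using z gauss_mass_pos by (simp add: ennreal_mult'[symmetric] powr_minus_divide)
  finally show "kern L z \<le> ennreal (?C / norm z)" .
qed

text \<open>The bound exp(- L s) \<le> 2 / (L s)^2 brings in two negative powers of s, which become
  four more powers of decay in \<open>norm z\<close> than in \<open>kern_upper\<close>. The power -5
  is integrable at infinity in dimension three.\<close>

lemma kern_decay: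
  obtains C where "C > 0" "\<And>L z. L > 0 \<Longrightarrow> z \<noteq> 0 \<Longrightarrow> kern L z \<le> ennreal (C / L\<^sup>2 * norm z powr (- 5))"
proof
  let ?C = "2 * (fact 4 * 4 ^ 4 + 2) / gauss_mass"
  show "?C > 0" using gauss_mass_pos by (intro divide_pos_pos mult_pos_pos add_nonneg_pos) auto
  fix L :: real and z :: "real^3"
  assume L: "L > 0" and z: "z \<noteq> 0"
  have "kern L z \<le> (\<integral>\<^sup>+s. ennreal (2 / L\<^sup>2 / gauss_mass) * (ennreal (s powr (- 3 / 2 - real 2) * exp (- ((norm z)\<^sup>2 / (4 * s)))) * indicator {0<..} s) \<partial>lborel)"
    unfolding kern_def
  proof (rule nn_integral_mono)
    fix s
    have "exp (- L * s) * heat s z \<le> (2 / L\<^sup>2 / gauss_mass) * (s powr (- 3 / 2 - real 2) * exp (- ((norm z)\<^sup>2 / (4 * s))))" if s: "s > 0"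
    proof -
      have "sqrt (L * s) ^ (2 * 2) * exp (- (1 * (sqrt (L * s))\<^sup>2)) \<le> fact 2 / 1 ^ 2"
        by (rule power_gauss_bound) simp
      then have "(L * s)\<^sup>2 * exp (- L * s) \<le> 2"
        using L s unfolding power_mult by (simp add: fact_2)
      then have "exp (- L * s) \<le> 2 / L\<^sup>2 * (1 / s\<^sup>2)"
        using L s by (simp add: field_simps power_mult_distrib)
      also have "1 / s\<^sup>2 = s powr (- 2)" using s by (simp add: powr_neg_numeral)
      finally have "exp (- L * s) * heat s z \<le> (2 / L\<^sup>2 * s powr (- 2)) * heat s z"
        by (intro mult_right_mono) auto
      also have "\<dots> = (2 / L\<^sup>2 / gauss_mass) * ((s powr (- 2) * s powr (- 3 / 2)) * exp (- ((norm z)\<^sup>2 / (4 * s))))"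
        by (simp add: heat_def)
      also have "s powr (- 2) * s powr (- 3 / 2) = s powr (- 3 / 2 - real 2)"
        by (simp flip: powr_add)
      finally show ?thesis .
    qed
    then show "ennreal (exp (- L * s) * heat s z) * indicator {0<..} s
      \<le> ennreal (2 / L\<^sup>2 / gauss_mass) * (ennreal (s powr (- 3 / 2 - real 2) * exp (- ((norm z)\<^sup>2 / (4 * s)))) * indicator {0<..} s)"
      using gauss_mass_pos by (auto split: split_indicator simp: ennreal_leI simp flip: ennreal_mult')
  qed
  also have "\<dots> \<le> ennreal (2 / L\<^sup>2 / gauss_mass) * ennreal ((fact 4 * 4 ^ 4 + 2) * norm z powr (- 1 - 2 * real 2))"
    using z nn_integral_powr_exp_inverse[of "norm z" 2 4] by (subst nn_integral_cmult) (auto intro!: mult_left_mono)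
  also have "\<dots> = ennreal (?C / L\<^sup>2 * norm z powr (- 5))"
    using z gauss_mass_pos by (simp add: ennreal_mult'[symmetric]) (simp add: field_simps)
  finally show "kern L z \<le> ennreal (?C / L\<^sup>2 * norm z powr (- 5))" .
qed

lemma nn_integral_kern_set:
  assumes [measurable]: "A \<in> sets borel"
  shows "(\<integral>\<^sup>+z. kern L z * indicator A z \<partial>lborel)
    = (\<integral>\<^sup>+s. ennreal (exp (- L * s)) * indicator {0<..} s * (\<integral>\<^sup>+z. ennreal (heat s z) * indicator A z \<partial>lborel) \<partial>lborel)"
proof -
  have "(\<integral>\<^sup>+z. kern L z * indicator A z \<partial>lborel)
    = (\<integral>\<^sup>+z. \<integral>\<^sup>+s. (ennreal (exp (- L * s)) * indicator {0<..} s) * (ennreal (heat s z) * indicator A z) \<partial>lborel \<partial>lborel)"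
    unfolding kern_def
    by (intro nn_integral_cong, subst nn_integral_multc[symmetric]) (auto simp: ennreal_mult mult_ac)
  also have "\<dots> = (\<integral>\<^sup>+s. \<integral>\<^sup>+z. (ennreal (exp (- L * s)) * indicator {0<..} s) * (ennreal (heat s z) * indicator A z) \<partial>lborel \<partial>lborel)"
    by (rule lborel_pair.Fubini') measurable
  finally show ?thesis by (simp add: nn_integral_cmult)
qed

lemma kern_mass:
  assumes L: "L > 0"
  shows "(\<integral>\<^sup>+z. kern L z \<partial>lborel) \<le> ennreal (1 / L)"
proof -
  have "(\<integral>\<^sup>+z. kern L z * indicator UNIV z \<partial>lborel)
    = (\<integral>\<^sup>+s. ennreal (exp (- L * s)) * indicator {0<..} s * (\<integral>\<^sup>+z. ennreal (heat s z) * indicator UNIV z \<partial>lborel) \<partial>lborel)"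
    by (rule nn_integral_kern_set) simp
  also have "\<dots> \<le> (\<integral>\<^sup>+s. ennreal (exp (- L * s)) * indicator {0..} s \<partial>lborel)"
    by (intro nn_integral_mono) (auto split: split_indicator simp: nn_integral_heat)
  also have "\<dots> = ennreal (0 - (- (exp (- L * 0)) / L))"
  proof (rule nn_integral_FTC_atLeast)
    show "((\<lambda>s. - (exp (- L * s)) / L) has_real_derivative exp (- L * s)) (at s)" for s
      using L by (auto intro!: derivative_eq_intros)
    have "filterlim (\<lambda>s. - L * s) at_bot at_top"
      using L by (intro filterlim_tendsto_neg_mult_at_bot[OF tendsto_const] filterlim_ident) auto
    then have "((\<lambda>s. - (exp (- L * s)) / L) \<longlongrightarrow> - 0 / L) at_top"
      using L by (intro tendsto_intros filterlim_compose[OF exp_at_bot]) auto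
    then show "((\<lambda>s. - (exp (- L * s)) / L) \<longlongrightarrow> 0) at_top" by simp
  qed auto
  finally show ?thesis by simp
qed

text \<open>Times up to \<rho>^2 contribute with density at most 1, since the heat kernel has mass
  1; later times with at most a multiple of the volume of the ball times s^(-3/2). Both parts
  integrate to a multiple of \<rho>^2.\<close>

lemma kern_ball:
  obtains C where "C > 0" "\<And>L \<rho>. L > 0 \<Longrightarrow> \<rho> > 0 \<Longrightarrow> (\<integral>\<^sup>+z. kern L z * indicator (ball 0 \<rho>) z \<partial>lborel) \<le> ennreal (C * \<rho>\<^sup>2)"
proof
  let ?C = "1 + (4 / 3 * pi) / gauss_mass * 2"
  show "?C > 0" using gauss_mass_pos by (intro add_pos_nonneg) auto
  fix L \<rho> :: real assume L: "L > 0" and \<rho>: "\<rho> > 0"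
  have [measurable]: "ball (0::real^3) \<rho> \<in> sets borel" by auto
  have "(\<integral>\<^sup>+z. kern L z * indicator (ball 0 \<rho>) z \<partial>lborel)
    \<le> (\<integral>\<^sup>+s. indicator {0..\<rho>\<^sup>2} s + ennreal ((4 / 3 * pi * \<rho> ^ 3) / gauss_mass) * (ennreal (s powr - (3 / 2)) * indicator {\<rho>\<^sup>2..} s) \<partial>lborel)"
    unfolding nn_integral_kern_set[OF \<open>ball (0::real^3) \<rho> \<in> sets borel\<close>]
  proof (rule nn_integral_mono)
    fix s
    show "ennreal (exp (- L * s)) * indicator {0<..} s * (\<integral>\<^sup>+z. ennreal (heat s z) * indicator (ball 0 \<rho>) z \<partial>lborel)
      \<le> indicator {0..\<rho>\<^sup>2} s + ennreal ((4 / 3 * pi * \<rho> ^ 3) / gauss_mass) * (ennreal (s powr - (3 / 2)) * indicator {\<rho>\<^sup>2..} s)"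
    proof (cases "s > 0")
      case True
      let ?I = "\<integral>\<^sup>+z. ennreal (heat s z) * indicator (ball 0 \<rho>) z \<partial>lborel"
      have "ennreal (exp (- L * s)) * indicator {0<..} s * ?I \<le> 1 * 1 * ?I"
        using L True by (intro mult_mono) auto
      also have "1 * 1 * ?I \<le> indicator {0..\<rho>\<^sup>2} s + ennreal ((4 / 3 * pi * \<rho> ^ 3) / gauss_mass) * (ennreal (s powr - (3 / 2)) * indicator {\<rho>\<^sup>2..} s)"
      proof (cases "s \<le> \<rho>\<^sup>2")
        case s: True
        have "?I \<le> (\<integral>\<^sup>+z. ennreal (heat s z) \<partial>lborel)"
          by (intro nn_integral_mono) (auto split: split_indicator)
        with s True show ?thesis by (simp add: nn_integral_heat add_increasing2)
      next
        case False
        have "?I \<le> (\<integral>\<^sup>+z. ennreal (s powr (- 3 / 2) / gauss_mass) * indicator (ball (0::real^3) \<rho>) z \<partial>lborel)"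
          using heat_le[of s s] True by (intro nn_integral_mono mult_right_mono ennreal_leI) auto
        also have "\<dots> = ennreal (s powr (- 3 / 2) / gauss_mass) * ennreal (4 / 3 * pi * \<rho> ^ 3)"
          using \<rho> by (simp add: nn_integral_cmult_indicator emeasure_ball_R3)
        also have "\<dots> = ennreal ((4 / 3 * pi * \<rho> ^ 3) / gauss_mass) * ennreal (s powr - (3 / 2))"
          using \<rho> gauss_mass_pos by (simp add: ennreal_mult'[symmetric] mult_ac)
        finally show ?thesis using False by simp
      qed
      finally show ?thesis .
    qed simp
  qed
  also have "\<dots> = ennreal (\<rho>\<^sup>2) + ennreal ((4 / 3 * pi * \<rho> ^ 3) / gauss_mass) * ennreal ((\<rho>\<^sup>2) powr (1 - 3 / 2) / (3 / 2 - 1))"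
    using \<rho> nn_integral_powr_tail[of "3 / 2" "\<rho>\<^sup>2"] by (subst nn_integral_add) (auto simp: nn_integral_cmult)
  also have "(\<rho>\<^sup>2) powr (1 - 3 / 2) / (3 / 2 - 1) = 2 / \<rho>"
  proof -
    have "(\<rho> powr 2) powr (- 1 / 2) = \<rho> powr (- 1)" by (simp only: powr_powr) simp
    then have "(\<rho>\<^sup>2) powr (- 1 / 2) = 1 / \<rho>" using \<rho> by (simp add: powr_minus_divide)
    then show ?thesis by simp
  qed
  also have "ennreal (\<rho>\<^sup>2) + ennreal ((4 / 3 * pi * \<rho> ^ 3) / gauss_mass) * ennreal (2 / \<rho>) = ennreal (\<rho>\<^sup>2 + (4 / 3 * pi * \<rho> ^ 3) / gauss_mass * (2 / \<rho>))"
    using \<rho> gauss_mass_pos by (simp add: ennreal_mult'[symmetric] ennreal_plus[symmetric] del: ennreal_plus)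
  also have "\<rho>\<^sup>2 + (4 / 3 * pi * \<rho> ^ 3) / gauss_mass * (2 / \<rho>) = ?C * \<rho>\<^sup>2"
    using \<rho> gauss_mass_pos by (simp add: field_simps power2_eq_square power3_eq_cube)
  finally show "(\<integral>\<^sup>+z. kern L z * indicator (ball 0 \<rho>) z \<partial>lborel) \<le> ennreal (?C * \<rho>\<^sup>2)" .
qed

section \<open>Form bounds from supersolutions\<close>

text \<open>The parameter c stands in for a product of square roots, so that infinite values are
  covered and the inequality can be integrated term by term.\<close>

lemma ennreal_weighted_am_gm:
  fixes a b :: ennreal and c :: real
  assumes c: "c > 0"
  shows "2 * (a * b) \<le> ennreal c * (a * a) + ennreal (1 / c) * (b * b)"
proof (cases "a = \<infinity> \<or> b = \<infinity>")
  case True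
  then have "ennreal c * (a * a) + ennreal (1 / c) * (b * b) = \<infinity>"
    using c by (auto simp: ennreal_mult_eq_top_iff ennreal_add_eq_top)
  then show ?thesis by (simp only: infinity_ennreal_def top_greatest)
next
  case False
  then obtain x y where xy: "a = ennreal x" "b = ennreal y" "x \<ge> 0" "y \<ge> 0"
    by (metis ennreal_cases infinity_ennreal_def)
  have "0 \<le> (c * x - y)\<^sup>2 / c" using c by simp
  then have "2 * (x * y) \<le> c * (x * x) + 1 / c * (y * y)"
    using c by (simp add: power2_eq_square field_simps)
  then have "ennreal (2 * (x * y)) \<le> ennreal (c * (x * x) + 1 / c * (y * y))"
    by (rule ennreal_leI)
  moreover have "ennreal (c * (x * x) + 1 / c * (y * y)) = ennreal c * (ennreal x * ennreal x) + ennreal (1 / c) * (ennreal y * ennreal y)"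
    using c xy by (simp only: ennreal_mult'[symmetric] ennreal_plus[symmetric] mult_nonneg_nonneg less_imp_le divide_nonneg_nonneg zero_le_one)
  moreover have "ennreal (2 * (x * y)) = 2 * (ennreal x * ennreal y)"
    using xy by (simp add: ennreal_mult')
  ultimately show ?thesis unfolding xy(1,2) by simp
qed

text \<open>By the parallelogram law the product of two Gaussians at time \<open>t/2\<close> centred at \<open>x\<close> and \<open>y\<close> is
  \<open>heat t (x - y)\<close> times a Gaussian centred at the midpoint; the value of the constant is irrelevant.\<close>

lemma heat_split:
  assumes t: "t > 0"
  obtains \<kappa> where "\<And>x y. ennreal (heat t (x - y)) = ennreal \<kappa> * (\<integral>\<^sup>+z. ennreal (heat (t / 2) (x - z)) * ennreal (heat (t / 2) (z - y)) \<partial>lborel)"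
proof -
  define J where "J = (\<integral>\<^sup>+(z::real^3). ennreal (exp (- ((norm z)\<^sup>2 / t))) \<partial>lborel)"
  have Jeq: "J = ennreal (LINT z|(lborel :: (real^3) measure). exp (- ((norm z)\<^sup>2 / t)))"
    unfolding J_def using integrable_gauss[OF t] by (intro nn_integral_eq_integral) auto
  have "J \<noteq> 0"
  proof
    assume "J = 0"
    then have "AE z in (lborel :: (real^3) measure). ennreal (exp (- ((norm z)\<^sup>2 / t))) = 0"
      unfolding J_def by (subst (asm) nn_integral_0_iff_AE) auto
    then have "AE z in (lborel :: (real^3) measure). False" by simp
    then show False by (simp add: AE_iff_null null_sets_def)
  qed
  then obtain j where j: "J = ennreal j" "j > 0"
    using Jeq by (metis ennreal_neg not_le)
  define c where "c = t powr (- 3 / 2) / gauss_mass"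
  define d where "d = ((t / 2) powr (- 3 / 2) / gauss_mass)\<^sup>2"
  have cd: "c > 0" "d > 0" using t gauss_mass_pos by (auto simp: c_def d_def)
  show ?thesis
  proof (rule that[of "c / (d * j)"])
    fix x y :: "real^3"
    define m where "m = (1 / 2) *\<^sub>R (x + y)"
    have id: "(norm (x - z))\<^sup>2 / (4 * (t / 2)) + (norm (z - y))\<^sup>2 / (4 * (t / 2)) = (norm (z - m))\<^sup>2 / t + (norm (x - y))\<^sup>2 / (4 * t)" for z
    proof -
      have "2 * ((norm (x - z))\<^sup>2 + (norm (z - y))\<^sup>2) = 4 * (norm (z - m))\<^sup>2 + (norm (x - y))\<^sup>2"
        unfolding power2_norm_eq_inner m_def
        by (simp add: inner_diff_left inner_diff_right inner_add_left inner_add_right inner_commute algebra_simps)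
      moreover have "a / (4 * (t / 2)) + b / (4 * (t / 2)) = c / t + d / (4 * t)" if "2 * (a + b) = 4 * c + d" for a b c d
      proof -
        have "a / (4 * (t / 2)) + b / (4 * (t / 2)) = (2 * (a + b)) / (4 * t)"
          using t by (simp add: field_simps)
        also have "\<dots> = c / t + d / (4 * t)"
          unfolding that using t by (simp add: add_divide_distrib)
        finally show ?thesis .
      qed
      ultimately show ?thesis by blast
    qed
    have pw: "heat (t / 2) (x - z) * heat (t / 2) (z - y) = (d * exp (- ((norm (x - y))\<^sup>2 / (4 * t)))) * exp (- ((norm (z - m))\<^sup>2 / t))" for z
    proof -
      have "heat (t / 2) (x - z) * heat (t / 2) (z - y)
        = d * exp (- ((norm (x - z))\<^sup>2 / (4 * (t / 2)) + (norm (z - y))\<^sup>2 / (4 * (t / 2))))"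
        by (simp add: heat_def d_def power2_eq_square exp_add[symmetric] exp_minus[symmetric] mult_exp_exp)
      also have "\<dots> = (d * exp (- ((norm (x - y))\<^sup>2 / (4 * t)))) * exp (- ((norm (z - m))\<^sup>2 / t))"
        unfolding id by (simp add: mult_exp_exp)
      finally show ?thesis .
    qed
    have "(\<integral>\<^sup>+z. ennreal (heat (t / 2) (x - z)) * ennreal (heat (t / 2) (z - y)) \<partial>lborel)
      = (\<integral>\<^sup>+z. ennreal (d * exp (- ((norm (x - y))\<^sup>2 / (4 * t)))) * ennreal (exp (- ((norm (z - m))\<^sup>2 / t))) \<partial>lborel)"
      using cd by (simp add: pw flip: ennreal_mult')
    also have "\<dots> = ennreal (d * exp (- ((norm (x - y))\<^sup>2 / (4 * t)))) * (\<integral>\<^sup>+z. ennreal (exp (- ((norm (z - m))\<^sup>2 / t))) \<partial>lborel)"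
      by (rule nn_integral_cmult) measurable
    also have "(\<integral>\<^sup>+z. ennreal (exp (- ((norm (z - m))\<^sup>2 / t))) \<partial>lborel) = ennreal j"
      unfolding j(1)[symmetric] J_def by (rule nn_integral_lborel_shift) measurable
    finally have "ennreal (c / (d * j)) * (\<integral>\<^sup>+z. ennreal (heat (t / 2) (x - z)) * ennreal (heat (t / 2) (z - y)) \<partial>lborel)
      = ennreal (c / (d * j) * (d * exp (- ((norm (x - y))\<^sup>2 / (4 * t))) * j))"
      using cd j by (simp flip: ennreal_mult')
    also have "c / (d * j) * (d * exp (- ((norm (x - y))\<^sup>2 / (4 * t))) * j) = heat t (x - y)"
      using cd j by (simp add: c_def heat_def)
    finally show "ennreal (heat t (x - y)) = ennreal (c / (d * j)) * (\<integral>\<^sup>+z. ennreal (heat (t / 2) (x - z)) * ennreal (heat (t / 2) (z - y)) \<partial>lborel)" ..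
  qed
qed

text \<open>Through \<open>heat_split\<close> the form becomes \<kappa> times the integral of the
  product of the heat averages at time t/2, to which the weighted inequality applies pointwise. The
  same \<kappa> stands on both sides.\<close>

lemma heat_form_cauchy_schwarz:
  assumes [measurable]: "f \<in> borel_measurable borel" "g \<in> borel_measurable borel" and t: "t > 0" and c: "c > 0"
  shows "2 * (\<integral>\<^sup>+x. f x * heat_op t g x \<partial>lborel)
    \<le> ennreal c * (\<integral>\<^sup>+x. f x * heat_op t f x \<partial>lborel) + ennreal (1 / c) * (\<integral>\<^sup>+x. g x * heat_op t g x \<partial>lborel)"
proof -
  obtain \<kappa> where \<kappa>: "\<And>x y. ennreal (heat t (x - y)) = ennreal \<kappa> * (\<integral>\<^sup>+z. ennreal (heat (t / 2) (x - z)) * ennreal (heat (t / 2) (z - y)) \<partial>lborel)"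
    using heat_split[OF t] by blast
  have form: "(\<integral>\<^sup>+x. f x * heat_op t g x \<partial>lborel) = ennreal \<kappa> * (\<integral>\<^sup>+z. heat_op (t / 2) f z * heat_op (t / 2) g z \<partial>lborel)"
    if [measurable]: "f \<in> borel_measurable borel" "g \<in> borel_measurable borel" for f g
  proof -
    have "(\<integral>\<^sup>+x. f x * heat_op t g x \<partial>lborel)
      = (\<integral>\<^sup>+x. \<integral>\<^sup>+y. \<integral>\<^sup>+z. ennreal \<kappa> * ((ennreal (heat (t / 2) (x - z)) * f x) * (ennreal (heat (t / 2) (z - y)) * g y)) \<partial>lborel \<partial>lborel \<partial>lborel)"
      unfolding heat_op_def \<kappa>
      by (simp add: nn_integral_cmult[symmetric] nn_integral_multc[symmetric] mult_ac)
    also have "\<dots> = (\<integral>\<^sup>+x. \<integral>\<^sup>+z. \<integral>\<^sup>+y. ennreal \<kappa> * ((ennreal (heat (t / 2) (x - z)) * f x) * (ennreal (heat (t / 2) (z - y)) * g y)) \<partial>lborel \<partial>lborel \<partial>lborel)"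
      by (intro nn_integral_cong lborel_pair.Fubini') measurable
    also have "\<dots> = (\<integral>\<^sup>+z. \<integral>\<^sup>+x. \<integral>\<^sup>+y. ennreal \<kappa> * ((ennreal (heat (t / 2) (x - z)) * f x) * (ennreal (heat (t / 2) (z - y)) * g y)) \<partial>lborel \<partial>lborel \<partial>lborel)"
      by (rule lborel_pair.Fubini') measurable
    also have "\<dots> = (\<integral>\<^sup>+z. \<integral>\<^sup>+x. ennreal \<kappa> * ((ennreal (heat (t / 2) (x - z)) * f x) * heat_op (t / 2) g z) \<partial>lborel \<partial>lborel)"
      unfolding heat_op_def by (simp add: nn_integral_cmult)
    also have "\<dots> = (\<integral>\<^sup>+z. ennreal \<kappa> * (heat_op (t / 2) f z * heat_op (t / 2) g z) \<partial>lborel)"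
    proof (rule nn_integral_cong)
      fix z
      have "(\<integral>\<^sup>+x. ennreal \<kappa> * ((ennreal (heat (t / 2) (x - z)) * f x) * heat_op (t / 2) g z) \<partial>lborel)
        = ennreal \<kappa> * ((\<integral>\<^sup>+x. ennreal (heat (t / 2) (x - z)) * f x \<partial>lborel) * heat_op (t / 2) g z)"
        by (subst nn_integral_cmult, measurable) (subst nn_integral_multc, auto)
      then show "(\<integral>\<^sup>+x. ennreal \<kappa> * ((ennreal (heat (t / 2) (x - z)) * f x) * heat_op (t / 2) g z) \<partial>lborel)
        = ennreal \<kappa> * (heat_op (t / 2) f z * heat_op (t / 2) g z)"
        unfolding heat_op_def[of _ f] by (simp add: heat_commute)
    qed
    also have "\<dots> = ennreal \<kappa> * (\<integral>\<^sup>+z. heat_op (t / 2) f z * heat_op (t / 2) g z \<partial>lborel)"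
      by (rule nn_integral_cmult) measurable
    finally show ?thesis .
  qed
  have "2 * (\<integral>\<^sup>+z. heat_op (t / 2) f z * heat_op (t / 2) g z \<partial>lborel)
    = (\<integral>\<^sup>+z. 2 * (heat_op (t / 2) f z * heat_op (t / 2) g z) \<partial>lborel)"
    by (rule nn_integral_cmult[symmetric]) measurable
  also have "\<dots> \<le> (\<integral>\<^sup>+z. ennreal c * (heat_op (t / 2) f z * heat_op (t / 2) f z) + ennreal (1 / c) * (heat_op (t / 2) g z * heat_op (t / 2) g z) \<partial>lborel)"
    by (intro nn_integral_mono ennreal_weighted_am_gm c)
  also have "\<dots> = ennreal c * (\<integral>\<^sup>+z. heat_op (t / 2) f z * heat_op (t / 2) f z \<partial>lborel) + ennreal (1 / c) * (\<integral>\<^sup>+z. heat_op (t / 2) g z * heat_op (t / 2) g z \<partial>lborel)"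
    by (subst nn_integral_add) (auto simp: nn_integral_cmult)
  finally have "ennreal \<kappa> * (2 * (\<integral>\<^sup>+z. heat_op (t / 2) f z * heat_op (t / 2) g z \<partial>lborel))
    \<le> ennreal \<kappa> * (ennreal c * (\<integral>\<^sup>+z. heat_op (t / 2) f z * heat_op (t / 2) f z \<partial>lborel) + ennreal (1 / c) * (\<integral>\<^sup>+z. heat_op (t / 2) g z * heat_op (t / 2) g z \<partial>lborel))"
    by (rule mult_left_mono) simp
  then show ?thesis
    by (simp add: form distrib_left mult.left_commute)
qed

lemma resolvent_form:
  assumes [measurable]: "f \<in> borel_measurable borel" "g \<in> borel_measurable borel"
  shows "(\<integral>\<^sup>+x. f x * resolvent L g x \<partial>lborel)
    = (\<integral>\<^sup>+s. ennreal (exp (- L * s)) * indicator {0<..} s * (\<integral>\<^sup>+x. f x * heat_op s g x \<partial>lborel) \<partial>lborel)"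
proof -
  have "(\<integral>\<^sup>+x. f x * resolvent L g x \<partial>lborel)
    = (\<integral>\<^sup>+x. \<integral>\<^sup>+s. (ennreal (exp (- L * s)) * indicator {0<..} s) * (f x * heat_op s g x) \<partial>lborel \<partial>lborel)"
    unfolding resolvent_def by (intro nn_integral_cong, subst nn_integral_cmult[symmetric]) (auto simp: mult_ac)
  also have "\<dots> = (\<integral>\<^sup>+s. \<integral>\<^sup>+x. (ennreal (exp (- L * s)) * indicator {0<..} s) * (f x * heat_op s g x) \<partial>lborel \<partial>lborel)"
    by (rule lborel_pair.Fubini') measurable
  finally show ?thesis by (simp add: nn_integral_cmult)
qed

lemma resolvent_cauchy_schwarz:
  assumes [measurable]: "f \<in> borel_measurable borel" "g \<in> borel_measurable borel" and c: "c > 0"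
  shows "2 * (\<integral>\<^sup>+x. f x * resolvent L g x \<partial>lborel)
    \<le> ennreal c * (\<integral>\<^sup>+x. f x * resolvent L f x \<partial>lborel) + ennreal (1 / c) * (\<integral>\<^sup>+x. g x * resolvent L g x \<partial>lborel)"
proof -
  let ?w = "\<lambda>s. ennreal (exp (- L * s)) * indicator {0<..} s"
  let ?Q = "\<lambda>f g s. \<integral>\<^sup>+x. f x * heat_op s g x \<partial>lborel"
  have "2 * (\<integral>\<^sup>+x. f x * resolvent L g x \<partial>lborel) = (\<integral>\<^sup>+s. ?w s * (2 * ?Q f g s) \<partial>lborel)"
    by (simp add: resolvent_form nn_integral_cmult[symmetric] mult_ac)
  also have "\<dots> \<le> (\<integral>\<^sup>+s. ?w s * (ennreal c * ?Q f f s + ennreal (1 / c) * ?Q g g s) \<partial>lborel)"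
  proof (rule nn_integral_mono)
    fix s
    show "?w s * (2 * ?Q f g s) \<le> ?w s * (ennreal c * ?Q f f s + ennreal (1 / c) * ?Q g g s)"
      using heat_form_cauchy_schwarz[OF assms(1,2) _ c, of s]
      by (cases "s > 0") (auto intro: mult_left_mono)
  qed
  also have "\<dots> = ennreal c * (\<integral>\<^sup>+s. ?w s * ?Q f f s \<partial>lborel) + ennreal (1 / c) * (\<integral>\<^sup>+s. ?w s * ?Q g g s \<partial>lborel)"
    by (simp add: distrib_left nn_integral_add nn_integral_cmult[symmetric] mult_ac)
  finally show ?thesis by (simp add: resolvent_form)
qed

text \<open>Schur test with weight g: u(x) u(y) is at most half of u(x)^2 g(y) / g(x) plus the same
  with x and y exchanged. The kernel is symmetric, so both halves agree after integration, and in
  each the integral over the free variable is the resolvent of V g, bounded by \<delta> g.\<close>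

lemma resolvent_schur:
  fixes V u g :: "real^3 \<Rightarrow> real"
  assumes [measurable]: "V \<in> borel_measurable borel" "u \<in> borel_measurable borel" "g \<in> borel_measurable borel"
    and nn: "\<And>x. V x \<ge> 0" "\<And>x. u x \<ge> 0" "\<And>x. g x > 0" and \<delta>: "\<delta> \<ge> 0"
    and super: "AE x in lborel. resolvent L (\<lambda>y. ennreal (V y * g y)) x \<le> ennreal (\<delta> * g x)"
  shows "(\<integral>\<^sup>+x. ennreal (V x * u x) * resolvent L (\<lambda>y. ennreal (V y * u y)) x \<partial>lborel)
    \<le> ennreal \<delta> * (\<integral>\<^sup>+x. ennreal (V x * (u x)\<^sup>2) \<partial>lborel)"
proof -
  let ?a = "\<lambda>x y. ennreal (1 / 2 * V x * (u x)\<^sup>2 / g x) * (kern L (x - y) * ennreal (V y * g y))"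
  have "(\<integral>\<^sup>+x. ennreal (V x * u x) * resolvent L (\<lambda>y. ennreal (V y * u y)) x \<partial>lborel)
    = (\<integral>\<^sup>+x. \<integral>\<^sup>+y. kern L (x - y) * ennreal ((V x * u x) * (V y * u y)) \<partial>lborel \<partial>lborel)"
    using nn by (simp add: resolvent_kern nn_integral_cmult[symmetric] ennreal_mult mult_ac)
  also have "\<dots> \<le> (\<integral>\<^sup>+x. \<integral>\<^sup>+y. ?a x y + ?a y x \<partial>lborel \<partial>lborel)"
  proof (intro nn_integral_mono)
    fix x y
    have gx: "g x > 0" "g y > 0" using nn by auto
    have "(u x * g y) * (u y * g x) \<le> 1 / 2 * (u x * g y)\<^sup>2 + 1 / 2 * (u y * g x)\<^sup>2"
      using sum_squares_bound[of "u x * g y" "u y * g x"] by simp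
    then have "u x * u y \<le> 1 / 2 * (u x)\<^sup>2 / g x * g y + 1 / 2 * (u y)\<^sup>2 / g y * g x"
      using gx by (simp add: field_simps power2_eq_square)
    then have "(V x * V y) * (u x * u y) \<le> (V x * V y) * (1 / 2 * (u x)\<^sup>2 / g x * g y + 1 / 2 * (u y)\<^sup>2 / g y * g x)"
      using nn by (intro mult_left_mono) auto
    then have "ennreal ((V x * u x) * (V y * u y)) \<le> ennreal ((1 / 2 * V x * (u x)\<^sup>2 / g x) * (V y * g y) + (1 / 2 * V y * (u y)\<^sup>2 / g y) * (V x * g x))"
      by (intro ennreal_leI) (simp add: algebra_simps)
    also have "\<dots> = ennreal (1 / 2 * V x * (u x)\<^sup>2 / g x) * ennreal (V y * g y) + ennreal (1 / 2 * V y * (u y)\<^sup>2 / g y) * ennreal (V x * g x)"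
      using nn gx by (simp add: less_imp_le ennreal_mult'[symmetric] ennreal_plus[symmetric] del: ennreal_plus)
    finally have "kern L (x - y) * ennreal ((V x * u x) * (V y * u y)) \<le> kern L (x - y) * (ennreal (1 / 2 * V x * (u x)\<^sup>2 / g x) * ennreal (V y * g y) + ennreal (1 / 2 * V y * (u y)\<^sup>2 / g y) * ennreal (V x * g x))"
      by (rule mult_left_mono) simp
    then show "kern L (x - y) * ennreal ((V x * u x) * (V y * u y)) \<le> ?a x y + ?a y x"
      unfolding kern_commute[of L y x] by (simp only: distrib_left mult_ac)
  qed
  also have "\<dots> = (\<integral>\<^sup>+x. \<integral>\<^sup>+y. ?a x y \<partial>lborel \<partial>lborel) + (\<integral>\<^sup>+x. \<integral>\<^sup>+y. ?a y x \<partial>lborel \<partial>lborel)"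
    by (subst nn_integral_add[symmetric], measurable) (intro nn_integral_cong nn_integral_add, measurable)
  also have "(\<integral>\<^sup>+x. \<integral>\<^sup>+y. ?a y x \<partial>lborel \<partial>lborel) = (\<integral>\<^sup>+y. \<integral>\<^sup>+x. ?a y x \<partial>lborel \<partial>lborel)"
    by (rule lborel_pair.Fubini') measurable
  also have "(\<integral>\<^sup>+x. \<integral>\<^sup>+y. ?a x y \<partial>lborel \<partial>lborel) + (\<integral>\<^sup>+x. \<integral>\<^sup>+y. ?a x y \<partial>lborel \<partial>lborel) \<le>
    ennreal \<delta> * (\<integral>\<^sup>+x. ennreal (1 / 2 * V x * (u x)\<^sup>2) \<partial>lborel) + ennreal \<delta> * (\<integral>\<^sup>+x. ennreal (1 / 2 * V x * (u x)\<^sup>2) \<partial>lborel)"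
  proof -
    have "(\<integral>\<^sup>+x. \<integral>\<^sup>+y. ?a x y \<partial>lborel \<partial>lborel) = (\<integral>\<^sup>+x. ennreal (1 / 2 * V x * (u x)\<^sup>2 / g x) * resolvent L (\<lambda>y. ennreal (V y * g y)) x \<partial>lborel)"
      by (simp add: resolvent_kern nn_integral_cmult)
    also have "\<dots> \<le> (\<integral>\<^sup>+x. ennreal \<delta> * ennreal (1 / 2 * V x * (u x)\<^sup>2) \<partial>lborel)"
    proof (rule nn_integral_mono_AE, use super in eventually_elim)
      fix x assume x: "resolvent L (\<lambda>y. ennreal (V y * g y)) x \<le> ennreal (\<delta> * g x)"
      have "ennreal (1 / 2 * V x * (u x)\<^sup>2 / g x) * resolvent L (\<lambda>y. ennreal (V y * g y)) x
        \<le> ennreal (1 / 2 * V x * (u x)\<^sup>2 / g x) * ennreal (\<delta> * g x)"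
        by (rule mult_left_mono[OF x]) simp
      also have "\<dots> = ennreal ((1 / 2 * V x * (u x)\<^sup>2 / g x) * (\<delta> * g x))"
        using nn[of x] \<delta> by (simp only: ennreal_mult'[symmetric] divide_nonneg_nonneg mult_nonneg_nonneg zero_le_power2 less_imp_le)
      also have "(1 / 2 * V x * (u x)\<^sup>2 / g x) * (\<delta> * g x) = \<delta> * (1 / 2 * V x * (u x)\<^sup>2)"
        using nn(3)[of x] by simp
      finally show "ennreal (1 / 2 * V x * (u x)\<^sup>2 / g x) * resolvent L (\<lambda>y. ennreal (V y * g y)) x
        \<le> ennreal \<delta> * ennreal (1 / 2 * V x * (u x)\<^sup>2)"
        using \<delta> by (simp only: ennreal_mult')
    qed
    also have "\<dots> = ennreal \<delta> * (\<integral>\<^sup>+x. ennreal (1 / 2 * V x * (u x)\<^sup>2) \<partial>lborel)"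
      by (rule nn_integral_cmult) measurable
    finally show ?thesis by (intro add_mono)
  qed
  also have "\<dots> = ennreal \<delta> * (\<integral>\<^sup>+x. ennreal (1 / 2 * V x * (u x)\<^sup>2) + ennreal (1 / 2 * V x * (u x)\<^sup>2) \<partial>lborel)"
    by (subst nn_integral_add) (auto simp: distrib_left)
  also have "\<dots> = ennreal \<delta> * (\<integral>\<^sup>+x. ennreal (V x * (u x)\<^sup>2) \<partial>lborel)"
    using nn by (simp add: ennreal_plus[symmetric] del: ennreal_plus)
  finally show ?thesis .
qed

text \<open>Write X for the left-hand integral. As u is the resolvent of h, X is the resolvent form
  of V u with h. Cauchy-Schwarz bounds 2 X by 1/\<delta> times the form of V u with itself plus
  \<delta> times the integral of h u, and the Schur test bounds the first term by X. This is the
  dual form of the nonnegativity of - Delta + L - V / \<delta>, with g as positive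
  supersolution.\<close>

theorem potential_form_bound:
  fixes V u g h :: "real^3 \<Rightarrow> real"
  assumes [measurable]: "V \<in> borel_measurable borel" "u \<in> borel_measurable borel" "g \<in> borel_measurable borel" "h \<in> borel_measurable borel"
    and nn: "\<And>x. V x \<ge> 0" "\<And>x. u x \<ge> 0" "\<And>x. g x > 0" "\<And>x. h x \<ge> 0" and \<delta>: "\<delta> > 0"
    and super: "AE x in lborel. resolvent L (\<lambda>y. ennreal (V y * g y)) x \<le> ennreal (\<delta> * g x)"
    and rep: "AE x in lborel. ennreal (u x) = resolvent L (\<lambda>y. ennreal (h y)) x"
    and u_sq: "(\<integral>\<^sup>+x. ennreal ((u x)\<^sup>2) \<partial>lborel) < \<infinity>"
  shows "(\<integral>\<^sup>+x. ennreal (V x * (u x)\<^sup>2) \<partial>lborel) \<le> ennreal \<delta> * (\<integral>\<^sup>+x. ennreal (h x * u x) \<partial>lborel)"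
proof -
  \<comment> \<open>Truncating V makes X finite, so that it can be cancelled; the bound does not
    depend on n.\<close>
  define W where "W n x = min (V x) (real n)" for n x
  have [measurable]: "W n \<in> borel_measurable borel" for n unfolding W_def by measurable
  have W: "0 \<le> W n x" "W n x \<le> V x" "W n x \<le> real n" for n x using nn by (auto simp: W_def)
  let ?X = "\<lambda>n. \<integral>\<^sup>+x. ennreal (W n x * (u x)\<^sup>2) \<partial>lborel"
  let ?H = "\<integral>\<^sup>+x. ennreal (h x * u x) \<partial>lborel"
  have le: "?X n \<le> ennreal \<delta> * ?H" for n
  proof -
    have fin: "?X n < \<infinity>"
    proof -
      have "?X n \<le> (\<integral>\<^sup>+x. ennreal (real n) * ennreal ((u x)\<^sup>2) \<partial>lborel)"
        using W by (intro nn_integral_mono) (auto simp: ennreal_mult'[symmetric] intro!: ennreal_leI mult_right_mono)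
      also have "\<dots> = ennreal (real n) * (\<integral>\<^sup>+x. ennreal ((u x)\<^sup>2) \<partial>lborel)"
        by (rule nn_integral_cmult) measurable
      also have "\<dots> < \<infinity>" using u_sq by (simp add: ennreal_mult_less_top)
      finally show ?thesis .
    qed
    have sup: "AE x in lborel. resolvent L (\<lambda>y. ennreal (W n y * g y)) x \<le> ennreal (\<delta> * g x)"
      using super
    proof eventually_elim
      case (elim x)
      have "resolvent L (\<lambda>y. ennreal (W n y * g y)) x \<le> resolvent L (\<lambda>y. ennreal (V y * g y)) x"
        using W nn(3) by (simp add: resolvent_kern, intro nn_integral_mono mult_left_mono ennreal_leI mult_right_mono) (auto simp: less_imp_le)
      with elim show ?case by simp
    qed
    have "?X n = (\<integral>\<^sup>+x. ennreal (W n x * u x) * resolvent L (\<lambda>y. ennreal (h y)) x \<partial>lborel)"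
    proof (rule nn_integral_cong_AE, use rep in eventually_elim)
      case (elim x)
      then show ?case using nn(2) W by (simp only: elim[symmetric]) (simp add: ennreal_mult[symmetric] power2_eq_square mult_ac)
    qed
    moreover have "2 * (\<integral>\<^sup>+x. ennreal (W n x * u x) * resolvent L (\<lambda>y. ennreal (h y)) x \<partial>lborel) \<le> ennreal (1 / \<delta>) * (\<integral>\<^sup>+x. ennreal (W n x * u x) * resolvent L (\<lambda>y. ennreal (W n y * u y)) x \<partial>lborel)
        + ennreal (1 / (1 / \<delta>)) * (\<integral>\<^sup>+x. ennreal (h x) * resolvent L (\<lambda>y. ennreal (h y)) x \<partial>lborel)"
      using \<delta> by (intro resolvent_cauchy_schwarz) auto
    ultimately have "2 * ?X n \<le> ennreal (1 / \<delta>) * (\<integral>\<^sup>+x. ennreal (W n x * u x) * resolvent L (\<lambda>y. ennreal (W n y * u y)) x \<partial>lborel)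
        + ennreal (1 / (1 / \<delta>)) * (\<integral>\<^sup>+x. ennreal (h x) * resolvent L (\<lambda>y. ennreal (h y)) x \<partial>lborel)"
      by (simp only:)
    also have "(\<integral>\<^sup>+x. ennreal (h x) * resolvent L (\<lambda>y. ennreal (h y)) x \<partial>lborel) = ?H"
    proof (rule nn_integral_cong_AE, use rep in eventually_elim)
      case (elim x)
      then show ?case using nn by (simp only: elim[symmetric]) (simp add: ennreal_mult)
    qed
    also have "ennreal (1 / \<delta>) * (\<integral>\<^sup>+x. ennreal (W n x * u x) * resolvent L (\<lambda>y. ennreal (W n y * u y)) x \<partial>lborel)
      \<le> ennreal (1 / \<delta>) * (ennreal \<delta> * ?X n)"
      using W nn \<delta> by (intro mult_left_mono resolvent_schur[where g = g] sup) auto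
    also have "\<dots> = ?X n"
      using \<delta> by (simp add: mult.assoc[symmetric] ennreal_mult'[symmetric])
    finally have "?X n + ?X n \<le> ?X n + ennreal \<delta> * ?H"
      by (simp only: mult_2 div_by_1 divide_divide_eq_right mult_1_left add_right_mono)
    then show ?thesis using fin by (simp only: ennreal_add_left_cancel_le infinity_ennreal_def less_irrefl) auto
  qed
  have "(\<lambda>n. ?X n) \<longlonglongrightarrow> (\<integral>\<^sup>+x. ennreal (V x * (u x)\<^sup>2) \<partial>lborel)"
  proof (rule nn_integral_LIMSEQ)
    show "incseq (\<lambda>n x. ennreal (W n x * (u x)\<^sup>2))"
      unfolding incseq_def le_fun_def
      by (intro allI impI ennreal_leI mult_right_mono) (auto simp: W_def)
    show "(\<lambda>n. ennreal (W n x * (u x)\<^sup>2)) \<longlonglongrightarrow> ennreal (V x * (u x)\<^sup>2)" for x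
    proof (rule tendsto_eventually)
      obtain N where "V x \<le> real N" using real_arch_simple by blast
      then show "\<forall>\<^sub>F n in sequentially. ennreal (W n x * (u x)\<^sup>2) = ennreal (V x * (u x)\<^sup>2)"
        by (intro eventually_sequentiallyI[of N]) (auto simp: W_def min_def)
    qed
  qed measurable
  then show ?thesis by (rule LIMSEQ_le_const2) (use le in auto)
qed

section \<open>Decay of the local cubic mass\<close>

lemma ennreal_cube_bound:
  fixes a b :: real
  assumes "0 \<le> a" "a \<le> b"
  shows "ennreal (a ^ 3) \<le> ennreal (b ^ 3)"
  using assms by (intro ennreal_leI power_mono) auto

text \<open>A mass m in the ball of radius r forces w to be at least \<mu> c m / (r + s) within
  distance s of the centre, because all distances involved stay in the range where the kernel is at
  least c / norm z. Cubing and integrating over a region of volume proportional to r^3 cancels the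
  radius: this scale invariance is the criticality of the cube.\<close>

lemma cube_growth:
  assumes "c > 0" "\<mu> > 0" and kl: "\<And>L z. L > 0 \<Longrightarrow> z \<noteq> 0 \<Longrightarrow> norm z \<le> 1 / sqrt L \<Longrightarrow> ennreal (c / norm z) \<le> kern L z"
    and L: "L > 0" and [measurable]: "w \<in> borel_measurable borel" and w: "\<And>x. w x > 0"
    and rep: "AE x in lborel. resolvent L (\<lambda>y. ennreal (\<mu> * w y ^ 3)) x \<le> ennreal (w x)"
    and fin: "\<And>r. (\<integral>\<^sup>+y. ennreal (w y ^ 3) * indicator (ball x r) y \<partial>lborel) < \<infinity>"
  defines "m \<equiv> \<lambda>r. enn2real (\<integral>\<^sup>+y. ennreal (w y ^ 3) * indicator (ball x r) y \<partial>lborel)"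
  shows "0 < r \<Longrightarrow> 2 * r \<le> 1 / sqrt L \<Longrightarrow> (\<mu> * c) ^ 3 / 2 * m r ^ 3 \<le> m r"
    and "0 < r \<Longrightarrow> 3 * r \<le> 1 / sqrt L \<Longrightarrow> m r + (\<mu> * c) ^ 3 / 2 * m r ^ 3 \<le> m (2 * r)"
proof -
  have M: "(\<integral>\<^sup>+y. ennreal (w y ^ 3) * indicator (ball x r) y \<partial>lborel) = ennreal (m r)" for r
    using fin[of r] by (simp add: m_def)
  have m0: "m r \<ge> 0" for r by (simp add: m_def)
  have [measurable]: "ball x r \<in> sets borel" for r by auto
  have lower: "AE y in lborel. norm (y - x) \<le> s \<longrightarrow> \<mu> * c / (r + s) * m r \<le> w y"
    if r: "0 < r" "0 < s" "r + s \<le> 1 / sqrt L" for r s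
    using rep
  proof eventually_elim
    case (elim y)
    show ?case
    proof
      assume y: "norm (y - x) \<le> s"
      have "ennreal (\<mu> * c / (r + s) * m r) = ennreal (\<mu> * c / (r + s)) * (\<integral>\<^sup>+z. ennreal (w z ^ 3) * indicator (ball x r) z \<partial>lborel)"
        unfolding M using m0 assms(1,2) r by (intro ennreal_mult) auto
      also have "\<dots> = (\<integral>\<^sup>+z. ennreal (\<mu> * c / (r + s)) * (ennreal (w z ^ 3) * indicator (ball x r) z) \<partial>lborel)"
        by (rule nn_integral_cmult[symmetric]) measurable
      also have "\<dots> \<le> (\<integral>\<^sup>+z. kern L (y - z) * ennreal (\<mu> * w z ^ 3) \<partial>lborel)"
      \<comment> \<open>The lower bound for the kernel holds off the origin, so the single point z =
        y is excluded.\<close>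
      proof (rule nn_integral_mono_AE, use AE_lborel_singleton[of y] in eventually_elim)
        case (elim z)
        show "ennreal (\<mu> * c / (r + s)) * (ennreal (w z ^ 3) * indicator (ball x r) z) \<le> kern L (y - z) * ennreal (\<mu> * w z ^ 3)"
        proof (cases "z \<in> ball x r")
          case True
          have n: "norm (y - z) \<le> r + s"
            using norm_triangle_ineq[of "y - x" "x - z"] y True by (simp add: dist_norm)
          have ne: "y - z \<noteq> 0" using elim by simp
          have "ennreal (c / (r + s)) \<le> ennreal (c / norm (y - z))"
            using n ne assms(1) r by (intro ennreal_leI divide_left_mono) auto
          also have "\<dots> \<le> kern L (y - z)"
            using n ne r by (intro kl L) auto
          finally have "ennreal (c / (r + s)) * ennreal (\<mu> * w z ^ 3) \<le> kern L (y - z) * ennreal (\<mu> * w z ^ 3)"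
            by (rule mult_right_mono) simp
          moreover have "ennreal (c / (r + s)) * ennreal (\<mu> * w z ^ 3) = ennreal (\<mu> * c / (r + s)) * ennreal (w z ^ 3)"
            using assms(1,2) r w[of z] by (simp add: ennreal_mult[symmetric] less_imp_le mult_ac)
          ultimately show ?thesis using True by simp
        qed simp
      qed
      also have "\<dots> = resolvent L (\<lambda>y. ennreal (\<mu> * w y ^ 3)) y"
        by (simp add: resolvent_kern)
      also note elim
      finally show "\<mu> * c / (r + s) * m r \<le> w y"
        using w[of y] by (simp add: ennreal_le_iff less_imp_le)
    qed
  qed
  have set_lower: "ennreal ((\<mu> * c / (r + s) * m r) ^ 3) * emeasure lborel S \<le> (\<integral>\<^sup>+y. ennreal (w y ^ 3) * indicator S y \<partial>lborel)"
    if r: "0 < r" "0 < s" "r + s \<le> 1 / sqrt L" and S: "S \<subseteq> ball x s" "S \<in> sets borel" for r s S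
  proof -
    have "ennreal ((\<mu> * c / (r + s) * m r) ^ 3) * emeasure lborel S = (\<integral>\<^sup>+y. ennreal ((\<mu> * c / (r + s) * m r) ^ 3) * indicator S y \<partial>lborel)"
      using S by (simp add: nn_integral_cmult_indicator)
    also have "\<dots> \<le> (\<integral>\<^sup>+y. ennreal (w y ^ 3) * indicator S y \<partial>lborel)"
    proof (rule nn_integral_mono_AE, use lower[OF r] in eventually_elim)
      case (elim y)
      show ?case
      proof (cases "y \<in> S")
        case True
        then have "norm (y - x) \<le> s" using S by (auto simp: dist_norm norm_minus_commute)
        with elim have "\<mu> * c / (r + s) * m r \<le> w y" by simp
        moreover have "0 \<le> \<mu> * c / (r + s) * m r" using m0[of r] assms(1,2) r by simp
        ultimately show ?thesis using True ennreal_cube_bound by simp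
      qed simp
    qed
    finally show ?thesis .
  qed
  have pi3: "pi > 3" by (rule pi_gt3)
  show "(\<mu> * c) ^ 3 / 2 * m r ^ 3 \<le> m r" if r: "0 < r" "2 * r \<le> 1 / sqrt L" for r
  proof -
    have "ennreal ((\<mu> * c / (r + r) * m r) ^ 3) * emeasure lborel (ball x r) \<le> (\<integral>\<^sup>+y. ennreal (w y ^ 3) * indicator (ball x r) y \<partial>lborel)"
      using r by (intro set_lower) auto
    then have "ennreal ((\<mu> * c / (r + r) * m r) ^ 3 * (4 / 3 * pi * r ^ 3)) \<le> ennreal (m r)"
    proof -
      have "ennreal ((\<mu> * c / (r + r) * m r) ^ 3 * (4 / 3 * pi * r ^ 3)) = ennreal ((\<mu> * c / (r + r) * m r) ^ 3) * ennreal (4 / 3 * pi * r ^ 3)"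
        using r m0[of r] assms(1,2) by (intro ennreal_mult) auto
      moreover assume "ennreal ((\<mu> * c / (r + r) * m r) ^ 3) * emeasure lborel (ball x r) \<le> (\<integral>\<^sup>+y. ennreal (w y ^ 3) * indicator (ball x r) y \<partial>lborel)"
      ultimately show ?thesis using r by (simp only: M emeasure_ball_R3 less_imp_le)
    qed
    then have "(\<mu> * c / (r + r) * m r) ^ 3 * (4 / 3 * pi * r ^ 3) \<le> m r"
      using m0 by (simp only: ennreal_le_iff)
    also have "(\<mu> * c / (r + r) * m r) ^ 3 * (4 / 3 * pi * r ^ 3) = ((\<mu> * c) ^ 3 * m r ^ 3) * (pi / 6)"
      using r by (simp add: field_simps power3_eq_cube)
    finally have "((\<mu> * c) ^ 3 * m r ^ 3) * (pi / 6) \<le> m r" .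
    \<comment> \<open>The constants pi / 6 here and 28 pi / 81 below are both lowered to 1/2, so
      that the two claims share one coefficient.\<close>
    moreover have "((\<mu> * c) ^ 3 * m r ^ 3) * (1 / 2) \<le> ((\<mu> * c) ^ 3 * m r ^ 3) * (pi / 6)"
      using pi3 m0[of r] assms(1,2) by (intro mult_left_mono) auto
    ultimately have "((\<mu> * c) ^ 3 * m r ^ 3) * (1 / 2) \<le> m r" by (rule order_trans[rotated])
    then show ?thesis by (simp add: mult.commute)
  qed
  show "m r + (\<mu> * c) ^ 3 / 2 * m r ^ 3 \<le> m (2 * r)" if r: "0 < r" "3 * r \<le> 1 / sqrt L" for r
  proof -
    let ?S = "ball x (2 * r) - ball x r"
    have sub: "ball x r \<subseteq> ball x (2 * r)" using r by (intro subset_ball) auto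
    have em: "emeasure lborel ?S = ennreal (28 / 3 * pi * r ^ 3)"
    proof -
      have "emeasure lborel ?S = ennreal (4 / 3 * pi * (2 * r) ^ 3) - ennreal (4 / 3 * pi * r ^ 3)"
        using r sub by (subst emeasure_Diff) (auto simp: emeasure_ball_R3)
      also have "\<dots> = ennreal (4 / 3 * pi * (2 * r) ^ 3 - 4 / 3 * pi * r ^ 3)"
        using r by (intro ennreal_minus) auto
      finally show ?thesis by (simp add: power_mult_distrib mult.assoc)
    qed
    have "ennreal ((\<mu> * c / (r + 2 * r) * m r) ^ 3) * emeasure lborel ?S \<le> (\<integral>\<^sup>+y. ennreal (w y ^ 3) * indicator ?S y \<partial>lborel)"
      using r by (intro set_lower) auto
    then have "ennreal (m r) + ennreal ((\<mu> * c / (r + 2 * r) * m r) ^ 3) * ennreal (28 / 3 * pi * r ^ 3)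
      \<le> (\<integral>\<^sup>+y. ennreal (w y ^ 3) * indicator (ball x r) y \<partial>lborel) + (\<integral>\<^sup>+y. ennreal (w y ^ 3) * indicator ?S y \<partial>lborel)"
      unfolding M em by (intro add_left_mono)
    also have "\<dots> = (\<integral>\<^sup>+y. ennreal (w y ^ 3) * indicator (ball x r) y + ennreal (w y ^ 3) * indicator ?S y \<partial>lborel)"
      by (rule nn_integral_add[symmetric]) measurable
    also have "\<dots> = ennreal (m (2 * r))"
      unfolding M[symmetric] using sub by (intro nn_integral_cong) (auto split: split_indicator)
    also have "ennreal (m r) + ennreal ((\<mu> * c / (r + 2 * r) * m r) ^ 3) * ennreal (28 / 3 * pi * r ^ 3)
      = ennreal (m r + (\<mu> * c / (r + 2 * r) * m r) ^ 3 * (28 / 3 * pi * r ^ 3))"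
      using r m0[of r] assms(1,2) by (simp add: ennreal_mult'[symmetric] ennreal_plus[symmetric] del: ennreal_plus)
    finally have le: "m r + (\<mu> * c / (r + 2 * r) * m r) ^ 3 * (28 / 3 * pi * r ^ 3) \<le> m (2 * r)"
      using m0 by (simp only: ennreal_le_iff)
    have eq: "(\<mu> * c / (r + 2 * r) * m r) ^ 3 * (28 / 3 * pi * r ^ 3) = ((\<mu> * c) ^ 3 * m r ^ 3) * (28 * pi / 81)"
      using r by (simp add: field_simps power3_eq_cube)
    have "m r + ((\<mu> * c) ^ 3 * m r ^ 3) * (1 / 2) \<le> m r + ((\<mu> * c) ^ 3 * m r ^ 3) * (28 * pi / 81)"
      using pi3 m0[of r] assms(1,2) by (intro add_left_mono mult_left_mono) auto
    also note le[unfolded eq]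
    finally show ?thesis by (simp add: mult.commute)
  qed
qed

text \<open>The cubic nonlinearity is critical in dimension three: doubling the radius adds at least a fixed multiple
  of the cube of the mass, and the mass is bounded at the scale \<open>1 / sqrt L\<close>, so it becomes small after
  finitely many halvings.\<close>

theorem cube_mass_small:
  assumes \<mu>: "\<mu> > 0" and \<epsilon>: "\<epsilon> > 0"
  obtains d where "d > 0" "d \<le> 1"
    "\<And>L w x. L > 0 \<Longrightarrow> w \<in> borel_measurable borel \<Longrightarrow> (\<And>x. w x > 0) \<Longrightarrow>
      (AE x in lborel. resolvent L (\<lambda>y. ennreal (\<mu> * w y ^ 3)) x \<le> ennreal (w x)) \<Longrightarrow>
      (\<And>r. (\<integral>\<^sup>+y. ennreal (w y ^ 3) * indicator (ball x r) y \<partial>lborel) < \<infinity>) \<Longrightarrow>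
      (\<integral>\<^sup>+y. ennreal (w y ^ 3) * indicator (ball x (d / sqrt L)) y \<partial>lborel) \<le> ennreal \<epsilon>"
proof -
  obtain c where c: "c > 0" and kl: "\<And>L z. L > 0 \<Longrightarrow> z \<noteq> 0 \<Longrightarrow> norm z \<le> 1 / sqrt L \<Longrightarrow> ennreal (c / norm z) \<le> kern L z"
    using kern_lower by blast
  define b where "b = (\<mu> * c) ^ 3 / 2"
  have b: "b > 0" using \<mu> c by (simp add: b_def)
  \<comment> \<open>n gains of b \<epsilon>^3 each would lift the mass above 1 / sqrt b, the largest
    value compatible with b m^3 \<le> m.\<close>
  obtain n where n: "1 / sqrt b < real n * (b * \<epsilon> ^ 3)"
    using reals_Archimedean3[of "b * \<epsilon> ^ 3"] b \<epsilon> by auto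
  \<comment> \<open>n doublings lead from d / sqrt L to 1 / (4 sqrt L), which respects the radius
    restrictions of \<open>cube_growth\<close> at every step.\<close>
  define d where "d = 1 / (4 * 2 ^ n :: real)"
  have "(1::real) \<le> 4 * 2 ^ n" using one_le_power[of "2 :: real" n] by linarith
  then have d: "d > 0" "d \<le> 1" by (auto simp: d_def)
  show ?thesis
  proof (rule that[OF d])
    fix L :: real and w :: "real^3 \<Rightarrow> real" and x
    assume L: "L > 0" and w: "w \<in> borel_measurable borel" "\<And>x. w x > 0"
      and rep: "AE x in lborel. resolvent L (\<lambda>y. ennreal (\<mu> * w y ^ 3)) x \<le> ennreal (w x)"
      and fin: "\<And>r. (\<integral>\<^sup>+y. ennreal (w y ^ 3) * indicator (ball x r) y \<partial>lborel) < \<infinity>"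
    define m where "m r = enn2real (\<integral>\<^sup>+y. ennreal (w y ^ 3) * indicator (ball x r) y \<partial>lborel)" for r
    have M: "(\<integral>\<^sup>+y. ennreal (w y ^ 3) * indicator (ball x r) y \<partial>lborel) = ennreal (m r)" for r
      using fin[of r] by (simp add: m_def)
    have m0: "m r \<ge> 0" for r by (simp add: m_def)
    note g = cube_growth[OF c \<mu> kl L w rep fin, folded m_def b_def]
    have s: "sqrt L > 0" using L by simp
    have "m (d / sqrt L) \<le> \<epsilon>"
    proof (rule ccontr)
      assume "\<not> m (d / sqrt L) \<le> \<epsilon>"
      then have start: "\<epsilon> < m (d / sqrt L)" by simp
      have "\<epsilon> + real k * (b * \<epsilon> ^ 3) \<le> m (2 ^ k * (d / sqrt L))" if "k \<le> n" for k
        using that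
      proof (induction k)
        case 0
        then show ?case using start by simp
      next
        case (Suc k)
        then have IH: "\<epsilon> + real k * (b * \<epsilon> ^ 3) \<le> m (2 ^ k * (d / sqrt L))" by simp
        then have "\<epsilon> \<le> m (2 ^ k * (d / sqrt L))"
          using b \<epsilon> by (smt (verit) mult_nonneg_nonneg of_nat_0_le_iff zero_le_power)
        then have "b * \<epsilon> ^ 3 \<le> b * m (2 ^ k * (d / sqrt L)) ^ 3"
          using b \<epsilon> by (intro mult_left_mono power_mono) auto
        moreover have "m (2 ^ k * (d / sqrt L)) + b * m (2 ^ k * (d / sqrt L)) ^ 3 \<le> m (2 * (2 ^ k * (d / sqrt L)))"
        proof (rule g(2))
          show "0 < 2 ^ k * (d / sqrt L)" using d s by simp
          have "(2::real) ^ k \<le> 2 ^ n" using Suc by (intro power_increasing) auto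
          then have "3 * (2::real) ^ k \<le> 4 * 2 ^ n" by (intro mult_mono) auto
          then have "3 * 2 ^ k * d \<le> 1" by (simp add: d_def)
          then show "3 * (2 ^ k * (d / sqrt L)) \<le> 1 / sqrt L"
            using s by (simp add: divide_right_mono mult.assoc[symmetric])
        qed
        ultimately show ?case using IH by (simp add: algebra_simps)
      qed
      from this[of n] have big: "\<epsilon> + real n * (b * \<epsilon> ^ 3) \<le> m (2 ^ n * (d / sqrt L))" by simp
      define R where "R = 2 ^ n * (d / sqrt L)"
      have R: "R = 1 / (4 * sqrt L)" by (simp add: R_def d_def)
      have mb: "1 / sqrt b < m R" using big n \<epsilon> by (simp add: R_def)
      have "b * m R ^ 3 \<le> m R"
        using s by (intro g(1)) (auto simp: R field_simps)
      moreover have "m R > 0" using mb b by (smt (verit) divide_pos_pos real_sqrt_gt_zero)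
      ultimately have "b * (m R)\<^sup>2 \<le> 1" by (simp add: power3_eq_cube power2_eq_square mult.assoc[symmetric])
      moreover have "(1 / sqrt b)\<^sup>2 < (m R)\<^sup>2"
        using mb b by (intro power_strict_mono) auto
      then have "1 < b * (m R)\<^sup>2" using b by (simp add: power_divide field_simps)
      ultimately show False by simp
    qed
    then show "(\<integral>\<^sup>+y. ennreal (w y ^ 3) * indicator (ball x (d / sqrt L)) y \<partial>lborel) \<le> ennreal \<epsilon>"
      unfolding M by (rule ennreal_leI)
  qed
qed

text \<open>Instead of covering space by balls, the kernel at z is bounded by an average of the
  decaying majorant over the ball of radius r/2 about z, with r = 1 / sqrt L. After exchanging the
  integrals the inner one is a local mass of F.\<close>

lemma kern_far_bound:
  obtains C where "C > 0"
    "\<And>L F \<epsilon> x. L > 0 \<Longrightarrow> F \<in> borel_measurable borel \<Longrightarrow>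
      (\<And>x. (\<integral>\<^sup>+y. F y * indicator (ball x (1 / sqrt L)) y \<partial>lborel) \<le> ennreal \<epsilon>) \<Longrightarrow>
      (\<integral>\<^sup>+y. kern L (x - y) * F y * indicator {1 / sqrt L..} (norm (x - y)) \<partial>lborel) \<le> ennreal (C * sqrt L) * ennreal \<epsilon>"
proof -
  obtain D where D: "D > 0" and kd: "\<And>L z. L > 0 \<Longrightarrow> z \<noteq> 0 \<Longrightarrow> kern L z \<le> ennreal (D / L\<^sup>2 * norm z powr (- 5))"
    using kern_decay by blast
  define J where "J = (5 :: real) * (4 / 3 * pi) / (5 - 3)"
  \<comment> \<open>\<open>v * r ^ 3\<close> is the volume of a ball of radius r/2, and the factor
    \<open>(3 / 2) powr 5\<close> in \<open>E\<close> accounts for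
    \<open>norm p \<le> 3 / 2 * norm z\<close> on the ball about z.\<close>
  define v where "v = pi / 6"
  define E where "E = (3 / 2) powr 5 * D"
  have pos: "J > 0" "v > 0" "E > 0" using D by (auto simp: J_def v_def E_def)
  show ?thesis
  proof (rule that[of "E * J * 4 / v"])
    show "E * J * 4 / v > 0" using pos by simp
    fix L :: real and F :: "real^3 \<Rightarrow> ennreal" and \<epsilon> x
    assume L: "L > 0" and [measurable]: "F \<in> borel_measurable borel"
      and small: "\<And>x. (\<integral>\<^sup>+y. F y * indicator (ball x (1 / sqrt L)) y \<partial>lborel) \<le> ennreal \<epsilon>"
    define r where "r = 1 / sqrt L"
    have r: "r > 0" using L by (simp add: r_def)
    have [measurable]: "ball (z::real^3) s \<in> sets borel" for z s by auto
    let ?k = "\<lambda>z :: real^3. ennreal (E / L\<^sup>2) * (ennreal (norm z powr - 5) * indicator {r / 2..} (norm z))"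
    have avg: "ennreal (v * r ^ 3) * (kern L z * indicator {r..} (norm z)) \<le> (\<integral>\<^sup>+p. ?k p * indicator (ball z (r / 2)) p \<partial>lborel)" for z
    proof (cases "r \<le> norm z")
      case True
      have z: "z \<noteq> 0" using True r by auto
      have "ennreal (v * r ^ 3) * (kern L z * indicator {r..} (norm z)) \<le> ennreal (v * r ^ 3) * ennreal (D / L\<^sup>2 * norm z powr (- 5))"
        using True kd[OF L z] by (intro mult_left_mono) auto
      also have "\<dots> = (\<integral>\<^sup>+p. ennreal (D / L\<^sup>2 * norm z powr (- 5)) * indicator (ball z (r / 2)) p \<partial>lborel)"
      proof -
        have "4 / 3 * pi * (r / 2) ^ 3 = v * r ^ 3" by (simp add: v_def power_divide)
        then have "emeasure lborel (ball z (r / 2)) = ennreal (v * r ^ 3)"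
          using r by (subst emeasure_ball_R3) auto
        then show ?thesis
          by (subst nn_integral_cmult_indicator) (auto simp: mult.commute)
      qed
      also have "\<dots> \<le> (\<integral>\<^sup>+p. ?k p * indicator (ball z (r / 2)) p \<partial>lborel)"
      proof (rule nn_integral_mono)
        fix p
        show "ennreal (D / L\<^sup>2 * norm z powr (- 5)) * indicator (ball z (r / 2)) p \<le> ?k p * indicator (ball z (r / 2)) p"
        proof (cases "p \<in> ball z (r / 2)")
          case p: True
          have "norm p \<le> norm z + norm (z - p)" "norm z \<le> norm p + norm (z - p)"
            using norm_triangle_ineq4[of z "z - p"] norm_triangle_ineq[of p "z - p"] by auto
          with p True have np: "norm p \<le> 3 / 2 * norm z" "r / 2 \<le> norm p"
            by (auto simp: dist_norm)
          have "norm z powr (- 5) = (3 / 2) powr 5 * (3 / 2 * norm z) powr (- 5)"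
            by (simp add: powr_mult powr_minus field_simps)
          also have "\<dots> \<le> (3 / 2) powr 5 * norm p powr (- 5)"
            using np r by (intro mult_left_mono powr_mono2') auto
          finally have "D / L\<^sup>2 * norm z powr (- 5) \<le> D / L\<^sup>2 * ((3 / 2) powr 5 * norm p powr (- 5))"
            using D by (intro mult_left_mono) auto
          also have "\<dots> = E / L\<^sup>2 * norm p powr (- 5)" by (simp add: E_def)
          finally show ?thesis
            using p np pos by (simp add: ennreal_leI flip: ennreal_mult')
        qed simp
      qed
      finally show ?thesis .
    qed simp
    have "ennreal (v * r ^ 3) * (\<integral>\<^sup>+y. kern L (x - y) * F y * indicator {r..} (norm (x - y)) \<partial>lborel)
      = (\<integral>\<^sup>+y. F y * (ennreal (v * r ^ 3) * (kern L (x - y) * indicator {r..} (norm (x - y)))) \<partial>lborel)"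
      by (subst nn_integral_cmult[symmetric]) (auto simp: mult_ac)
    also have "\<dots> \<le> (\<integral>\<^sup>+y. F y * (\<integral>\<^sup>+p. ?k p * indicator (ball (x - y) (r / 2)) p \<partial>lborel) \<partial>lborel)"
      by (intro nn_integral_mono mult_left_mono avg) simp
    also have "\<dots> = (\<integral>\<^sup>+y. \<integral>\<^sup>+p. ?k p * (F y * indicator {q. norm q < r / 2} (x - y - p)) \<partial>lborel \<partial>lborel)"
      by (subst nn_integral_cmult[symmetric]) (auto intro!: nn_integral_cong simp: dist_norm mult_ac split: split_indicator)
    also have "\<dots> = (\<integral>\<^sup>+p. \<integral>\<^sup>+y. ?k p * (F y * indicator {q. norm q < r / 2} (x - y - p)) \<partial>lborel \<partial>lborel)"
      by (rule lborel_pair.Fubini') measurable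
    also have "\<dots> \<le> (\<integral>\<^sup>+p. ?k p * ennreal \<epsilon> \<partial>lborel)"
    proof (rule nn_integral_mono)
      fix p
      have "(\<integral>\<^sup>+y. ?k p * (F y * indicator {q. norm q < r / 2} (x - y - p)) \<partial>lborel) = ?k p * (\<integral>\<^sup>+y. F y * indicator {q. norm q < r / 2} (x - y - p) \<partial>lborel)"
        by (rule nn_integral_cmult) measurable
      also have "(\<integral>\<^sup>+y. F y * indicator {q. norm q < r / 2} (x - y - p) \<partial>lborel) \<le> (\<integral>\<^sup>+y. F y * indicator (ball (x - p) (1 / sqrt L)) y \<partial>lborel)"
        using r unfolding r_def[symmetric]
        by (intro nn_integral_mono) (auto simp: dist_norm algebra_simps split: split_indicator)
      also note small
      finally show "(\<integral>\<^sup>+y. ?k p * (F y * indicator {q. norm q < r / 2} (x - y - p)) \<partial>lborel) \<le> ?k p * ennreal \<epsilon>"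
        by (simp add: mult_left_mono)
    qed
    also have "\<dots> = ennreal (E / L\<^sup>2) * (\<integral>\<^sup>+p. ennreal (norm p powr - 5) * indicator {r / 2..} (norm p) \<partial>(lborel :: (real^3) measure)) * ennreal \<epsilon>"
      by (subst nn_integral_multc, measurable) (subst nn_integral_cmult, auto)
    also have "\<dots> \<le> ennreal (E / L\<^sup>2) * ennreal (J * (r / 2) powr (3 - 5)) * ennreal \<epsilon>"
      using nn_integral_norm_powr_tail[of 5 "r / 2"] r unfolding J_def by (intro mult_right_mono mult_left_mono) auto
    also have "\<dots> = ennreal (v * r ^ 3) * (ennreal (E * J * 4 / v * sqrt L) * ennreal \<epsilon>)"
    proof -
      have p: "(r / 2) powr (3 - 5) = 4 / r\<^sup>2"
        using r by (simp add: powr_neg_numeral power_divide)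
      have Lr: "L = 1 / r\<^sup>2" and sr: "sqrt L = 1 / r" using L by (auto simp: r_def power_divide)
      have "E / L\<^sup>2 * (J * (r / 2) powr (3 - 5)) = v * r ^ 3 * (E * J * 4 / v * sqrt L)"
        unfolding p sr unfolding Lr using r pos by (simp add: field_simps power2_eq_square power3_eq_cube)
      then have "ennreal (E / L\<^sup>2) * ennreal (J * (r / 2) powr (3 - 5)) = ennreal (v * r ^ 3) * ennreal (E * J * 4 / v * sqrt L)"
        using r pos L by (simp flip: ennreal_mult')
      then show ?thesis by (simp add: mult.assoc)
    qed
    finally have "ennreal (v * r ^ 3) * (\<integral>\<^sup>+y. kern L (x - y) * F y * indicator {r..} (norm (x - y)) \<partial>lborel)
      \<le> ennreal (v * r ^ 3) * (ennreal (E * J * 4 / v * sqrt L) * ennreal \<epsilon>)" .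
    then show "(\<integral>\<^sup>+y. kern L (x - y) * F y * indicator {1 / sqrt L..} (norm (x - y)) \<partial>lborel) \<le> ennreal (E * J * 4 / v * sqrt L) * ennreal \<epsilon>"
      using r pos by (subst (asm) ennreal_mult_le_mult_iff) (auto simp: r_def)
  qed
qed

section \<open>A supersolution for the squared potential\<close>

text \<open>Interpolation at a threshold T: above it the power 5/2 is dominated by the cube, below
  it by its value at T. The potential of the cube is controlled by the supersolution property or by
  the local mass, the rest by the kernel alone.\<close>

lemma power_five_halves_split:
  fixes w T :: real
  assumes "w > 0" "T > 0"
  shows "w\<^sup>2 * sqrt w \<le> w ^ 3 / sqrt T + T\<^sup>2 * sqrt T"
proof (cases "T \<le> w")
  case True
  have "sqrt w * sqrt T \<le> sqrt w * sqrt w"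
    using True assms by (intro mult_left_mono) auto
  then have "w\<^sup>2 * (sqrt w * sqrt T) \<le> w\<^sup>2 * w"
    using assms by (intro mult_left_mono) auto
  then have "w\<^sup>2 * sqrt w \<le> w ^ 3 / sqrt T"
    using assms by (simp add: pos_le_divide_eq power3_eq_cube power2_eq_square mult.assoc)
  then show ?thesis using assms by (simp add: add_increasing2)
next
  case False
  then have "w\<^sup>2 * sqrt w \<le> T\<^sup>2 * sqrt T"
    using assms by (intro mult_mono power_mono) auto
  then show ?thesis using assms by (simp add: add_increasing)
qed

text \<open>The constants are fixed in the order A, \<kappa>, \<eta>, \<epsilon>: each makes small,
  given its predecessors, the terms in which it is the last to appear. Each of the six terms
  receives the share d/6.\<close>

lemma small_constants:
  fixes B C D F \<mu> d :: real
  assumes pos: "B > 0" "C > 0" "D > 0" "F > 0" "\<mu> > 0" "d > 0"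
  obtains A \<kappa> \<eta> \<epsilon> where "A > 0" "0 < \<kappa>" "\<kappa> \<le> 1" "\<eta> > 0" "\<epsilon> > 0"
    "1 / (sqrt A * \<mu>) + A\<^sup>2 * sqrt A * B * \<kappa>\<^sup>2 + C * \<epsilon> / (sqrt \<eta> * sqrt \<kappa>) + C * D * \<eta>\<^sup>2 * sqrt \<eta> / sqrt \<kappa>
      + F * \<epsilon> / sqrt \<eta> + \<eta>\<^sup>2 * sqrt \<eta> \<le> d"
proof -
  define e where "e = d / 6"
  have e: "e > 0" and e6: "d = 6 * e" using pos by (simp_all add: e_def)
  have small: "\<exists>x>0. x \<le> 1 \<and> f x \<le> e" if "(f \<longlongrightarrow> 0) (at_right 0)" for f :: "real \<Rightarrow> real"
  proof -
    have "\<forall>\<^sub>F x in at_right 0. f x < e" using order_tendstoD(2)[OF that e] .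
    then have "\<forall>\<^sub>F x in at_right 0. f x < e \<and> x \<in> {0<..<1}"
      by (intro eventually_conj eventually_at_right_real) auto
    then obtain x where "f x < e" "x \<in> {0<..<1}"
      using eventually_happens'[OF trivial_limit_at_right_real] by blast
    then show ?thesis by (intro exI[of _ x]) auto
  qed
  define A where "A = (1 / (e * \<mu>))\<^sup>2"
  have A: "A > 0" "1 / (sqrt A * \<mu>) \<le> e"
    using e pos by (auto simp: A_def real_sqrt_divide real_sqrt_mult)
  have "((\<lambda>k. A\<^sup>2 * sqrt A * B * k\<^sup>2) \<longlongrightarrow> A\<^sup>2 * sqrt A * B * 0\<^sup>2) (at_right 0)"
    by (intro tendsto_intros)
  then obtain \<kappa> where \<kappa>: "\<kappa> > 0" "\<kappa> \<le> 1" "A\<^sup>2 * sqrt A * B * \<kappa>\<^sup>2 \<le> e"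
    using small by force
  \<comment> \<open>The maximum lets one choice of the variable meet two conditions.\<close>
  have "((\<lambda>x. max (C * D * x\<^sup>2 * sqrt x / sqrt \<kappa>) (x\<^sup>2 * sqrt x)) \<longlongrightarrow> max (C * D * 0\<^sup>2 * sqrt 0 / sqrt \<kappa>) (0\<^sup>2 * sqrt 0)) (at_right 0)"
    using \<kappa> by (intro tendsto_intros) auto
  then obtain \<eta> where \<eta>: "\<eta> > 0" "C * D * \<eta>\<^sup>2 * sqrt \<eta> / sqrt \<kappa> \<le> e" "\<eta>\<^sup>2 * sqrt \<eta> \<le> e"
    using small by force
  have "((\<lambda>x. max (C * x / (sqrt \<eta> * sqrt \<kappa>)) (F * x / sqrt \<eta>)) \<longlongrightarrow> max (C * 0 / (sqrt \<eta> * sqrt \<kappa>)) (F * 0 / sqrt \<eta>)) (at_right 0)"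
    using \<kappa> \<eta> by (intro tendsto_intros) auto
  then obtain \<epsilon> where \<epsilon>: "\<epsilon> > 0" "C * \<epsilon> / (sqrt \<eta> * sqrt \<kappa>) \<le> e" "F * \<epsilon> / sqrt \<eta> \<le> e"
    using small by force
  show ?thesis
    by (rule that[OF A(1) \<kappa>(1,2) \<eta>(1) \<epsilon>(1)]) (use A(2) \<kappa>(3) \<eta>(2,3) \<epsilon>(2,3) e6 in linarith)
qed

text \<open>In place of the Sobolev inequality: the square root of \<open>w + sqrt L\<close> is itself an almost
  supersolution for the potential \<open>w\<^sup>2\<close>. Near \<open>x\<close> the hypothesis bounds the potential of \<open>w\<^sup>3\<close> by \<open>w x\<close>
  (threshold \<open>A * W\<close>); at distances beyond \<open>\<kappa> / W\<close> the smallness of the local mass takes over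
  (threshold \<open>\<eta> / norm (x - y)\<close>, frozen at the scale \<open>1 / sqrt L\<close>).\<close>

lemma resolvent_five_halves:
  assumes \<mu>: "\<mu> > 0" and d: "d > 0"
  obtains \<epsilon> where "\<epsilon> > 0"
    "\<And>L w x. L > 0 \<Longrightarrow> w \<in> borel_measurable borel \<Longrightarrow> (\<And>x. w x > 0) \<Longrightarrow>
      (\<And>x. (\<integral>\<^sup>+y. ennreal (w y ^ 3) * indicator (ball x (1 / sqrt L)) y \<partial>lborel) \<le> ennreal \<epsilon>) \<Longrightarrow>
      resolvent L (\<lambda>y. ennreal (\<mu> * w y ^ 3)) x \<le> ennreal (w x) \<Longrightarrow>
      resolvent L (\<lambda>y. ennreal ((w y)\<^sup>2 * sqrt (w y))) x \<le> ennreal (d * sqrt (w x + sqrt L))"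
proof -
  obtain B where B: "B > 0" and kb: "\<And>L \<rho>. L > 0 \<Longrightarrow> \<rho> > 0 \<Longrightarrow> (\<integral>\<^sup>+z. kern L z * indicator (ball 0 \<rho>) z \<partial>lborel) \<le> ennreal (B * \<rho>\<^sup>2)"
    using kern_ball by blast
  obtain C where C: "C > 0" and ku: "\<And>L z. L > 0 \<Longrightarrow> z \<noteq> 0 \<Longrightarrow> kern L z \<le> ennreal (C / norm z)"
    using kern_upper by blast
  obtain F where F: "F > 0" and kf: "\<And>L f \<epsilon> x. L > 0 \<Longrightarrow> f \<in> borel_measurable borel \<Longrightarrow>
      (\<And>x. (\<integral>\<^sup>+y. f y * indicator (ball x (1 / sqrt L)) y \<partial>lborel) \<le> ennreal \<epsilon>) \<Longrightarrow>
      (\<integral>\<^sup>+y. kern L (x - y) * f y * indicator {1 / sqrt L..} (norm (x - y)) \<partial>lborel) \<le> ennreal (F * sqrt L) * ennreal \<epsilon>"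
    using kern_far_bound by blast
  define D where "D = (7 / 2) * (4 / 3 * pi) / (7 / 2 - 3 :: real)"
  have D: "D > 0" by (simp add: D_def)
  obtain A \<kappa> \<eta> \<epsilon> where A: "A > 0" and \<kappa>: "0 < \<kappa>" "\<kappa> \<le> 1" and \<eta>: "\<eta> > 0" and \<epsilon>: "\<epsilon> > 0"
    and sum: "1 / (sqrt A * \<mu>) + A\<^sup>2 * sqrt A * B * \<kappa>\<^sup>2 + C * \<epsilon> / (sqrt \<eta> * sqrt \<kappa>) + C * D * \<eta>\<^sup>2 * sqrt \<eta> / sqrt \<kappa>
      + F * \<epsilon> / sqrt \<eta> + \<eta>\<^sup>2 * sqrt \<eta> \<le> d"
    using small_constants[OF B C D F \<mu> d] by blast
  show ?thesis
  proof (rule that[OF \<epsilon>])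
    fix L :: real and w :: "real^3 \<Rightarrow> real" and x
    assume L: "L > 0" and [measurable]: "w \<in> borel_measurable borel" and w: "\<And>x. w x > 0"
      and small: "\<And>x. (\<integral>\<^sup>+y. ennreal (w y ^ 3) * indicator (ball x (1 / sqrt L)) y \<partial>lborel) \<le> ennreal \<epsilon>"
      and super: "resolvent L (\<lambda>y. ennreal (\<mu> * w y ^ 3)) x \<le> ennreal (w x)"
    \<comment> \<open>W is the size of w at x, kept above sqrt L so that \<rho> = \<kappa> / W does
      not exceed r = 1 / sqrt L.\<close>
    define W where "W = w x + sqrt L"
    define \<rho> where "\<rho> = \<kappa> / W"
    define r where "r = 1 / sqrt L"
    have sL: "sqrt L > 0" using L by simp
    have W: "W > 0" "w x \<le> W" "sqrt L \<le> W" unfolding W_def using w[of x] sL by linarith+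
    have \<rho>: "\<rho> > 0" using W \<kappa> by (simp add: \<rho>_def)
    have r: "r > 0" using L by (simp add: r_def)
    \<comment> \<open>The coefficients come in pairs for the zones norm (x - y) < \<rho>, between
      \<rho> and r, and from r on. The threshold T is A W, \<eta> / norm (x - y) and \<eta> sqrt L
      respectively; the odd index belongs to the cubic part and the even one to T^(5/2).\<close>
    define k1 where "k1 = 1 / (sqrt (A * W) * \<mu>)"
    define k2 where "k2 = (A * W)\<^sup>2 * sqrt (A * W)"
    define k3 where "k3 = C / (sqrt \<eta> * sqrt \<rho>)"
    define k4 where "k4 = C * \<eta>\<^sup>2 * sqrt \<eta>"
    define k5 where "k5 = 1 / sqrt (\<eta> * sqrt L)"
    define k6 where "k6 = (\<eta> * sqrt L)\<^sup>2 * sqrt (\<eta> * sqrt L)"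
    have s0: "sqrt (A * W) \<ge> 0" using A W by (intro real_sqrt_ge_zero mult_nonneg_nonneg) auto
    have "k1 \<ge> 0" "k2 \<ge> 0"
      unfolding k1_def k2_def using s0 \<mu> by (intro divide_nonneg_nonneg mult_nonneg_nonneg; simp)+
    moreover have "k3 \<ge> 0" "k4 \<ge> 0" "k5 \<ge> 0" "k6 \<ge> 0"
      using C \<eta> \<rho> sL by (auto simp: k3_def k4_def k5_def k6_def)
    ultimately have k0: "k1 \<ge> 0" "k2 \<ge> 0" "k3 \<ge> 0" "k4 \<ge> 0" "k5 \<ge> 0" "k6 \<ge> 0" .
    let ?t1 = "\<lambda>y. ennreal k1 * (kern L (x - y) * ennreal (\<mu> * w y ^ 3))"
    let ?t2 = "\<lambda>y. ennreal k2 * (kern L (x - y) * indicator (ball 0 \<rho>) (x - y))"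
    let ?t3 = "\<lambda>y. ennreal k3 * (ennreal (w y ^ 3) * indicator (ball x r) y)"
    let ?t4 = "\<lambda>y. ennreal k4 * (ennreal (norm (x - y) powr - (7 / 2)) * indicator {\<rho>..} (norm (x - y)))"
    let ?t5 = "\<lambda>y. ennreal k5 * (kern L (x - y) * ennreal (w y ^ 3) * indicator {1 / sqrt L..} (norm (x - y)))"
    let ?t6 = "\<lambda>y. ennreal k6 * kern L (x - y)"
    have [measurable]: "ball (z::real^3) s \<in> sets borel" for z s by auto
    have split: "kern L (x - y) * ennreal ((w y)\<^sup>2 * sqrt (w y)) \<le> kern L (x - y) * ennreal (w y ^ 3 / sqrt T) + kern L (x - y) * ennreal (T\<^sup>2 * sqrt T)"
      if "T > 0" for T y
    proof -
      have "ennreal ((w y)\<^sup>2 * sqrt (w y)) \<le> ennreal (w y ^ 3 / sqrt T) + ennreal (T\<^sup>2 * sqrt T)"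
        using power_five_halves_split[OF w[of y] that] w[of y] that
        by (simp add: ennreal_plus[symmetric] ennreal_leI less_imp_le del: ennreal_plus)
      then show ?thesis
        unfolding distrib_left[symmetric] by (rule mult_left_mono) simp
    qed
    have six: "a + b \<le> a + b + c + d + e + f" "c + d \<le> a + b + c + d + e + f" "e + f \<le> a + b + c + d + e + f"
      for a b c d e f :: ennreal
      unfolding le_iff_add
      by (rule exI[of _ "c + d + e + f"] exI[of _ "a + b + e + f"] exI[of _ "a + b + c + d"]; simp only: add_ac)+
    have point: "kern L (x - y) * ennreal ((w y)\<^sup>2 * sqrt (w y)) \<le> ?t1 y + ?t2 y + ?t3 y + ?t4 y + ?t5 y + ?t6 y" for y
    proof -
      define s where "s = norm (x - y)"
      consider "s < \<rho>" | "\<rho> \<le> s" "s < r" | "r \<le> s" by linarith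
      then show ?thesis
      proof cases
        case 1
        have AW: "A * W > 0" using A W by simp
        have "kern L (x - y) * ennreal ((w y)\<^sup>2 * sqrt (w y)) \<le> kern L (x - y) * ennreal (w y ^ 3 / sqrt (A * W)) + kern L (x - y) * ennreal ((A * W)\<^sup>2 * sqrt (A * W))"
          by (rule split[OF AW])
        also have "w y ^ 3 / sqrt (A * W) = k1 * (\<mu> * w y ^ 3)" using \<mu> by (simp add: k1_def)
        also have "kern L (x - y) * ennreal (k1 * (\<mu> * w y ^ 3)) = ?t1 y"
          unfolding ennreal_mult'[OF k0(1)] by (rule mult.left_commute)
        also have "kern L (x - y) * ennreal ((A * W)\<^sup>2 * sqrt (A * W)) = ?t2 y"
          using 1 by (simp add: k2_def s_def mult_ac)
        also have "?t1 y + ?t2 y \<le> ?t1 y + ?t2 y + ?t3 y + ?t4 y + ?t5 y + ?t6 y"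
          by (rule six)
        finally show ?thesis .
      next
        case 2
        have s: "s > 0" using 2 \<rho> by simp
        have T: "\<eta> / s > 0" using s \<eta> by simp
        have ks: "kern L (x - y) \<le> ennreal (C / s)"
          using ku[OF L, of "x - y"] s by (auto simp: s_def)
        have "kern L (x - y) * ennreal ((w y)\<^sup>2 * sqrt (w y)) \<le> kern L (x - y) * ennreal (w y ^ 3 / sqrt (\<eta> / s)) + kern L (x - y) * ennreal ((\<eta> / s)\<^sup>2 * sqrt (\<eta> / s))"
          by (rule split[OF T])
        also have "\<dots> \<le> ?t3 y + ?t4 y"
        proof (rule add_mono)
          have "kern L (x - y) * ennreal (w y ^ 3 / sqrt (\<eta> / s)) \<le> ennreal (C / s) * ennreal (w y ^ 3 / sqrt (\<eta> / s))"
            by (rule mult_right_mono[OF ks]) simp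
          also have "\<dots> = ennreal (C / s * (w y ^ 3 / sqrt (\<eta> / s)))"
            using C s by (simp add: ennreal_mult'[symmetric])
          also have "C / s * (w y ^ 3 / sqrt (\<eta> / s)) = C / (sqrt \<eta> * sqrt s) * w y ^ 3"
          proof -
            have "s = sqrt s * sqrt s" using s by simp
            then show ?thesis using s \<eta> by (simp add: real_sqrt_divide field_simps)
          qed
          also have "ennreal (C / (sqrt \<eta> * sqrt s) * w y ^ 3) \<le> ennreal (k3 * w y ^ 3)"
            unfolding k3_def using 2 C \<eta> \<rho> s w[of y]
            by (intro ennreal_leI mult_right_mono divide_left_mono mult_left_mono) auto
          also have "\<dots> = ?t3 y"
            using k0 2 by (simp add: ennreal_mult' s_def dist_norm)
          finally show "kern L (x - y) * ennreal (w y ^ 3 / sqrt (\<eta> / s)) \<le> ?t3 y" .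
          have "kern L (x - y) * ennreal ((\<eta> / s)\<^sup>2 * sqrt (\<eta> / s)) \<le> ennreal (C / s) * ennreal ((\<eta> / s)\<^sup>2 * sqrt (\<eta> / s))"
            by (rule mult_right_mono[OF ks]) simp
          also have "\<dots> = ennreal (C / s * ((\<eta> / s)\<^sup>2 * sqrt (\<eta> / s)))"
            using C s by (simp add: ennreal_mult'[symmetric])
          \<comment> \<open>One power of 1/s comes from the kernel and 5/2 from the threshold; as
            7/2 > 3, the tail is integrable.\<close>
          also have "C / s * ((\<eta> / s)\<^sup>2 * sqrt (\<eta> / s)) = k4 * s powr - (7 / 2)"
          proof -
            have "s powr - (7 / 2) = s powr (- 3) * s powr (- (1 / 2))" by (simp flip: powr_add)
            also have "\<dots> = 1 / (s ^ 3 * sqrt s)"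
              using s by (simp add: powr_neg_numeral powr_minus powr_half_sqrt field_simps)
            finally show ?thesis
              using s by (simp add: k4_def real_sqrt_divide power_divide field_simps power2_eq_square power3_eq_cube)
          qed
          also have "ennreal (k4 * s powr - (7 / 2)) = ?t4 y"
            using k0 2 by (simp add: ennreal_mult' s_def)
          finally show "kern L (x - y) * ennreal ((\<eta> / s)\<^sup>2 * sqrt (\<eta> / s)) \<le> ?t4 y" .
        qed
        also have "?t3 y + ?t4 y \<le> ?t1 y + ?t2 y + ?t3 y + ?t4 y + ?t5 y + ?t6 y"
          by (rule six)
        finally show ?thesis .
      next
        case 3
        have T: "\<eta> * sqrt L > 0" using \<eta> sL by simp
        have "kern L (x - y) * ennreal ((w y)\<^sup>2 * sqrt (w y)) \<le> kern L (x - y) * ennreal (w y ^ 3 / sqrt (\<eta> * sqrt L)) + kern L (x - y) * ennreal ((\<eta> * sqrt L)\<^sup>2 * sqrt (\<eta> * sqrt L))"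
          by (rule split[OF T])
        also have "w y ^ 3 / sqrt (\<eta> * sqrt L) = k5 * w y ^ 3" by (simp add: k5_def)
        also have "kern L (x - y) * ennreal (k5 * w y ^ 3) = ?t5 y"
          using k0 3 by (simp add: ennreal_mult' mult_ac s_def r_def)
        also have "kern L (x - y) * ennreal ((\<eta> * sqrt L)\<^sup>2 * sqrt (\<eta> * sqrt L)) = ?t6 y"
          by (simp add: k6_def mult_ac)
        also have "?t5 y + ?t6 y \<le> ?t1 y + ?t2 y + ?t3 y + ?t4 y + ?t5 y + ?t6 y"
          by (rule six)
        finally show ?thesis .
      qed
    qed
    \<comment> \<open>The thresholds are chosen so that each of the six integrals is a constant
      times sqrt W; the far zone gives the fourth root of L, which is at most sqrt W.\<close>
    have e1: "(\<integral>\<^sup>+y. ?t1 y \<partial>lborel) \<le> ennreal (1 / (sqrt A * \<mu>) * sqrt W)"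
    proof -
      have "(\<integral>\<^sup>+y. ?t1 y \<partial>lborel) = ennreal k1 * resolvent L (\<lambda>y. ennreal (\<mu> * w y ^ 3)) x"
        by (simp add: resolvent_kern nn_integral_cmult)
      also have "\<dots> \<le> ennreal k1 * ennreal W"
        using super W by (intro mult_left_mono) (auto intro: order_trans ennreal_leI)
      also have "\<dots> = ennreal (k1 * W)" using k0 by (simp add: ennreal_mult')
      also have "k1 * W = 1 / (sqrt A * \<mu>) * sqrt W"
      proof -
        have "W = sqrt W * sqrt W" using W by simp
        then have "k1 * W = 1 / (sqrt A * sqrt W * \<mu>) * (sqrt W * sqrt W)" by (simp add: k1_def real_sqrt_mult)
        also have "\<dots> = 1 / (sqrt A * \<mu>) * sqrt W"
          using nonzero_mult_div_cancel_right[of "sqrt W" "sqrt W"] W by (simp only: times_divide_eq_left mult_1_left) (simp del: real_sqrt_mult_self)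
        finally show ?thesis .
      qed
      finally show ?thesis .
    qed
    have e2: "(\<integral>\<^sup>+y. ?t2 y \<partial>lborel) \<le> ennreal (A\<^sup>2 * sqrt A * B * \<kappa>\<^sup>2 * sqrt W)"
    proof -
      have "(\<integral>\<^sup>+y. ?t2 y \<partial>lborel) = ennreal k2 * (\<integral>\<^sup>+y. kern L (x - y) * indicator (ball 0 \<rho>) (x - y) \<partial>lborel)"
        by (rule nn_integral_cmult) measurable
      also have "(\<integral>\<^sup>+y. kern L (x - y) * indicator (ball 0 \<rho>) (x - y) \<partial>lborel) = (\<integral>\<^sup>+z. kern L z * indicator (ball 0 \<rho>) z \<partial>lborel)"
        by (rule nn_integral_lborel_reflect) measurable
      also have "ennreal k2 * \<dots> \<le> ennreal k2 * ennreal (B * \<rho>\<^sup>2)"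
        by (intro mult_left_mono kb L \<rho>) simp
      also have "\<dots> = ennreal (k2 * (B * \<rho>\<^sup>2))" using k0 by (simp add: ennreal_mult')
      also have "k2 * (B * \<rho>\<^sup>2) = A\<^sup>2 * sqrt A * B * \<kappa>\<^sup>2 * sqrt W"
        using W by (simp add: k2_def \<rho>_def real_sqrt_mult power_mult_distrib power_divide)
      finally show ?thesis .
    qed
    have e3: "(\<integral>\<^sup>+y. ?t3 y \<partial>lborel) \<le> ennreal (C * \<epsilon> / (sqrt \<eta> * sqrt \<kappa>) * sqrt W)"
    proof -
      have "(\<integral>\<^sup>+y. ?t3 y \<partial>lborel) = ennreal k3 * (\<integral>\<^sup>+y. ennreal (w y ^ 3) * indicator (ball x r) y \<partial>lborel)"
        by (rule nn_integral_cmult) measurable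
      also have "\<dots> \<le> ennreal k3 * ennreal \<epsilon>"
        unfolding r_def by (intro mult_left_mono small) simp
      also have "\<dots> = ennreal (k3 * \<epsilon>)" using k0 by (simp add: ennreal_mult')
      also have "k3 * \<epsilon> = C * \<epsilon> / (sqrt \<eta> * sqrt \<kappa>) * sqrt W"
        by (simp add: k3_def \<rho>_def real_sqrt_divide)
      finally show ?thesis .
    qed
    have e4: "(\<integral>\<^sup>+y. ?t4 y \<partial>lborel) \<le> ennreal (C * D * \<eta>\<^sup>2 * sqrt \<eta> / sqrt \<kappa> * sqrt W)"
    proof -
      have "(\<integral>\<^sup>+y. ?t4 y \<partial>lborel) = ennreal k4 * (\<integral>\<^sup>+y. ennreal (norm (x - y) powr - (7 / 2)) * indicator {\<rho>..} (norm (x - y)) \<partial>lborel)"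
        by (rule nn_integral_cmult) measurable
      also have "(\<integral>\<^sup>+y. ennreal (norm (x - y) powr - (7 / 2)) * indicator {\<rho>..} (norm (x - y)) \<partial>lborel)
        = (\<integral>\<^sup>+z. ennreal (norm z powr - (7 / 2)) * indicator {\<rho>..} (norm z) \<partial>(lborel :: (real^3) measure))"
        by (rule nn_integral_lborel_reflect[of "\<lambda>z. ennreal (norm z powr - (7 / 2)) * indicator {\<rho>..} (norm z)"]) measurable
      also have "ennreal k4 * \<dots> \<le> ennreal k4 * ennreal (D * \<rho> powr (3 - 7 / 2))"
        unfolding D_def using \<rho> by (intro mult_left_mono nn_integral_norm_powr_tail) auto
      also have "\<dots> = ennreal (k4 * (D * \<rho> powr (3 - 7 / 2)))" using k0 by (simp add: ennreal_mult')
      also have "k4 * (D * \<rho> powr (3 - 7 / 2)) = C * D * \<eta>\<^sup>2 * sqrt \<eta> / sqrt \<kappa> * sqrt W"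
      proof -
        have "\<rho> powr (3 - 7 / 2) = \<rho> powr (- (1 / 2))" by simp
        also have "\<dots> = 1 / sqrt \<rho>" using \<rho> by (simp add: powr_minus_divide powr_half_sqrt)
        also have "\<dots> = sqrt W / sqrt \<kappa>" by (simp add: \<rho>_def real_sqrt_divide)
        finally show ?thesis by (simp add: k4_def)
      qed
      finally show ?thesis .
    qed
    have qL: "sqrt (sqrt L) \<le> sqrt W" using W by simp
    have e5: "(\<integral>\<^sup>+y. ?t5 y \<partial>lborel) \<le> ennreal (F * \<epsilon> / sqrt \<eta> * sqrt W)"
    proof -
      have "(\<integral>\<^sup>+y. ?t5 y \<partial>lborel) = ennreal k5 * (\<integral>\<^sup>+y. kern L (x - y) * ennreal (w y ^ 3) * indicator {1 / sqrt L..} (norm (x - y)) \<partial>lborel)"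
        by (rule nn_integral_cmult) measurable
      also have "\<dots> \<le> ennreal k5 * (ennreal (F * sqrt L) * ennreal \<epsilon>)"
        by (intro mult_left_mono kf L small) auto
      also have "\<dots> = ennreal (k5 * (F * sqrt L * \<epsilon>))" using k0 F sL by (simp add: ennreal_mult'[symmetric])
      also have "k5 * (F * sqrt L * \<epsilon>) = F * \<epsilon> / sqrt \<eta> * sqrt (sqrt L)"
      proof -
        have "sqrt L = sqrt (sqrt L) * sqrt (sqrt L)" using sL by simp
        then have "k5 * (F * sqrt L * \<epsilon>) = 1 / (sqrt \<eta> * sqrt (sqrt L)) * (F * (sqrt (sqrt L) * sqrt (sqrt L)) * \<epsilon>)"
          by (simp add: k5_def real_sqrt_mult)
        also have "\<dots> = F * \<epsilon> / sqrt \<eta> * sqrt (sqrt L)"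
          using sL by (simp del: real_sqrt_mult_self)
        finally show ?thesis .
      qed
      also have "ennreal (F * \<epsilon> / sqrt \<eta> * sqrt (sqrt L)) \<le> ennreal (F * \<epsilon> / sqrt \<eta> * sqrt W)"
        using F \<epsilon> \<eta> by (intro ennreal_leI mult_left_mono qL) auto
      finally show ?thesis .
    qed
    have e6: "(\<integral>\<^sup>+y. ?t6 y \<partial>lborel) \<le> ennreal (\<eta>\<^sup>2 * sqrt \<eta> * sqrt W)"
    proof -
      have "(\<integral>\<^sup>+y. ?t6 y \<partial>lborel) = ennreal k6 * (\<integral>\<^sup>+y. kern L (x - y) \<partial>lborel)"
        by (rule nn_integral_cmult) measurable
      also have "(\<integral>\<^sup>+y. kern L (x - y) \<partial>lborel) = (\<integral>\<^sup>+z. kern L z \<partial>lborel)"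
        by (rule nn_integral_lborel_reflect) measurable
      also have "ennreal k6 * \<dots> \<le> ennreal k6 * ennreal (1 / L)"
        by (intro mult_left_mono kern_mass L) simp
      also have "\<dots> = ennreal (k6 * (1 / L))" by (rule ennreal_mult'[OF k0(6), symmetric])
      also have "k6 * (1 / L) = \<eta>\<^sup>2 * sqrt \<eta> * sqrt (sqrt L)"
        using L by (simp add: k6_def real_sqrt_mult power_mult_distrib)
      also have "ennreal (\<eta>\<^sup>2 * sqrt \<eta> * sqrt (sqrt L)) \<le> ennreal (\<eta>\<^sup>2 * sqrt \<eta> * sqrt W)"
        using \<eta> by (intro ennreal_leI mult_left_mono qL) auto
      finally show ?thesis .
    qed
    have "resolvent L (\<lambda>y. ennreal ((w y)\<^sup>2 * sqrt (w y))) x = (\<integral>\<^sup>+y. kern L (x - y) * ennreal ((w y)\<^sup>2 * sqrt (w y)) \<partial>lborel)"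
      by (simp add: resolvent_kern)
    also have "\<dots> \<le> (\<integral>\<^sup>+y. ?t1 y + ?t2 y + ?t3 y + ?t4 y + ?t5 y + ?t6 y \<partial>lborel)"
      by (intro nn_integral_mono point)
    also have "\<dots> = (\<integral>\<^sup>+y. ?t1 y \<partial>lborel) + (\<integral>\<^sup>+y. ?t2 y \<partial>lborel) + (\<integral>\<^sup>+y. ?t3 y \<partial>lborel) + (\<integral>\<^sup>+y. ?t4 y \<partial>lborel) + (\<integral>\<^sup>+y. ?t5 y \<partial>lborel) + (\<integral>\<^sup>+y. ?t6 y \<partial>lborel)"
      by (subst nn_integral_add; measurable?)+
    also have "\<dots> \<le> ennreal (1 / (sqrt A * \<mu>) * sqrt W) + ennreal (A\<^sup>2 * sqrt A * B * \<kappa>\<^sup>2 * sqrt W)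
      + ennreal (C * \<epsilon> / (sqrt \<eta> * sqrt \<kappa>) * sqrt W) + ennreal (C * D * \<eta>\<^sup>2 * sqrt \<eta> / sqrt \<kappa> * sqrt W)
      + ennreal (F * \<epsilon> / sqrt \<eta> * sqrt W) + ennreal (\<eta>\<^sup>2 * sqrt \<eta> * sqrt W)"
      by (intro add_mono e1 e2 e3 e4 e5 e6)
    also have "\<dots> = ennreal ((1 / (sqrt A * \<mu>) + A\<^sup>2 * sqrt A * B * \<kappa>\<^sup>2 + C * \<epsilon> / (sqrt \<eta> * sqrt \<kappa>) + C * D * \<eta>\<^sup>2 * sqrt \<eta> / sqrt \<kappa>
      + F * \<epsilon> / sqrt \<eta> + \<eta>\<^sup>2 * sqrt \<eta>) * sqrt W)"
      unfolding distrib_right using A \<mu> W B C D F \<kappa> \<eta> \<epsilon>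
      by (subst ennreal_plus; (simp add: add_nonneg_nonneg)?)+
    also have "\<dots> \<le> ennreal (d * sqrt W)"
      using sum W by (intro ennreal_leI mult_right_mono) auto
    finally show "resolvent L (\<lambda>y. ennreal ((w y)\<^sup>2 * sqrt (w y))) x \<le> ennreal (d * sqrt (w x + sqrt L))"
      unfolding W_def .
  qed
qed

text \<open>The Schur test needs one weight on both sides, so sqrt L is moved out of the root and
  the potential also acts on the constant fourth root of L. Where w \<ge> a sqrt L that constant is
  at most sqrt w / sqrt a; elsewhere w^2 \<le> a^2 L, which the kernel mass 1/L turns into a small
  multiple of the constant.\<close>

theorem square_potential_supersolution:
  assumes \<mu>: "\<mu> > 0" and \<delta>: "\<delta> > 0"
  obtains \<epsilon> where "\<epsilon> > 0"
    "\<And>L w. L > 0 \<Longrightarrow> w \<in> borel_measurable borel \<Longrightarrow> (\<And>x. w x > 0) \<Longrightarrow>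
      (\<And>x. (\<integral>\<^sup>+y. ennreal (w y ^ 3) * indicator (ball x (1 / sqrt L)) y \<partial>lborel) \<le> ennreal \<epsilon>) \<Longrightarrow>
      (AE x in lborel. resolvent L (\<lambda>y. ennreal (\<mu> * w y ^ 3)) x \<le> ennreal (w x)) \<Longrightarrow>
      (AE x in lborel. resolvent L (\<lambda>y. ennreal ((w y)\<^sup>2 * (sqrt (w y) + sqrt (sqrt L)))) x
        \<le> ennreal (\<delta> * (sqrt (w x) + sqrt (sqrt L))))"
proof -
  \<comment> \<open>\<delta> is split into halves: a^2 = \<delta> / 2 for the region where w is
    small, and d (1 + 1 / sqrt a) = \<delta> / 2 for the part bounded by the power 5/2.\<close>
  define a where "a = sqrt (\<delta> / 2)"
  have a: "a > 0" "a\<^sup>2 = \<delta> / 2" using \<delta> by (auto simp: a_def)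
  define d where "d = \<delta> / 2 / (1 + 1 / sqrt a)"
  have sa: "1 + 1 / sqrt a > 0" using a by (intro add_pos_nonneg) auto
  have d: "d > 0" using \<delta> sa by (simp add: d_def)
  obtain \<epsilon> where \<epsilon>: "\<epsilon> > 0" and five: "\<And>L w x. L > 0 \<Longrightarrow> w \<in> borel_measurable borel \<Longrightarrow> (\<And>x. w x > 0) \<Longrightarrow>
      (\<And>x. (\<integral>\<^sup>+y. ennreal (w y ^ 3) * indicator (ball x (1 / sqrt L)) y \<partial>lborel) \<le> ennreal \<epsilon>) \<Longrightarrow>
      resolvent L (\<lambda>y. ennreal (\<mu> * w y ^ 3)) x \<le> ennreal (w x) \<Longrightarrow>
      resolvent L (\<lambda>y. ennreal ((w y)\<^sup>2 * sqrt (w y))) x \<le> ennreal (d * sqrt (w x + sqrt L))"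
    using resolvent_five_halves[OF \<mu> d] by blast
  show ?thesis
  proof (rule that[OF \<epsilon>])
    fix L :: real and w :: "real^3 \<Rightarrow> real"
    assume L: "L > 0" and [measurable]: "w \<in> borel_measurable borel" and w: "\<And>x. w x > 0"
      and small: "\<And>x. (\<integral>\<^sup>+y. ennreal (w y ^ 3) * indicator (ball x (1 / sqrt L)) y \<partial>lborel) \<le> ennreal \<epsilon>"
      and super: "AE x in lborel. resolvent L (\<lambda>y. ennreal (\<mu> * w y ^ 3)) x \<le> ennreal (w x)"
    let ?l = "sqrt (sqrt L)"
    have l: "?l > 0" "?l ^ 4 = L" using L by (auto simp: power4_eq_xxxx mult.assoc)
    have point: "(w y)\<^sup>2 * (sqrt (w y) + ?l) \<le> (1 + 1 / sqrt a) * ((w y)\<^sup>2 * sqrt (w y)) + a\<^sup>2 * ?l * L" for y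
    proof -
      have "(w y)\<^sup>2 * ?l \<le> 1 / sqrt a * ((w y)\<^sup>2 * sqrt (w y)) + a\<^sup>2 * ?l * L"
      proof (cases "a * sqrt L \<le> w y")
        case True
        then have "sqrt (a * sqrt L) \<le> sqrt (w y)" by simp
        then have "sqrt a * ?l \<le> sqrt (w y)" by (simp add: real_sqrt_mult)
        then have "?l \<le> 1 / sqrt a * sqrt (w y)" using a by (simp add: field_simps)
        then have "(w y)\<^sup>2 * ?l \<le> (w y)\<^sup>2 * (1 / sqrt a * sqrt (w y))" by (intro mult_left_mono) auto
        moreover have "0 \<le> a\<^sup>2 * ?l * L" using a L by simp
        ultimately show ?thesis by (simp add: mult_ac)
      next
        case False
        then have "(w y)\<^sup>2 \<le> (a * sqrt L)\<^sup>2" using w[of y] by (intro power_mono) auto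
        also have "\<dots> = a\<^sup>2 * L" using L by (simp add: power_mult_distrib)
        finally have "(w y)\<^sup>2 * ?l \<le> a\<^sup>2 * L * ?l" using l by (intro mult_right_mono) auto
        moreover have "0 \<le> 1 / sqrt a * ((w y)\<^sup>2 * sqrt (w y))" using a w[of y] by simp
        ultimately show ?thesis by (simp add: mult_ac)
      qed
      then show ?thesis by (simp add: algebra_simps)
    qed
    show "AE x in lborel. resolvent L (\<lambda>y. ennreal ((w y)\<^sup>2 * (sqrt (w y) + ?l))) x \<le> ennreal (\<delta> * (sqrt (w x) + ?l))"
      using super
    proof eventually_elim
      case (elim x)
      have "resolvent L (\<lambda>y. ennreal ((w y)\<^sup>2 * (sqrt (w y) + ?l))) x = (\<integral>\<^sup>+y. kern L (x - y) * ennreal ((w y)\<^sup>2 * (sqrt (w y) + ?l)) \<partial>lborel)"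
        by (simp add: resolvent_kern)
      also have "\<dots> \<le> (\<integral>\<^sup>+y. ennreal (1 + 1 / sqrt a) * (kern L (x - y) * ennreal ((w y)\<^sup>2 * sqrt (w y))) + ennreal (a\<^sup>2 * ?l * L) * kern L (x - y) \<partial>lborel)"
      proof (rule nn_integral_mono)
        fix y
        have "kern L (x - y) * ennreal ((w y)\<^sup>2 * (sqrt (w y) + ?l)) \<le> kern L (x - y) * ennreal ((1 + 1 / sqrt a) * ((w y)\<^sup>2 * sqrt (w y)) + a\<^sup>2 * ?l * L)"
          by (intro mult_left_mono ennreal_leI point) simp
        also have "ennreal ((1 + 1 / sqrt a) * ((w y)\<^sup>2 * sqrt (w y)) + a\<^sup>2 * ?l * L) = ennreal (1 + 1 / sqrt a) * ennreal ((w y)\<^sup>2 * sqrt (w y)) + ennreal (a\<^sup>2 * ?l * L)"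
          using sa w[of y] L by (subst ennreal_plus) (auto intro!: ennreal_mult' mult_nonneg_nonneg)
        finally show "kern L (x - y) * ennreal ((w y)\<^sup>2 * (sqrt (w y) + ?l)) \<le> ennreal (1 + 1 / sqrt a) * (kern L (x - y) * ennreal ((w y)\<^sup>2 * sqrt (w y))) + ennreal (a\<^sup>2 * ?l * L) * kern L (x - y)"
          by (simp only: distrib_left mult_ac)
      qed
      also have "\<dots> = ennreal (1 + 1 / sqrt a) * resolvent L (\<lambda>y. ennreal ((w y)\<^sup>2 * sqrt (w y))) x + ennreal (a\<^sup>2 * ?l * L) * (\<integral>\<^sup>+y. kern L (x - y) \<partial>lborel)"
        by (subst nn_integral_add, measurable) (simp add: nn_integral_cmult resolvent_kern)
      also have "(\<integral>\<^sup>+y. kern L (x - y) \<partial>lborel) = (\<integral>\<^sup>+z. kern L z \<partial>lborel)"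
        by (rule nn_integral_lborel_reflect) measurable
      also have "ennreal (1 + 1 / sqrt a) * resolvent L (\<lambda>y. ennreal ((w y)\<^sup>2 * sqrt (w y))) x + ennreal (a\<^sup>2 * ?l * L) * (\<integral>\<^sup>+z. kern L z \<partial>lborel)
        \<le> ennreal (1 + 1 / sqrt a) * ennreal (d * sqrt (w x + sqrt L)) + ennreal (a\<^sup>2 * ?l * L) * ennreal (1 / L)"
        using L w small elim by (intro add_mono mult_left_mono five kern_mass) auto
      also have "\<dots> = ennreal ((1 + 1 / sqrt a) * (d * sqrt (w x + sqrt L)) + a\<^sup>2 * ?l * L * (1 / L))"
        using sa d w[of x] L a(1)
        by (simp only: ennreal_mult''[symmetric] ennreal_plus[symmetric] mult_nonneg_nonneg less_imp_le
            real_sqrt_ge_zero add_nonneg_nonneg zero_le_power2 divide_nonneg_pos zero_le_one)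
      also have "\<dots> \<le> ennreal (\<delta> * (sqrt (w x) + ?l))"
      proof (rule ennreal_leI)
        have "(1 + 1 / sqrt a) * d = \<delta> / 2"
          unfolding d_def times_divide_eq_right[of "1 + 1 / sqrt a" "\<delta> / 2"]
          by (rule nonzero_mult_div_cancel_left) (use sa in linarith)
        then have "(1 + 1 / sqrt a) * (d * sqrt (w x + sqrt L)) = \<delta> / 2 * sqrt (w x + sqrt L)"
          by (simp only: mult.assoc[symmetric])
        also have "\<dots> \<le> \<delta> / 2 * (sqrt (w x) + ?l)"
          using \<delta> w[of x] L by (intro mult_left_mono sqrt_add_le_add_sqrt) auto
        finally have 1: "(1 + 1 / sqrt a) * (d * sqrt (w x + sqrt L)) \<le> \<delta> / 2 * (sqrt (w x) + ?l)" .
        have "a\<^sup>2 * ?l * L * (1 / L) = \<delta> / 2 * ?l" using L a by simp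
        also have "\<dots> \<le> \<delta> / 2 * (sqrt (w x) + ?l)" using \<delta> w[of x] by (intro mult_left_mono) auto
        finally have 2: "a\<^sup>2 * ?l * L * (1 / L) \<le> \<delta> / 2 * (sqrt (w x) + ?l)" .
        show "(1 + 1 / sqrt a) * (d * sqrt (w x + sqrt L)) + a\<^sup>2 * ?l * L * (1 / L) \<le> \<delta> * (sqrt (w x) + ?l)"
          by (rule order_trans[OF add_mono[OF 1 2]]) simp
      qed
      finally show ?case .
    qed
  qed
qed

section \<open>From weak solutions to the contradiction\<close>

lemma grad_inner: "i \<in> Basis \<Longrightarrow> grad f x \<bullet> i = pd f i x"
  by (simp add: grad_def inner_sum_left inner_Basis if_distrib sum.delta cong: if_cong)

lemma inner_grad: "y \<bullet> grad f x = (\<Sum>i\<in>Basis. (y \<bullet> i) * pd f i x)"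
  by (simp add: grad_def inner_sum_right mult.commute)

lemma test_smooth: "\<phi> \<in> test_functions \<Longrightarrow> smooth \<phi>"
  by (simp add: test_functions_def smooth_def)

text \<open>Lets one bad test function be added to an arbitrary one in
  \<open>weak_eq_intro\<close>.\<close>

lemma test_add:
  assumes "\<phi> \<in> test_functions" "\<psi> \<in> test_functions"
  shows "(\<lambda>x. \<phi> x + \<psi> x) \<in> test_functions"
proof -
  have "{x. \<phi> x + \<psi> x \<noteq> 0} \<subseteq> closure {x. \<phi> x \<noteq> 0} \<union> closure {x. \<psi> x \<noteq> 0}"
  proof -
    have "{x. \<phi> x + \<psi> x \<noteq> 0} \<subseteq> {x. \<phi> x \<noteq> 0} \<union> {x. \<psi> x \<noteq> 0}" by auto
    also have "\<dots> \<subseteq> closure {x. \<phi> x \<noteq> 0} \<union> closure {x. \<psi> x \<noteq> 0}"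
      by (rule Un_mono[OF closure_subset closure_subset])
    finally show ?thesis .
  qed
  moreover have "compact (closure {x. \<phi> x \<noteq> 0} \<union> closure {x. \<psi> x \<noteq> 0})"
    using assms by (intro compact_Un) (auto simp: test_functions_def)
  ultimately have "compact (closure {x. \<phi> x + \<psi> x \<noteq> 0})"
    unfolding compact_closure[of "{x. \<phi> x + \<psi> x \<noteq> 0}"] using bounded_subset compact_imp_bounded by blast
  moreover have "smooth (\<lambda>x. \<phi> x + \<psi> x)"
    using assms by (intro smooth_add test_smooth)
  ultimately show ?thesis by (simp add: test_functions_def smooth_def)
qed

lemma pd_add: "smooth f \<Longrightarrow> smooth g \<Longrightarrow> pd (\<lambda>x. f x + g x) i x = pd f i x + pd g i x"
  by (rule pd_eqI[OF has_derivative_add[OF smooth_has_derivative smooth_has_derivative]])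

lemma integrable_compact_support_sq:
  fixes f :: "'a::euclidean_space \<Rightarrow> real"
  assumes "compact K" "continuous_on UNIV f" "\<And>x. x \<notin> K \<Longrightarrow> f x = 0"
  shows "integrable lborel (\<lambda>x. (f x)\<^sup>2)"
proof -
  have "integrable lborel (\<lambda>x. indicator K x *\<^sub>R (f x)\<^sup>2)"
    using assms by (intro borel_integrable_compact) (auto intro!: continuous_intros intro: continuous_on_subset)
  moreover have "indicator K x *\<^sub>R (f x)\<^sup>2 = (f x)\<^sup>2" for x
    using assms(3)[of x] by (auto split: split_indicator)
  ultimately show ?thesis by (simp only:)
qed

lemma test_integrable_sq:
  assumes "\<phi> \<in> test_functions"
  shows "integrable lborel (\<lambda>x. (\<phi> x)\<^sup>2)"
    and "i \<in> Basis \<Longrightarrow> integrable lborel (\<lambda>x. (pd \<phi> i x)\<^sup>2)"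
proof -
  define K where "K = closure {x. \<phi> x \<noteq> 0}"
  have K: "compact K" using assms by (simp add: test_functions_def K_def)
  have sm: "smooth \<phi>" using assms by (rule test_smooth)
  have 0: "\<phi> x = 0" if "x \<notin> K" for x
    using that closure_subset[of "{x. \<phi> x \<noteq> 0}"] unfolding K_def by blast
  show "integrable lborel (\<lambda>x. (\<phi> x)\<^sup>2)"
    by (rule integrable_compact_support_sq[OF K smooth_continuous[OF sm] 0])
  show "integrable lborel (\<lambda>x. (pd \<phi> i x)\<^sup>2)" if i: "i \<in> Basis"
  proof (rule integrable_compact_support_sq[OF K smooth_continuous[OF smooth_pd[OF sm i]]])
    fix x assume x: "x \<notin> K"
    have "(\<phi> has_derivative (\<lambda>_. 0)) (at x)"
    proof (rule has_derivative_transform_within_open[of "\<lambda>_. 0" _ _ _ "- K"])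
      show "open (- K)" using K by (auto intro: compact_imp_closed)
      show "x \<in> - K" using x by simp
      show "0 = \<phi> y" if "y \<in> - K" for y using 0[of y] that by simp
    qed simp
    then show "pd \<phi> i x = 0" by (rule pd_eqI)
  qed
qed

lemma integrable_mult_test:
  fixes f :: "'a::euclidean_space \<Rightarrow> real"
  assumes "f \<in> borel_measurable borel" "integrable lborel (\<lambda>x. (f x)\<^sup>2)" "\<phi> \<in> test_functions"
  shows "integrable lborel (\<lambda>x. f x * \<phi> x)"
    and "i \<in> Basis \<Longrightarrow> integrable lborel (\<lambda>x. f x * pd \<phi> i x)"
proof -
  have sm: "smooth \<phi>" by (rule test_smooth[OF assms(3)])
  show "integrable lborel (\<lambda>x. f x * \<phi> x)"
    using assms smooth_measurable[OF sm]
    by (intro integrable_mult_of_squares test_integrable_sq(1)[OF assms(3)]) auto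
  show "integrable lborel (\<lambda>x. f x * pd \<phi> i x)" if "i \<in> Basis"
    using assms smooth_measurable[OF smooth_pd[OF sm that]] that
    by (intro integrable_mult_of_squares test_integrable_sq(2)[OF assms(3)]) auto
qed

text \<open>The Bochner integral of a non-integrable function is \<open>0\<close>. If \<open>h * \<phi>\<close> were not integrable for
  a single test function, adding that function to an arbitrary one would show that the left-hand
  side of the weak equation vanishes identically, so that \<open>u\<close> would solve the equation with
  right-hand side \<open>0\<close> and hence vanish.\<close>

lemma weak_eq_intro:
  fixes h u :: "real^3 \<Rightarrow> real" and G :: "real^3 \<Rightarrow> real^3"
  assumes lam: "lam > 0"
    and meas [measurable]: "h \<in> borel_measurable borel" "u \<in> borel_measurable borel" "G \<in> borel_measurable borel"
    and u2: "integrable lborel (\<lambda>x. (u x)\<^sup>2)" and G2: "integrable lborel (\<lambda>x. (norm (G x))\<^sup>2)"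
    and pos: "\<And>x. u x > 0" "\<And>x. h x \<ge> 0"
    and wg: "\<And>\<phi> i. \<phi> \<in> test_functions \<Longrightarrow> i \<in> Basis \<Longrightarrow>
      (LINT x|lborel. u x * pd \<phi> i x) = - (LINT x|lborel. \<phi> x * (G x \<bullet> i))"
    and wf: "\<And>\<phi>. \<phi> \<in> test_functions \<Longrightarrow>
      (\<Sum>i\<in>Basis. LINT x|lborel. (G x \<bullet> i) * pd \<phi> i x) + lam * (LINT x|lborel. u x * \<phi> x)
        = (LINT x|lborel. h x * \<phi> x)"
  shows "weak_eq lam h u G"
proof (cases "\<forall>\<phi>\<in>test_functions. integrable lborel (\<lambda>x. h x * \<phi> x)")
  case True
  then show ?thesis
    by unfold_locales (use assms in auto)
next
  case False
  then obtain \<phi>0 where \<phi>0: "\<phi>0 \<in> test_functions" "\<not> integrable lborel (\<lambda>x. h x * \<phi>0 x)" by blast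
  define A where "A \<phi> = (\<Sum>i\<in>Basis. LINT x|lborel. (G x \<bullet> i) * pd \<phi> i x) + lam * (LINT x|lborel. u x * \<phi> x)" for \<phi>
  have A_add: "A (\<lambda>x. \<phi> x + \<psi> x) = A \<phi> + A \<psi>" if "\<phi> \<in> test_functions" "\<psi> \<in> test_functions" for \<phi> \<psi>
  proof -
    have "(LINT x|lborel. (G x \<bullet> i) * pd (\<lambda>x. \<phi> x + \<psi> x) i x) = (LINT x|lborel. (G x \<bullet> i) * pd \<phi> i x) + (LINT x|lborel. (G x \<bullet> i) * pd \<psi> i x)"
      if i: "i \<in> Basis" for i
      using integrable_mult_test(2)[OF _ integrable_component_sq[OF meas(3) G2 i] \<open>\<phi> \<in> test_functions\<close> i]
        integrable_mult_test(2)[OF _ integrable_component_sq[OF meas(3) G2 i] \<open>\<psi> \<in> test_functions\<close> i]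
      by (simp add: pd_add[OF test_smooth test_smooth] \<open>\<phi> \<in> test_functions\<close> \<open>\<psi> \<in> test_functions\<close> distrib_left)
    moreover have "(LINT x|lborel. u x * (\<phi> x + \<psi> x)) = (LINT x|lborel. u x * \<phi> x) + (LINT x|lborel. u x * \<psi> x)"
      using that by (simp add: distrib_left integrable_mult_test u2)
    ultimately show ?thesis by (simp add: A_def sum.distrib distrib_left)
  qed
  have A_nonint: "A \<phi> = 0" if "\<phi> \<in> test_functions" "\<not> integrable lborel (\<lambda>x. h x * \<phi> x)" for \<phi>
    using wf[OF that(1)] not_integrable_integral_eq[OF that(2)] by (simp add: A_def)
  have A0: "A \<phi> = 0" if \<phi>: "\<phi> \<in> test_functions" for \<phi>
  proof (cases "integrable lborel (\<lambda>x. h x * \<phi> x)")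
    case True
    have "\<not> integrable lborel (\<lambda>x. h x * (\<phi>0 x + \<phi> x))"
    proof
      assume "integrable lborel (\<lambda>x. h x * (\<phi>0 x + \<phi> x))"
      from Bochner_Integration.integrable_diff[OF this True] show False
        using \<phi>0(2) by (simp add: algebra_simps)
    qed
    then have "A (\<lambda>x. \<phi>0 x + \<phi> x) = 0"
      by (rule A_nonint[OF test_add[OF \<phi>0(1) \<phi>]])
    then show ?thesis using A_add[OF \<phi>0(1) \<phi>] A_nonint[OF \<phi>0] by simp
  qed (rule A_nonint[OF \<phi>])
  have "weak_eq lam (\<lambda>_. 0) u G"
    by unfold_locales (use assms A0[unfolded A_def] in auto)
  from weak_eq.representation[OF this lam]
  have "AE x in lborel. ennreal (u x) = 0"
    by (simp add: resolvent_def heat_op_def)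
  then have "AE x in (lborel :: (real^3) measure). False"
  proof eventually_elim
    case (elim x)
    then show ?case using pos(1)[of x] by simp
  qed
  then show ?thesis by (simp add: AE_iff_null null_sets_def)
qed

section \<open>Consequences of one equation: larger parameters and the cubic supersolution\<close>

context weak_eq
begin

text \<open>Moving a nonnegative multiple of u to the right-hand side lets both equations be
  represented by the same resolvent, and the first one also at the finer scale 1 / sqrt M.\<close>

lemma shift_parameter:
  assumes "L \<ge> lam"
  shows "weak_eq L (\<lambda>x. h x + (L - lam) * u x) u G"
proof
  fix \<phi> :: "real^3 \<Rightarrow> real" assume \<phi>: "\<phi> \<in> test_functions"
  have uphi: "integrable lborel (\<lambda>x. u x * \<phi> x)"
    by (rule integrable_mult_test[OF u_borel u_sq \<phi>])
  have e: "(h x + (L - lam) * u x) * \<phi> x = h x * \<phi> x + (L - lam) * (u x * \<phi> x)" for x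
    by (simp add: algebra_simps)
  show "integrable lborel (\<lambda>x. (h x + (L - lam) * u x) * \<phi> x)"
    unfolding e by (intro Bochner_Integration.integrable_add h_test \<phi> integrable_mult_right uphi)
  show "(\<Sum>i\<in>Basis. LINT x|lborel. (G x \<bullet> i) * pd \<phi> i x) + L * (LINT x|lborel. u x * \<phi> x)
    = (LINT x|lborel. (h x + (L - lam) * u x) * \<phi> x)"
    unfolding e using weak_form[OF \<phi>] h_test[OF \<phi>] uphi by (simp add: algebra_simps)
qed (use assms u_sq G_sq u_pos h_nonneg weak_grad in \<open>auto simp: less_imp_le\<close>)

text \<open>The right-hand side dominates the cube, and the resolvent decreases when its parameter
  grows; so the inequality is available at every scale finer than that of the equation.\<close>

lemma cube_supersolution:
  assumes "lam > 0" "L \<ge> lam" and le: "\<And>x. \<mu> * u x ^ 3 \<le> h x"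
  shows "AE x in lborel. resolvent L (\<lambda>y. ennreal (\<mu> * u y ^ 3)) x \<le> ennreal (u x)"
  using representation[OF \<open>lam > 0\<close>]
proof eventually_elim
  case (elim x)
  have "resolvent L (\<lambda>y. ennreal (\<mu> * u y ^ 3)) x \<le> resolvent lam (\<lambda>y. ennreal (\<mu> * u y ^ 3)) x"
    by (intro resolvent_antimono assms) measurable
  also have "\<dots> \<le> resolvent lam (\<lambda>y. ennreal (h y)) x"
    by (simp add: resolvent_kern) (intro nn_integral_mono mult_left_mono ennreal_leI le, simp)
  finally show ?case using elim by simp
qed

text \<open>The Gaussian at time 1 is bounded below on the ball, and h is integrable against
  it.\<close>

lemma cube_locally_finite:
  assumes \<mu>: "\<mu> > 0" and le: "\<And>x. \<mu> * u x ^ 3 \<le> h x"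
  shows "(\<integral>\<^sup>+y. ennreal (u y ^ 3) * indicator (ball x r) y \<partial>lborel) < \<infinity>"
proof -
  define c where "c = exp (- (r\<^sup>2 / 4)) / gauss_mass"
  have c: "c > 0" using gauss_mass_pos by (simp add: c_def)
  have "(\<integral>\<^sup>+y. ennreal (u y ^ 3) * indicator (ball x r) y \<partial>lborel) \<le> (\<integral>\<^sup>+y. ennreal (1 / (\<mu> * c)) * ennreal (h y * heat 1 (y - x)) \<partial>lborel)"
  proof (rule nn_integral_mono)
    fix y
    show "ennreal (u y ^ 3) * indicator (ball x r) y \<le> ennreal (1 / (\<mu> * c)) * ennreal (h y * heat 1 (y - x))"
    proof (cases "y \<in> ball x r")
      case True
      then have "norm (y - x) \<le> r" by (simp add: dist_norm norm_minus_commute)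
      then have "(norm (y - x))\<^sup>2 \<le> r\<^sup>2" by (intro power_mono) auto
      then have "c \<le> heat 1 (y - x)"
        using gauss_mass_pos by (simp add: c_def heat_def divide_right_mono)
      then have "\<mu> * u y ^ 3 * c \<le> h y * heat 1 (y - x)"
        using le[of y] c h_nonneg[of y] by (intro mult_mono) auto
      then have "u y ^ 3 \<le> 1 / (\<mu> * c) * (h y * heat 1 (y - x))"
        using \<mu> c by (simp add: field_simps)
      then have "ennreal (u y ^ 3) \<le> ennreal (1 / (\<mu> * c) * (h y * heat 1 (y - x)))"
        by (rule ennreal_leI)
      also have "\<dots> = ennreal (1 / (\<mu> * c)) * ennreal (h y * heat 1 (y - x))"
        by (rule ennreal_mult') (use \<mu> c in simp)
      finally show ?thesis using True by simp
    qed simp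
  qed
  also have "\<dots> = ennreal (1 / (\<mu> * c)) * (\<integral>\<^sup>+y. ennreal (h y * heat 1 (y - x)) \<partial>lborel)"
    by (rule nn_integral_cmult) measurable
  also have "(\<integral>\<^sup>+y. ennreal (h y * heat 1 (y - x)) \<partial>lborel) < \<infinity>"
    using heat_weak_form(1)[of 1 x] h_nonneg by (simp add: integrable_iff_bounded)
  then have "ennreal (1 / (\<mu> * c)) * (\<integral>\<^sup>+y. ennreal (h y * heat 1 (y - x)) \<partial>lborel) < \<infinity>"
    by (simp add: ennreal_mult_less_top)
  finally show ?thesis .
qed

end

text \<open>With p, q, s the integrals of u^4, u^2 v^2 and u^2, the facts \<open>e1\<close>,
  \<open>e2\<close>, \<open>e3\<close> are linear inequalities obtained from
  \<open>potential_form_bound\<close> for three choices of potential and weight. They become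
  incompatible once lam1 / lam2 is large.\<close>

lemma no_coupled_pair:
  fixes \<mu>1 \<mu>2 \<beta> :: real
  assumes \<mu>: "\<mu>1 > 0" "\<mu>2 > 0" and \<beta>: "\<beta> \<ge> \<mu>1"
  obtains \<eta> where "\<eta> > 0"
    "\<And>lam1 lam2 u v G1 G2. lam1 > 0 \<Longrightarrow> lam2 > 0 \<Longrightarrow> lam1 / lam2 > \<eta> \<Longrightarrow>
      weak_eq lam1 (\<lambda>x. \<mu>1 * u x ^ 3 + \<beta> * u x * (v x)\<^sup>2) u G1 \<Longrightarrow>
      weak_eq lam2 (\<lambda>x. \<mu>2 * v x ^ 3 + \<beta> * v x * (u x)\<^sup>2) v G2 \<Longrightarrow> False"
proof -
  have b: "\<beta> > 0" using \<mu> \<beta> by simp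
  \<comment> \<open>Turns \<open>e3\<close> into a bound of \<mu>1 p by a quarter of X + (M - lam1)
    s.\<close>
  define \<delta>' where "\<delta>' = 1 / (4 * \<mu>1)"
  have \<delta>': "\<delta>' > 0" using \<mu> by (simp add: \<delta>'_def)
  obtain \<epsilon>' where \<epsilon>': "\<epsilon>' > 0" and sq': "\<And>L w. L > 0 \<Longrightarrow> w \<in> borel_measurable borel \<Longrightarrow> (\<And>x. w x > 0) \<Longrightarrow>
      (\<And>x. (\<integral>\<^sup>+y. ennreal (w y ^ 3) * indicator (ball x (1 / sqrt L)) y \<partial>lborel) \<le> ennreal \<epsilon>') \<Longrightarrow>
      (AE x in lborel. resolvent L (\<lambda>y. ennreal (\<mu>1 * w y ^ 3)) x \<le> ennreal (w x)) \<Longrightarrow>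
      (AE x in lborel. resolvent L (\<lambda>y. ennreal ((w y)\<^sup>2 * (sqrt (w y) + sqrt (sqrt L)))) x
        \<le> ennreal (\<delta>' * (sqrt (w x) + sqrt (sqrt L))))"
    using square_potential_supersolution[OF \<mu>(1) \<delta>'] by blast
  obtain d' where d': "d' > 0" "d' \<le> 1" and small': "\<And>L w x. L > 0 \<Longrightarrow> w \<in> borel_measurable borel \<Longrightarrow> (\<And>x. w x > 0) \<Longrightarrow>
      (AE x in lborel. resolvent L (\<lambda>y. ennreal (\<mu>1 * w y ^ 3)) x \<le> ennreal (w x)) \<Longrightarrow>
      (\<And>r. (\<integral>\<^sup>+y. ennreal (w y ^ 3) * indicator (ball x r) y \<partial>lborel) < \<infinity>) \<Longrightarrow>
      (\<integral>\<^sup>+y. ennreal (w y ^ 3) * indicator (ball x (d' / sqrt L)) y \<partial>lborel) \<le> ennreal \<epsilon>'"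
    using cube_mass_small[OF \<mu>(1) \<epsilon>'] by blast
  \<comment> \<open>With M = A lam1 the radius 1 / sqrt M is d' / sqrt lam1, where
    \<open>cube_mass_small\<close> makes the mass of u small.\<close>
  define A where "A = 1 / d'\<^sup>2"
  have A: "A \<ge> 1" using d' by (simp add: A_def power_le_one)
  \<comment> \<open>The factor A compensates for the bound X \<le> M s / 2 below, whose right-hand
    side is A lam1 s / 2.\<close>
  define \<delta> where "\<delta> = 1 / (4 * \<beta> * A)"
  have \<delta>: "\<delta> > 0" using b A by (simp add: \<delta>_def)
  obtain \<epsilon> where \<epsilon>: "\<epsilon> > 0" and sq: "\<And>L w. L > 0 \<Longrightarrow> w \<in> borel_measurable borel \<Longrightarrow> (\<And>x. w x > 0) \<Longrightarrow>
      (\<And>x. (\<integral>\<^sup>+y. ennreal (w y ^ 3) * indicator (ball x (1 / sqrt L)) y \<partial>lborel) \<le> ennreal \<epsilon>) \<Longrightarrow>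
      (AE x in lborel. resolvent L (\<lambda>y. ennreal (\<mu>2 * w y ^ 3)) x \<le> ennreal (w x)) \<Longrightarrow>
      (AE x in lborel. resolvent L (\<lambda>y. ennreal ((w y)\<^sup>2 * (sqrt (w y) + sqrt (sqrt L)))) x
        \<le> ennreal (\<delta> * (sqrt (w x) + sqrt (sqrt L))))"
    using square_potential_supersolution[OF \<mu>(2) \<delta>] by blast
  obtain d where d: "d > 0" "d \<le> 1" and small: "\<And>L w x. L > 0 \<Longrightarrow> w \<in> borel_measurable borel \<Longrightarrow> (\<And>x. w x > 0) \<Longrightarrow>
      (AE x in lborel. resolvent L (\<lambda>y. ennreal (\<mu>2 * w y ^ 3)) x \<le> ennreal (w x)) \<Longrightarrow>
      (\<And>r. (\<integral>\<^sup>+y. ennreal (w y ^ 3) * indicator (ball x r) y \<partial>lborel) < \<infinity>) \<Longrightarrow>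
      (\<integral>\<^sup>+y. ennreal (w y ^ 3) * indicator (ball x (d / sqrt L)) y \<partial>lborel) \<le> ennreal \<epsilon>"
    using cube_mass_small[OF \<mu>(2) \<epsilon>] by blast
  show ?thesis
  \<comment> \<open>The square of d places the ball of radius 1 / sqrt lam1 inside that of radius d
    / sqrt lam2, where v has small mass; with d \<le> 1 the factor 2 gives lam1 > 2 lam2.\<close>
  proof (rule that[of "2 / d\<^sup>2"])
    show "2 / d\<^sup>2 > 0" using d by simp
    fix lam1 lam2 u v G1 G2
    assume lam: "lam1 > 0" "lam2 > 0" and ratio: "lam1 / lam2 > 2 / d\<^sup>2"
      and eq1: "weak_eq lam1 (\<lambda>x. \<mu>1 * u x ^ 3 + \<beta> * u x * (v x)\<^sup>2) u G1"
      and eq2: "weak_eq lam2 (\<lambda>x. \<mu>2 * v x ^ 3 + \<beta> * v x * (u x)\<^sup>2) v G2"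
    interpret U: weak_eq lam1 "\<lambda>x. \<mu>1 * u x ^ 3 + \<beta> * u x * (v x)\<^sup>2" u G1 by (rule eq1)
    interpret V: weak_eq lam2 "\<lambda>x. \<mu>2 * v x ^ 3 + \<beta> * v x * (u x)\<^sup>2" v G2 by (rule eq2)
    note [measurable] = U.u_borel V.u_borel
    have u: "u x > 0" for x by (rule U.u_pos)
    have v: "v x > 0" for x by (rule V.u_pos)
    have d2: "lam1 * d\<^sup>2 > 2 * lam2" using ratio lam d by (simp add: field_simps)
    have "lam1 * d\<^sup>2 \<le> lam1 * 1" using d lam by (intro mult_left_mono power_le_one) auto
    then have lam12: "lam1 > 2 * lam2" using d2 by linarith
    define M where "M = A * lam1"
    have M: "M > 0" "M \<ge> lam1" using A lam by (auto simp: M_def)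
    have sM: "1 / sqrt M = d' / sqrt lam1"
      using d' lam by (simp add: M_def A_def real_sqrt_mult real_sqrt_divide)
    have leU: "\<mu>1 * u x ^ 3 \<le> \<mu>1 * u x ^ 3 + \<beta> * u x * (v x)\<^sup>2" for x
      using b u[of x] by simp
    have leV: "\<mu>2 * v x ^ 3 \<le> \<mu>2 * v x ^ 3 + \<beta> * v x * (u x)\<^sup>2" for x
      using b v[of x] by simp
    let ?P = "\<integral>\<^sup>+x. ennreal (u x ^ 4) \<partial>lborel"
    let ?Q = "\<integral>\<^sup>+x. ennreal ((u x)\<^sup>2 * (v x)\<^sup>2) \<partial>lborel"
    let ?S = "\<integral>\<^sup>+x. ennreal ((u x)\<^sup>2) \<partial>lborel"
    have S: "?S < \<infinity>" using U.u_sq by (simp add: integrable_iff_bounded)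
    have comb: "(\<integral>\<^sup>+x. ennreal (a * u x ^ 4 + c * ((u x)\<^sup>2 * (v x)\<^sup>2) + e * (u x)\<^sup>2) \<partial>lborel)
      = ennreal a * ?P + ennreal c * ?Q + ennreal e * ?S" if "a \<ge> 0" "c \<ge> 0" "e \<ge> 0" for a c e
    proof -
      have "(\<integral>\<^sup>+x. ennreal (a * u x ^ 4 + c * ((u x)\<^sup>2 * (v x)\<^sup>2) + e * (u x)\<^sup>2) \<partial>lborel)
        = (\<integral>\<^sup>+x. ennreal a * ennreal (u x ^ 4) + ennreal c * ennreal ((u x)\<^sup>2 * (v x)\<^sup>2) + ennreal e * ennreal ((u x)\<^sup>2) \<partial>lborel)"
        using that by (intro nn_integral_cong) (simp add: ennreal_mult'[symmetric] ennreal_plus[symmetric] del: ennreal_plus)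
      also have "\<dots> = ennreal a * ?P + ennreal c * ?Q + ennreal e * ?S"
        by (simp add: nn_integral_add nn_integral_cmult)
      finally show ?thesis .
    qed
    have energy: "ennreal \<mu>1 * ?P + ennreal \<beta> * ?Q < \<infinity>"
    proof -
      have "(\<integral>\<^sup>+x. ennreal (\<mu>1 * u x ^ 3 + \<beta> * u x * (v x)\<^sup>2) * ennreal (u x) \<partial>lborel)
        = (\<integral>\<^sup>+x. ennreal (\<mu>1 * u x ^ 4 + \<beta> * ((u x)\<^sup>2 * (v x)\<^sup>2) + 0 * (u x)\<^sup>2) \<partial>lborel)"
        by (simp only: ennreal_mult''[symmetric, OF less_imp_le[OF u]])
           (simp add: algebra_simps power2_eq_square power3_eq_cube power4_eq_xxxx)
      also have "\<dots> = ennreal \<mu>1 * ?P + ennreal \<beta> * ?Q + ennreal 0 * ?S"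
        using \<mu> b by (intro comb) auto
      finally show ?thesis using U.energy_finite[OF lam(1)] by simp
    qed
    then have PQ: "?P < \<infinity>" "?Q < \<infinity>"
      using \<mu> b by (auto simp: ennreal_mult_less_top ennreal_add_eq_top less_top)
    define p where "p = enn2real ?P"
    define q where "q = enn2real ?Q"
    define s where "s = enn2real ?S"
    have pqs: "?P = ennreal p" "?Q = ennreal q" "?S = ennreal s" "p \<ge> 0" "q \<ge> 0" "s \<ge> 0"
      using PQ S by (simp_all add: p_def q_def s_def)
    have s: "s > 0"
    proof (rule ccontr)
      assume "\<not> s > 0"
      then have "?S = 0" using pqs by (simp add: ennreal_neg)
      then have "AE x in lborel. ennreal ((u x)\<^sup>2) = 0"
        by (subst (asm) nn_integral_0_iff_AE) auto
      then have "AE x in (lborel :: (real^3) measure). False"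
      proof eventually_elim
        case (elim x)
        then show ?case using u[of x] by simp
      qed
      then show False by (simp add: AE_iff_null null_sets_def)
    qed
    have real_comb: "(\<integral>\<^sup>+x. ennreal (a * u x ^ 4 + c * ((u x)\<^sup>2 * (v x)\<^sup>2) + e * (u x)\<^sup>2) \<partial>lborel) = ennreal (a * p + c * q + e * s)"
      if "a \<ge> 0" "c \<ge> 0" "e \<ge> 0" for a c e
      using that pqs(4-6) by (simp add: comb pqs(1-3) ennreal_mult'[symmetric] ennreal_plus[symmetric] del: ennreal_plus)
    have repU: "AE x in lborel. ennreal (u x) = resolvent lam1 (\<lambda>y. ennreal (\<mu>1 * u y ^ 3 + \<beta> * u y * (v y)\<^sup>2)) x"
      by (rule U.representation[OF lam(1)])
    have posU: "0 \<le> \<mu>1 * u x ^ 3 + \<beta> * u x * (v x)\<^sup>2" for x by (rule U.h_nonneg)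
    \<comment> \<open>The weight v solves the second equation shifted to the parameter lam1, so lam1
      - lam2 joins the potential; its supersolution inequality is an equality, whence \<delta> =
      1.\<close>
    have e1: "\<beta> * p + \<mu>2 * q + (lam1 - lam2) * s \<le> \<mu>1 * p + \<beta> * q"
    proof -
      interpret V1: weak_eq lam1 "\<lambda>x. \<mu>2 * v x ^ 3 + \<beta> * v x * (u x)\<^sup>2 + (lam1 - lam2) * v x" v G2
        by (rule V.shift_parameter) (use lam12 lam in simp)
      have "(\<integral>\<^sup>+x. ennreal ((\<mu>2 * (v x)\<^sup>2 + \<beta> * (u x)\<^sup>2 + (lam1 - lam2)) * (u x)\<^sup>2) \<partial>lborel)
        \<le> ennreal 1 * (\<integral>\<^sup>+x. ennreal ((\<mu>1 * u x ^ 3 + \<beta> * u x * (v x)\<^sup>2) * u x) \<partial>lborel)"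
      proof (rule potential_form_bound[where g = v and L = lam1])
        show "AE x in lborel. resolvent lam1 (\<lambda>y. ennreal ((\<mu>2 * (v y)\<^sup>2 + \<beta> * (u y)\<^sup>2 + (lam1 - lam2)) * v y)) x \<le> ennreal (1 * v x)"
          using V1.representation[OF lam(1)]
          by eventually_elim (simp add: algebra_simps power2_eq_square power3_eq_cube)
        show "0 \<le> \<mu>2 * (v x)\<^sup>2 + \<beta> * (u x)\<^sup>2 + (lam1 - lam2)" for x
          using \<mu> b lam12 lam by simp
      qed (use repU S posU u v in \<open>auto simp: less_imp_le\<close>)
      also have "(\<integral>\<^sup>+x. ennreal ((\<mu>1 * u x ^ 3 + \<beta> * u x * (v x)\<^sup>2) * u x) \<partial>lborel) = (\<integral>\<^sup>+x. ennreal (\<mu>1 * u x ^ 4 + \<beta> * ((u x)\<^sup>2 * (v x)\<^sup>2) + 0 * (u x)\<^sup>2) \<partial>lborel)"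
        by (simp add: algebra_simps power2_eq_square power3_eq_cube power4_eq_xxxx)
      also have "\<dots> = ennreal (\<mu>1 * p + \<beta> * q + 0 * s)"
        using \<mu> b by (intro real_comb) auto
      also have "(\<integral>\<^sup>+x. ennreal ((\<mu>2 * (v x)\<^sup>2 + \<beta> * (u x)\<^sup>2 + (lam1 - lam2)) * (u x)\<^sup>2) \<partial>lborel)
        = (\<integral>\<^sup>+x. ennreal (\<beta> * u x ^ 4 + \<mu>2 * ((u x)\<^sup>2 * (v x)\<^sup>2) + (lam1 - lam2) * (u x)\<^sup>2) \<partial>lborel)"
        by (simp add: algebra_simps power2_eq_square power4_eq_xxxx)
      also have "\<dots> = ennreal (\<beta> * p + \<mu>2 * q + (lam1 - lam2) * s)"
        using \<mu> b lam12 lam by (intro real_comb) auto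
      finally have "ennreal (\<beta> * p + \<mu>2 * q + (lam1 - lam2) * s) \<le> ennreal (\<mu>1 * p + \<beta> * q)"
        by (simp only: ennreal_1 mult_1_left mult_zero_left add_0_right)
      then show ?thesis
        using \<mu> b pqs(4,5) by (simp only: ennreal_le_iff add_nonneg_nonneg mult_nonneg_nonneg less_imp_le)
    qed
    \<comment> \<open>The potential is v^2 alone; the ratio condition supplies the small mass of v
      at the scale 1 / sqrt lam1.\<close>
    have e2: "q \<le> \<delta> * (\<mu>1 * p + \<beta> * q)"
    proof -
      have le1: "1 / sqrt lam1 \<le> d / sqrt lam2"
      proof -
        have "lam2 \<le> lam1 * d\<^sup>2" using d2 lam by linarith
        then have "sqrt lam2 \<le> sqrt (lam1 * d\<^sup>2)" by simp
        then have "sqrt lam2 \<le> sqrt lam1 * d" using d by (simp add: real_sqrt_mult)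
        then show ?thesis using lam by (simp add: field_simps)
      qed
      have "AE x in lborel. resolvent lam1 (\<lambda>y. ennreal ((v y)\<^sup>2 * (sqrt (v y) + sqrt (sqrt lam1)))) x
          \<le> ennreal (\<delta> * (sqrt (v x) + sqrt (sqrt lam1)))"
      proof (rule sq[OF lam(1) V.u_borel v])
        fix x
        have "(\<integral>\<^sup>+y. ennreal (v y ^ 3) * indicator (ball x (1 / sqrt lam1)) y \<partial>lborel) \<le> (\<integral>\<^sup>+y. ennreal (v y ^ 3) * indicator (ball x (d / sqrt lam2)) y \<partial>lborel)"
          using le1 by (intro nn_integral_mono mult_left_mono) (auto split: split_indicator)
        also have "\<dots> \<le> ennreal \<epsilon>"
          by (rule small[OF lam(2) V.u_borel v V.cube_supersolution[OF lam(2) order_refl leV] V.cube_locally_finite[OF \<mu>(2) leV]])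
        finally show "(\<integral>\<^sup>+y. ennreal (v y ^ 3) * indicator (ball x (1 / sqrt lam1)) y \<partial>lborel) \<le> ennreal \<epsilon>" .
      next
        show "AE x in lborel. resolvent lam1 (\<lambda>y. ennreal (\<mu>2 * v y ^ 3)) x \<le> ennreal (v x)"
          by (rule V.cube_supersolution[OF lam(2) _ leV]) (use lam12 lam in simp)
      qed
      then have "(\<integral>\<^sup>+x. ennreal ((v x)\<^sup>2 * (u x)\<^sup>2) \<partial>lborel)
        \<le> ennreal \<delta> * (\<integral>\<^sup>+x. ennreal ((\<mu>1 * u x ^ 3 + \<beta> * u x * (v x)\<^sup>2) * u x) \<partial>lborel)"
        using repU S posU u v lam \<delta>
        by (intro potential_form_bound[where g = "\<lambda>x. sqrt (v x) + sqrt (sqrt lam1)" and L = lam1])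
           (auto simp: less_imp_le intro: add_pos_pos)
      also have "(\<integral>\<^sup>+x. ennreal ((\<mu>1 * u x ^ 3 + \<beta> * u x * (v x)\<^sup>2) * u x) \<partial>lborel) = (\<integral>\<^sup>+x. ennreal (\<mu>1 * u x ^ 4 + \<beta> * ((u x)\<^sup>2 * (v x)\<^sup>2) + 0 * (u x)\<^sup>2) \<partial>lborel)"
        by (simp add: algebra_simps power2_eq_square power3_eq_cube power4_eq_xxxx)
      also have "\<dots> = ennreal (\<mu>1 * p + \<beta> * q + 0 * s)"
        using \<mu> b by (intro real_comb) auto
      also have "(\<integral>\<^sup>+x. ennreal ((v x)\<^sup>2 * (u x)\<^sup>2) \<partial>lborel) = ennreal q"
        by (simp add: pqs(2)[symmetric] mult.commute)
      finally have "ennreal q \<le> ennreal (\<delta> * (\<mu>1 * p + \<beta> * q))"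
        using \<delta> by (simp only: ennreal_mult'[OF less_imp_le] mult_zero_left add_0_right)
      then show ?thesis
        using \<mu> b \<delta> pqs(4,5) by (simp only: ennreal_le_iff add_nonneg_nonneg mult_nonneg_nonneg less_imp_le)
    qed
    \<comment> \<open>For the potential u^2 the parameter has to be raised to M, and the added term
      (M - lam1) u reappears as (M - lam1) s.\<close>
    have e3: "p \<le> \<delta>' * (\<mu>1 * p + \<beta> * q + (M - lam1) * s)"
    proof -
      interpret U1: weak_eq M "\<lambda>x. \<mu>1 * u x ^ 3 + \<beta> * u x * (v x)\<^sup>2 + (M - lam1) * u x" u G1
        by (rule U.shift_parameter) (rule M)
      have "AE x in lborel. resolvent M (\<lambda>y. ennreal ((u y)\<^sup>2 * (sqrt (u y) + sqrt (sqrt M)))) x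
          \<le> ennreal (\<delta>' * (sqrt (u x) + sqrt (sqrt M)))"
      proof (rule sq'[OF M(1) U.u_borel u])
        show "(\<integral>\<^sup>+y. ennreal (u y ^ 3) * indicator (ball x (1 / sqrt M)) y \<partial>lborel) \<le> ennreal \<epsilon>'" for x
          unfolding sM
          by (rule small'[OF lam(1) U.u_borel u U.cube_supersolution[OF lam(1) order_refl leU] U.cube_locally_finite[OF \<mu>(1) leU]])
        show "AE x in lborel. resolvent M (\<lambda>y. ennreal (\<mu>1 * u y ^ 3)) x \<le> ennreal (u x)"
          by (rule U.cube_supersolution[OF lam(1) M(2) leU])
      qed
      then have "(\<integral>\<^sup>+x. ennreal ((u x)\<^sup>2 * (u x)\<^sup>2) \<partial>lborel)
        \<le> ennreal \<delta>' * (\<integral>\<^sup>+x. ennreal ((\<mu>1 * u x ^ 3 + \<beta> * u x * (v x)\<^sup>2 + (M - lam1) * u x) * u x) \<partial>lborel)"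
        using U1.representation[OF M(1)] U1.h_nonneg S u M \<delta>'
        by (intro potential_form_bound[where g = "\<lambda>x. sqrt (u x) + sqrt (sqrt M)" and L = M])
           (auto simp: less_imp_le intro: add_pos_pos)
      also have "(\<integral>\<^sup>+x. ennreal ((\<mu>1 * u x ^ 3 + \<beta> * u x * (v x)\<^sup>2 + (M - lam1) * u x) * u x) \<partial>lborel) = (\<integral>\<^sup>+x. ennreal (\<mu>1 * u x ^ 4 + \<beta> * ((u x)\<^sup>2 * (v x)\<^sup>2) + (M - lam1) * (u x)\<^sup>2) \<partial>lborel)"
        by (simp add: algebra_simps power2_eq_square power3_eq_cube power4_eq_xxxx)
      also have "\<dots> = ennreal (\<mu>1 * p + \<beta> * q + (M - lam1) * s)"
        using \<mu> b M by (intro real_comb) auto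
      also have "(\<integral>\<^sup>+x. ennreal ((u x)\<^sup>2 * (u x)\<^sup>2) \<partial>lborel) = ennreal p"
        by (simp add: pqs(1)[symmetric] power2_eq_square power4_eq_xxxx mult.assoc)
      finally have "ennreal p \<le> ennreal (\<delta>' * (\<mu>1 * p + \<beta> * q + (M - lam1) * s))"
        using \<delta>' by (simp only: ennreal_mult'[OF less_imp_le])
      then show ?thesis
        using \<mu> b \<delta>' M(2) pqs(4-6)
        by (simp only: ennreal_le_iff add_nonneg_nonneg mult_nonneg_nonneg less_imp_le diff_ge_0_iff_ge)
    qed
    define X where "X = \<mu>1 * p + \<beta> * q"
    have X0: "X \<ge> 0" using \<mu> b pqs by (simp add: X_def)
    have 1: "\<mu>1 * p \<le> (X + (M - lam1) * s) / 4"
    proof -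
      have "\<mu>1 * p \<le> \<mu>1 * (\<delta>' * (X + (M - lam1) * s))"
        using e3 \<mu> by (intro mult_left_mono) (auto simp: X_def)
      then show ?thesis using \<mu> by (simp add: \<delta>'_def)
    qed
    have 2: "\<beta> * q \<le> X / (4 * A)"
    proof -
      have "\<beta> * q \<le> \<beta> * (\<delta> * X)"
        using e2 b by (intro mult_left_mono) (auto simp: X_def)
      then show ?thesis using b by (simp add: \<delta>_def)
    qed
    have 3: "X / (4 * A) \<le> X / 4" using X0 A by (intro divide_left_mono) auto
    have "(M - lam1) * s \<le> M * s" using lam pqs by (intro mult_right_mono) auto
    moreover have "\<beta> * q \<le> X / 4" using 2 3 by (rule order_trans)
    \<comment> \<open>Adding the two bounds gives X \<le> X / 2 + M s / 4.\<close>
    ultimately have X: "X \<le> M * s / 2" using 1 X_def by argo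
    \<comment> \<open>Here \<open>\<beta> \<ge> \<mu>1\<close> enters: the u^4 term on the right of
      \<open>e1\<close> is absorbed by the one on the left.\<close>
    have "(lam1 - lam2) * s \<le> \<beta> * q"
    proof -
      have "\<mu>1 * p \<le> \<beta> * p" "0 \<le> \<mu>2 * q" using \<beta> \<mu> pqs by (auto intro: mult_right_mono)
      then show ?thesis using e1 by linarith
    qed
    also note 2
    also have "X / (4 * A) \<le> (M * s / 2) / (4 * A)" using X A by (intro divide_right_mono) auto
    also have "\<dots> = lam1 / 8 * s" using A by (simp add: M_def)
    finally have "(lam1 - lam2) * s \<le> lam1 / 8 * s" .
    then have "lam1 - lam2 \<le> lam1 / 8" using s by simp
    then show False using lam12 lam by linarith
  qed
qed

section \<open>Borel representatives of weak solutions\<close>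

lemma positive_borel_version:
  fixes u :: "'a::euclidean_space \<Rightarrow> real"
  assumes "u \<in> borel_measurable lebesgue" "AE x in lebesgue. u x > 0"
  obtains u0 where "u0 \<in> borel_measurable borel" "\<And>x. u0 x > 0" "AE x in lebesgue. u x = u0 x"
proof -
  obtain g where g: "g \<in> borel_measurable lborel" "AE x in lborel. u x = g x"
    using completion_ex_borel_measurable_real[OF assms(1)] by blast
  \<comment> \<open>The value 1 where g is not positive, which is a null set, makes the
    representative positive everywhere.\<close>
  define u0 where "u0 x = (if g x > 0 then g x else 1)" for x
  have "u0 \<in> borel_measurable borel" using g(1) unfolding u0_def by simp
  moreover have "u0 x > 0" for x by (simp add: u0_def)
  moreover have "AE x in lebesgue. u x = u0 x"
    using AE_completion[OF g(2)] assms(2) by eventually_elim (simp add: u0_def)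
  ultimately show ?thesis by (rule that)
qed

lemma vector_borel_version:
  fixes G :: "'a::euclidean_space \<Rightarrow> 'b::euclidean_space"
  assumes "G \<in> borel_measurable lebesgue"
  obtains G0 where "G0 \<in> borel_measurable borel" "AE x in lebesgue. G x = G0 x"
proof -
  have "\<exists>g. g \<in> borel_measurable lborel \<and> (AE x in lborel. G x \<bullet> i = g x)" for i
    using completion_ex_borel_measurable_real[of "\<lambda>x. G x \<bullet> i" lborel] assms by auto
  then obtain g where g: "\<And>i. g i \<in> borel_measurable lborel" "\<And>i. AE x in lborel. G x \<bullet> i = g i x"
    by metis
  define G0 where "G0 x = (\<Sum>i\<in>Basis. g i x *\<^sub>R i)" for x
  have "G0 \<in> borel_measurable borel" using g(1) unfolding G0_def by simp
  moreover have "AE x in lebesgue. \<forall>i\<in>(Basis::'b set). G x \<bullet> i = g i x"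
    using g(2)[THEN AE_completion] by (intro AE_finite_allI) auto
  then have "AE x in lebesgue. G x = G0 x"
  proof eventually_elim
    case (elim x)
    have "G x = (\<Sum>i\<in>Basis. (G x \<bullet> i) *\<^sub>R i)" by (rule euclidean_representation[symmetric])
    with elim show ?case by (simp add: G0_def)
  qed
  ultimately show ?thesis by (rule that)
qed

lemma lebesgue_integral_borel_version:
  fixes f f0 :: "'a::euclidean_space \<Rightarrow> 'b::euclidean_space"
  assumes "f \<in> borel_measurable lebesgue" and [measurable]: "f0 \<in> borel_measurable borel" and "AE x in lebesgue. f x = f0 x"
  shows "integral\<^sup>L lebesgue f = integral\<^sup>L lborel f0"
    and "integrable lebesgue f \<longleftrightarrow> integrable lborel f0"
proof -
  have m: "f0 \<in> borel_measurable lborel" by simp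
  note m' = measurable_completion[OF m]
  show "integral\<^sup>L lebesgue f = integral\<^sup>L lborel f0"
    using integral_cong_AE[OF assms(1) m' assms(3)] integral_completion[OF m] by simp
  show "integrable lebesgue f \<longleftrightarrow> integrable lborel f0"
    using integrable_cong_AE[OF assms(1) m' assms(3)] integrable_completion[OF m] by simp
qed

text \<open>Changes on null sets and the passage from \<open>lebesgue\<close> to
  \<open>lborel\<close> leave all integrals unchanged; the vector identities are then split into
  coordinates to fit \<open>weak_eq\<close>.\<close>

lemma weak_solution_imp_weak_eq:
  fixes u u0 h h0 :: "real^3 \<Rightarrow> real"
  assumes sol: "weak_solution lam h u" and lam: "lam > 0"
    and u0 [measurable]: "u0 \<in> borel_measurable borel" and u0_pos: "\<And>x. u0 x > 0" and u_eq: "AE x in lebesgue. u x = u0 x"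
    and h0 [measurable]: "h0 \<in> borel_measurable borel" and h0_nonneg: "\<And>x. h0 x \<ge> 0"
    and h [measurable]: "h \<in> borel_measurable lebesgue" and h_eq: "AE x in lebesgue. h x = h0 x"
  shows "\<exists>G0. weak_eq lam h0 u0 G0"
proof -
  obtain G where G: "G \<in> L2" "weak_gradient u G" and wf: "\<And>\<phi>. \<phi> \<in> test_functions \<Longrightarrow>
        (LINT x|lebesgue. G x \<bullet> grad \<phi> x) + lam * (LINT x|lebesgue. u x * \<phi> x) = (LINT x|lebesgue. h x * \<phi> x)"
    using sol unfolding weak_solution_def by blast
  have uL2: "u \<in> L2" using sol by (simp add: weak_solution_def H1_def)
  have um [measurable]: "u \<in> borel_measurable lebesgue" and Gm [measurable]: "G \<in> borel_measurable lebesgue"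
    using uL2 G(1) by (auto simp: L2_def)
  obtain G0 where G0 [measurable]: "G0 \<in> borel_measurable borel" and G_eq: "AE x in lebesgue. G x = G0 x"
    using vector_borel_version[OF Gm] by blast
  have u2: "integrable lborel (\<lambda>x. (u0 x)\<^sup>2)"
  proof -
    have "integrable lebesgue (\<lambda>x. (u x)\<^sup>2)" using uL2 by (simp add: L2_def)
    then show ?thesis
      by (subst lebesgue_integral_borel_version(2)[symmetric, of "\<lambda>x. (u x)\<^sup>2"]) (use u_eq in auto)
  qed
  have G2: "integrable lborel (\<lambda>x. (norm (G0 x))\<^sup>2)"
  proof -
    have "integrable lebesgue (\<lambda>x. (norm (G x))\<^sup>2)" using G(1) by (simp add: L2_def)
    then show ?thesis
      by (subst lebesgue_integral_borel_version(2)[symmetric, of "\<lambda>x. (norm (G x))\<^sup>2"]) (use G_eq in auto)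
  qed
  have "weak_eq lam h0 u0 G0"
  proof (rule weak_eq_intro[OF lam h0 u0 G0 u2 G2 u0_pos h0_nonneg])
    fix \<phi> :: "real^3 \<Rightarrow> real" assume \<phi>: "\<phi> \<in> test_functions"
    have sm: "smooth \<phi>" by (rule test_smooth[OF \<phi>])
    have pdm [measurable]: "pd \<phi> i \<in> borel_measurable borel" if "i \<in> Basis" for i
      using smooth_measurable[OF smooth_pd[OF sm that]] .
    have phm [measurable]: "\<phi> \<in> borel_measurable borel" by (rule smooth_measurable[OF sm])
    have grm [measurable]: "grad \<phi> \<in> borel_measurable borel"
      unfolding grad_def[abs_def] by (intro borel_measurable_sum borel_measurable_scaleR pdm) auto
    have phl [measurable]: "\<phi> \<in> borel_measurable lebesgue" and grl [measurable]: "grad \<phi> \<in> borel_measurable lebesgue"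
      using phm grm by (auto intro: measurable_completion)
    have intu: "integrable lborel (\<lambda>x. u0 x * pd \<phi> i x)" if "i \<in> Basis" for i
      by (rule integrable_mult_test(2)[OF u0 u2 \<phi> that])
    have intG: "integrable lborel (\<lambda>x. \<phi> x * (G0 x \<bullet> i))" if "i \<in> Basis" for i
      using integrable_mult_test(1)[OF _ integrable_component_sq[OF G0 G2 that] \<phi>] by (simp add: mult.commute)
    have intGp: "integrable lborel (\<lambda>x. (G0 x \<bullet> i) * pd \<phi> i x)" if "i \<in> Basis" for i
      using integrable_mult_test(2)[OF _ integrable_component_sq[OF G0 G2 that] \<phi> that] by simp
    have "(LINT x|lborel. u0 x *\<^sub>R grad \<phi> x) = (LINT x|lebesgue. u x *\<^sub>R grad \<phi> x)"
      by (rule lebesgue_integral_borel_version(1)[symmetric]) (use u_eq in auto)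
    also have "\<dots> = - (LINT x|lebesgue. \<phi> x *\<^sub>R G x)"
      using G(2) \<phi> by (simp add: weak_gradient_def)
    also have "(LINT x|lebesgue. \<phi> x *\<^sub>R G x) = (LINT x|lborel. \<phi> x *\<^sub>R G0 x)"
      by (rule lebesgue_integral_borel_version(1)) (use G_eq in auto)
    finally have vec: "(LINT x|lborel. u0 x *\<^sub>R grad \<phi> x) = - (LINT x|lborel. \<phi> x *\<^sub>R G0 x)" .
    \<comment> \<open>The vector identity passes to coordinates through
      \<open>integral_inner_left\<close>, which asks for integrability of both vector
      functions.\<close>
    have "integrable lborel (\<lambda>x. \<Sum>i\<in>Basis. (u0 x * pd \<phi> i x) *\<^sub>R i)"
      by (intro Bochner_Integration.integrable_sum integrable_scaleR_left intu)
    then have I1: "integrable lborel (\<lambda>x. u0 x *\<^sub>R grad \<phi> x)"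
      by (simp add: grad_def scaleR_sum_right)
    have "integrable lborel (\<lambda>x. \<Sum>i\<in>Basis. (\<phi> x * (G0 x \<bullet> i)) *\<^sub>R i)"
      by (intro Bochner_Integration.integrable_sum integrable_scaleR_left intG)
    moreover have "(\<Sum>i\<in>Basis. (\<phi> x * (G0 x \<bullet> i)) *\<^sub>R i) = \<phi> x *\<^sub>R G0 x" for x
      by (simp only: scaleR_scaleR[symmetric] scaleR_sum_right[symmetric] euclidean_representation)
    ultimately have I2: "integrable lborel (\<lambda>x. \<phi> x *\<^sub>R G0 x)" by simp
    show "(LINT x|lborel. u0 x * pd \<phi> i x) = - (LINT x|lborel. \<phi> x * (G0 x \<bullet> i))" if i: "i \<in> Basis" for i
      using arg_cong[OF vec, of "\<lambda>y. y \<bullet> i"] integral_inner_left[of i lborel, OF I1] integral_inner_left[of i lborel, OF I2]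
      by (simp add: grad_inner[OF i])
    have "(LINT x|lborel. G0 x \<bullet> grad \<phi> x) = (LINT x|lebesgue. G x \<bullet> grad \<phi> x)"
      by (rule lebesgue_integral_borel_version(1)[symmetric]) (use G_eq in auto)
    moreover have "(LINT x|lborel. u0 x * \<phi> x) = (LINT x|lebesgue. u x * \<phi> x)"
      by (rule lebesgue_integral_borel_version(1)[symmetric]) (use u_eq in auto)
    moreover have "(LINT x|lborel. h0 x * \<phi> x) = (LINT x|lebesgue. h x * \<phi> x)"
      by (rule lebesgue_integral_borel_version(1)[symmetric]) (use h_eq in auto)
    moreover have "(LINT x|lborel. G0 x \<bullet> grad \<phi> x) = (\<Sum>i\<in>Basis. LINT x|lborel. (G0 x \<bullet> i) * pd \<phi> i x)"
      unfolding inner_grad by (rule Bochner_Integration.integral_sum) (rule intGp)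
    ultimately show "(\<Sum>i\<in>Basis. LINT x|lborel. (G0 x \<bullet> i) * pd \<phi> i x) + lam * (LINT x|lborel. u0 x * \<phi> x) = (LINT x|lborel. h0 x * \<phi> x)"
      using wf[OF \<phi>] by simp
  qed
  then show ?thesis by blast
qed

lemma positive_solution_imp_weak_eq:
  assumes sol: "positive_solution \<mu>1 \<mu>2 \<beta> lam1 lam2 u v"
    and pos: "\<mu>1 > 0" "\<mu>2 > 0" "\<beta> > 0" "lam1 > 0" "lam2 > 0"
  obtains u0 v0 G1 G2 where "weak_eq lam1 (\<lambda>x. \<mu>1 * u0 x ^ 3 + \<beta> * u0 x * (v0 x)\<^sup>2) u0 G1"
    "weak_eq lam2 (\<lambda>x. \<mu>2 * v0 x ^ 3 + \<beta> * v0 x * (u0 x)\<^sup>2) v0 G2"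
proof -
  have um: "u \<in> borel_measurable lebesgue" and vm: "v \<in> borel_measurable lebesgue"
    using sol by (auto simp: positive_solution_def H1_def L2_def)
  obtain u0 where u0 [measurable]: "u0 \<in> borel_measurable borel" "\<And>x. u0 x > 0" and ueq: "AE x in lebesgue. u x = u0 x"
    using positive_borel_version[OF um] sol unfolding positive_solution_def by metis
  obtain v0 where v0 [measurable]: "v0 \<in> borel_measurable borel" "\<And>x. v0 x > 0" and veq: "AE x in lebesgue. v x = v0 x"
    using positive_borel_version[OF vm] sol unfolding positive_solution_def by metis
  have "\<exists>G1. weak_eq lam1 (\<lambda>x. \<mu>1 * u0 x ^ 3 + \<beta> * u0 x * (v0 x)\<^sup>2) u0 G1"
  proof (rule weak_solution_imp_weak_eq[OF _ pos(4) u0 ueq])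
    show "weak_solution lam1 (\<lambda>x. \<mu>1 * u x ^ 3 + \<beta> * u x * (v x)\<^sup>2) u"
      using sol by (simp add: positive_solution_def solution_def)
    show "0 \<le> \<mu>1 * u0 x ^ 3 + \<beta> * u0 x * (v0 x)\<^sup>2" for x
      using pos u0(2)[of x] v0(2)[of x] by simp
    show "AE x in lebesgue. \<mu>1 * u x ^ 3 + \<beta> * u x * (v x)\<^sup>2 = \<mu>1 * u0 x ^ 3 + \<beta> * u0 x * (v0 x)\<^sup>2"
      using ueq veq by eventually_elim simp
  qed (use um vm in measurable)
  moreover have "\<exists>G2. weak_eq lam2 (\<lambda>x. \<mu>2 * v0 x ^ 3 + \<beta> * v0 x * (u0 x)\<^sup>2) v0 G2"
  proof (rule weak_solution_imp_weak_eq[OF _ pos(5) v0 veq])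
    show "weak_solution lam2 (\<lambda>x. \<mu>2 * v x ^ 3 + \<beta> * v x * (u x)\<^sup>2) v"
      using sol by (simp add: positive_solution_def solution_def)
    show "0 \<le> \<mu>2 * v0 x ^ 3 + \<beta> * v0 x * (u0 x)\<^sup>2" for x
      using pos u0(2)[of x] v0(2)[of x] by simp
    show "AE x in lebesgue. \<mu>2 * v x ^ 3 + \<beta> * v x * (u x)\<^sup>2 = \<mu>2 * v0 x ^ 3 + \<beta> * v0 x * (u0 x)\<^sup>2"
      using ueq veq by eventually_elim simp
  qed (use um vm in measurable)
  ultimately show ?thesis using that by blast
qed

section \<open>Exchange of the two components and the conclusion\<close>

lemma positive_solution_swap:
  "positive_solution \<mu>1 \<mu>2 \<beta> lam1 lam2 u v \<longleftrightarrow> positive_solution \<mu>2 \<mu>1 \<beta> lam2 lam1 v u"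
  by (auto simp: positive_solution_def solution_def)

lemma no_positive_solution_large_ratio:
  fixes \<mu>1 \<mu>2 \<beta> :: real
  assumes \<mu>: "\<mu>1 > 0" "\<mu>2 > 0" and \<beta>: "\<beta> \<ge> \<mu>1"
  obtains \<eta> where "\<eta> > 0"
    "\<And>lam1 lam2 u v. lam1 > 0 \<Longrightarrow> lam2 > 0 \<Longrightarrow> lam1 / lam2 > \<eta> \<Longrightarrow> \<not> positive_solution \<mu>1 \<mu>2 \<beta> lam1 lam2 u v"
proof -
  obtain \<eta> where \<eta>: "\<eta> > 0" and no: "\<And>lam1 lam2 u v G1 G2. lam1 > 0 \<Longrightarrow> lam2 > 0 \<Longrightarrow> lam1 / lam2 > \<eta> \<Longrightarrow>
      weak_eq lam1 (\<lambda>x. \<mu>1 * u x ^ 3 + \<beta> * u x * (v x)\<^sup>2) u G1 \<Longrightarrow>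
      weak_eq lam2 (\<lambda>x. \<mu>2 * v x ^ 3 + \<beta> * v x * (u x)\<^sup>2) v G2 \<Longrightarrow> False"
    using no_coupled_pair[OF \<mu> \<beta>] by blast
  show ?thesis
  proof (rule that[OF \<eta>], rule notI)
    fix lam1 lam2 u v
    assume lam: "lam1 > 0" "lam2 > 0" "lam1 / lam2 > \<eta>" and sol: "positive_solution \<mu>1 \<mu>2 \<beta> lam1 lam2 u v"
    have "\<beta> > 0" using \<mu> \<beta> by simp
    from positive_solution_imp_weak_eq[OF sol \<mu> this lam(1,2)] no[OF lam] show False by blast
  qed
qed

theorem theorem2p4:
  fixes \<mu>1 \<mu>2 :: real
  assumes "\<mu>1 > 0" and "\<mu>2 > 0"
  shows
    "(\<forall>\<beta>\<ge>\<mu>1. \<exists>\<eta>1>0. \<forall>lam1>0. \<forall>lam2>0.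
        lam1 / lam2 > \<eta>1 \<longrightarrow> \<not> (\<exists>u v. positive_solution \<mu>1 \<mu>2 \<beta> lam1 lam2 u v))
     \<and>
     (\<forall>\<beta>\<ge>\<mu>2. \<exists>\<eta>2>0. \<forall>lam1>0. \<forall>lam2>0.
        lam1 / lam2 < \<eta>2 \<longrightarrow> \<not> (\<exists>u v. positive_solution \<mu>1 \<mu>2 \<beta> lam1 lam2 u v))"
proof (intro conjI allI impI)
  fix \<beta> assume "\<beta> \<ge> \<mu>1"
  then show "\<exists>\<eta>1>0. \<forall>lam1>0. \<forall>lam2>0.
        lam1 / lam2 > \<eta>1 \<longrightarrow> \<not> (\<exists>u v. positive_solution \<mu>1 \<mu>2 \<beta> lam1 lam2 u v)"
    using no_positive_solution_large_ratio[OF assms] by metis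
next
  fix \<beta> assume "\<beta> \<ge> \<mu>2"
  then obtain \<eta> where \<eta>: "\<eta> > 0" and no: "\<And>lam1 lam2 u v. lam1 > 0 \<Longrightarrow> lam2 > 0 \<Longrightarrow> lam1 / lam2 > \<eta> \<Longrightarrow>
      \<not> positive_solution \<mu>2 \<mu>1 \<beta> lam1 lam2 u v"
    using no_positive_solution_large_ratio[OF assms(2,1)] by metis
  show "\<exists>\<eta>2>0. \<forall>lam1>0. \<forall>lam2>0.
        lam1 / lam2 < \<eta>2 \<longrightarrow> \<not> (\<exists>u v. positive_solution \<mu>1 \<mu>2 \<beta> lam1 lam2 u v)"
  \<comment> \<open>The exchange inverts the ratio, so the threshold becomes its reciprocal.\<close>
  proof (intro exI[of _ "1 / \<eta>"] conjI allI impI notI)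
    show "1 / \<eta> > 0" using \<eta> by simp
    fix lam1 lam2 :: real assume lam: "lam1 > 0" "lam2 > 0" "lam1 / lam2 < 1 / \<eta>"
    then have "lam2 / lam1 > \<eta>" using \<eta> by (simp add: field_simps)
    moreover assume "\<exists>u v. positive_solution \<mu>1 \<mu>2 \<beta> lam1 lam2 u v"
    ultimately show False
      using no[OF lam(2,1)] positive_solution_swap by blast
  qed
qed

end
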